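(* Let $D\subset\mathbb{C}^n$ be a bounded domain, let $\varphi\in C^2(D)$ be a real-valued function, and let $r$ be an integer with $1\leq r\leq n$. Suppose there exists a non-zero holomorphic function $f\in A^2(D,\varphi)$ such that for every $g=(g_1,\ldots,g_{r+1})\in(\mathcal{O}(D))^{\oplus(r+1)}$ with $g_1,\ldots,g_{r+1}$ having no common zeros in $D$ and $dg_1\wedge\cdots\wedge dg_r\neq 0$ on $D$, and every smooth plurisubharmonic function $\psi$ on $D$ satisfying $$i\partial\bar\partial\psi\otimes\operatorname{Id}_{\underline{\mathbb{C}}^{r+1}}+i\beta^*\wedge\beta>0$$ in the sense of Nakano and $I_{\varphi,\psi,g}(f)<\infty$, there exists $h=(h_1,\ldots,h_{r+1})\in(\mathcal{O}(D))^{\oplus(r+1)}$ such that $f=g\cdot h$ and $$\|h\|^2_{\varphi+\psi}\leq I_{\varphi,\psi,g}(f).$$ Then, at every point of $D$, the sum of any $r$ eigenvalues (counted with multiplicity) of $i\partial\bar\partial\varphi$, with respect to the Euclidean metric, is non-negative.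
   Context: Notation. $\mathcal{O}(D)$ is the space of holomorphic functions on $D$; $dV$ is Lebesgue measure; $A^2(D,\varphi)$ is the set of $f\in\mathcal{O}(D)$ with $\int_D|f|^2e^{-\varphi}dV<\infty$ (the paper assumes throughout that $A^2(D,\varphi)\neq\{0\}$). Put $k=r+1$. For $h=(h_1,\ldots,h_k)$, $|h|^2=\sum_\lambda|h_\lambda|^2$, $g\cdot h=\sum_\lambda g_\lambda h_\lambda$, and $\|h\|^2_{\varphi}=\int_D|h|^2e^{-\varphi}dV$ for any weight $\varphi$. $\underline{\mathbb{C}}^k$ is the trivial bundle of rank $k$ over $D$ with standard metric and standard frame $e_1,\ldots,e_k$. On $\mathbb{C}^n$ use the standard Euclidean metric $\omega=i\sum_j dz_j\wedge d\bar z_j$, normalized so that $dz_1,\ldots,dz_n$ are orthonormal; $dz=dz_1\wedge\cdots\wedge dz_n$; $\Lambda$ is the pointwise adjoint of $L=\omega\wedge\cdot$. The eigenvalues of $i\partial\bar\partial\varphi$ at a point are those of the Hermitian matrix $(\partial^2\varphi/\partial z_j\partial\bar z_l)$. Second fundamental form. If $g_1,\ldots,g_k$ have no common zeros, $g$ defines a surjective morphism $\underline{\mathbb{C}}^k\to\underline{\mathbb{C}}$, $h\mapsto g\cdot h$, with kernel $S=\operatorname{Ker} g$. The quotient $\underline{\mathbb{C}}$ carries the quotient metric $|q|^2/|g|^2$. The second fundamental form of $S$ is $$\beta=|g|^2\Big(-\partial\big(\tfrac{g_1}{|g|^2}\big),\ldots,-\partial\big(\tfrac{g_k}{|g|^2}\big)\Big),$$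 a $(1,0)$-form with values in $\operatorname{Hom}(\underline{\mathbb{C}}^k,\underline{\mathbb{C}})$ (vanishing on $S^\perp$). Its adjoint with respect to these metrics is the $S$-valued $(0,1)$-form $\beta^*=-\bar\partial g^*$, where $g^*=(\bar g_1/|g|^2,\ldots,\bar g_k/|g|^2)$. Positivity. Writing $\beta=\sum_j dz_j\otimes\beta_j$, one has $\beta^*\wedge\beta=-\sum_{j,l}dz_j\wedge d\bar z_l\otimes\beta_l^*\beta_j$. The condition $i\partial\bar\partial\psi\otimes\operatorname{Id}_{\underline{\mathbb{C}}^k}+i\beta^*\wedge\beta>0$ in the sense of Nakano means that at each point of $D$, for every non-zero $(u_{j\lambda})_{1\leq j\leq n,\,1\leq\lambda\leq k}$, with $u_j=(u_{j1},\ldots,u_{jk})\in\mathbb{C}^k$, $$\sum_{j,l}\frac{\partial^2\psi}{\partial z_j\partial\bar z_l}\langle u_j,u_l\rangle-\frac{1}{|g|^2}\Big|\sum_j\beta_j(u_j)\Big|^2>0.$$ The operator $[i\partial\bar\partial\psi\otimes\operatorname{Id}_{\underline{\mathbb{C}}^k}+i\beta^*\wedge\beta,\Lambda]$ acting on $\underline{\mathbb{C}}^k$-valued $(n,1)$-forms $u=\sum_{j,\lambda}u_{j\lambda}\,dz\wedge d\bar z_j\otimes e_\lambda$ is the self-adjoint operator whose quadratic form $\langle[\cdot,\Lambda]u,u\rangle$ is the left-hand side above. The functional. With $(\cdot,\cdot)$ the pointwise inner product on $(n,1)$-forms, $$I_{\varphi,\psi,g}(f)=\int_D\Big\{\frac{1}{|g|^2}+\Big(\big[i\partial\bar\partial\psi\otimes\operatorname{Id}_{\underline{\mathbb{C}}^k}+i\beta^*\wedge\beta,\Lambda\big]^{-1}\beta^*\wedge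 dz,\ \beta^*\wedge dz\Big)\Big\}|f|^2e^{-\varphi-\psi}dV.$$ *)

theory Defs
  imports "HOL-Analysis.Analysis"
begin

section \<open>Functions of several complex variables\<close>

text \<open>The space \<open>\<O>(D)\<close> for open \<open>D\<close>; only the values on \<open>D\<close> matter.\<close>

definition holomorphic_functions :: "(complex ^ 'n) set \<Rightarrow> (complex ^ 'n \<Rightarrow> complex) set" where
  "holomorphic_functions D =
     {f. \<forall>z\<in>D. \<exists>L. (f has_derivative L) (at z) \<and> (\<forall>c v. L (c *s v) = c * L v)}"

text \<open>\<open>C\<^sup>k\<close> regularity (in the real sense) on an open set.\<close>

primrec Ck_on ::
  "nat \<Rightarrow> ('a::real_normed_vector \<Rightarrow> 'b::real_normed_vector) \<Rightarrow> 'a set \<Rightarrow> bool" where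
  "Ck_on 0 f D \<longleftrightarrow> continuous_on D f"
| "Ck_on (Suc k) f D \<longleftrightarrow> (\<forall>x\<in>D. f differentiable (at x)) \<and>
     (\<forall>v. Ck_on k (\<lambda>x. frechet_derivative f (at x) v) D)"

definition smooth_on :: "('a::real_normed_vector \<Rightarrow> 'b::real_normed_vector) \<Rightarrow> 'a set \<Rightarrow> bool" where
  "smooth_on f D \<longleftrightarrow> (\<forall>k. Ck_on k f D)"

text \<open>The Wirtinger derivatives \<open>\<partial>/\<partial>z\<^sub>j\<close> and \<open>\<partial>/\<partial>\<bar>z\<^sub>j\<close>.\<close>

definition d_z :: "'n \<Rightarrow> (complex ^ 'n \<Rightarrow> complex) \<Rightarrow> complex ^ 'n \<Rightarrow> complex" where
  "d_z j f z = (frechet_derivative f (at z) (axis j 1)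
                - \<i> * frechet_derivative f (at z) (axis j \<i>)) / 2"

definition d_zbar :: "'n \<Rightarrow> (complex ^ 'n \<Rightarrow> complex) \<Rightarrow> complex ^ 'n \<Rightarrow> complex" where
  "d_zbar j f z = (frechet_derivative f (at z) (axis j 1)
                   + \<i> * frechet_derivative f (at z) (axis j \<i>)) / 2"

text \<open>The matrix \<open>(\<partial>\<^sup>2u/\<partial>z\<^sub>j\<partial>\<bar>z\<^sub>l)\<close> of \<open>i\<partial>\<bar>\<partial>u\<close>.\<close>

definition levi :: "(complex ^ 'n \<Rightarrow> real) \<Rightarrow> complex ^ 'n \<Rightarrow> complex ^ 'n ^ 'n" where
  "levi u z = (\<chi> j l. d_z j (d_zbar l (\<lambda>w. of_real (u w))) z)"

text \<open>Plurisubharmonicity of real-valued functions (the value \<open>-\<infinity>\<close> is not needed): upper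
  semicontinuity and the sub-mean value property on every closed complex disc inside \<open>D\<close>.\<close>

definition plurisubharmonic_on :: "(complex ^ 'n \<Rightarrow> real) \<Rightarrow> (complex ^ 'n) set \<Rightarrow> bool" where
  "plurisubharmonic_on u D \<longleftrightarrow>
     (\<forall>z\<in>D. \<forall>c>u z. \<forall>\<^sub>F w in at z within D. u w < c) \<and>
     (\<forall>z w. (\<forall>\<zeta>. norm \<zeta> \<le> 1 \<longrightarrow> z + \<zeta> *s w \<in> D) \<longrightarrow>
        u z \<le> integral {0..2 * pi} (\<lambda>t. u (z + cis t *s w)) / (2 * pi))"

text \<open>Eigenvalues with multiplicity, as roots of the characteristic polynomial.\<close>

definition char_polynomial :: "complex ^ 'n ^ 'n \<Rightarrow> complex poly" where
  "char_polynomial A = det (\<chi> i j. (if i = j then [:0, 1:] else 0) - [:A $ i $ j:])"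

definition eigenvalues :: "complex ^ 'n ^ 'n \<Rightarrow> complex multiset" where
  "eigenvalues A = proots (char_polynomial A)"

section \<open>Weighted spaces\<close>

text \<open>Lebesgue measure of \<open>complex ^ 'n\<close> as a real Euclidean space is \<open>dV\<close>; \<open>norm\<close> on
  \<open>complex ^ 'k\<close> is the Hermitian norm. The squared norm may be infinite.\<close>

definition weighted_norm_sq ::
  "(complex ^ 'n) set \<Rightarrow> (complex ^ 'n \<Rightarrow> real) \<Rightarrow> (complex ^ 'n \<Rightarrow> 'b::real_normed_vector) \<Rightarrow> ennreal"
  where "weighted_norm_sq D \<phi> h = (\<integral>\<^sup>+ z\<in>D. ennreal ((norm (h z))\<^sup>2 * exp (- \<phi> z)) \<partial>lborel)"

definition A2 ::
  "(complex ^ 'n) set \<Rightarrow> (complex ^ 'n \<Rightarrow> real) \<Rightarrow> (complex ^ 'n \<Rightarrow> complex) set" where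
  "A2 D \<phi> = {f \<in> holomorphic_functions D. weighted_norm_sq D \<phi> f < \<infinity>}"

section \<open>The morphism \<open>g\<close> and its second fundamental form\<close>

text \<open>The bilinear pairing \<open>g \<cdot> h\<close>, and the Hermitian inner products on \<open>\<complex>\<^sup>k\<close> and on the
  coefficients \<open>(u\<^sub>j\<^sub>\<lambda>)\<close> of \<open>(n,1)\<close>-forms in the orthonormal frame
  \<open>dz \<and> d\<bar>z\<^sub>j \<otimes> e\<^sub>\<lambda>\<close>. Such coefficients are elements \<open>u\<close> of \<open>complex ^ 'k ^ 'n\<close> with
  \<open>u\<^sub>j = u $ j\<close>.\<close>

definition dot :: "complex ^ 'k \<Rightarrow> complex ^ 'k \<Rightarrow> complex" where
  "dot g h = (\<Sum>\<nu>\<in>UNIV. g $ \<nu> * h $ \<nu>)"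

definition herm :: "complex ^ 'k \<Rightarrow> complex ^ 'k \<Rightarrow> complex" where
  "herm u v = (\<Sum>\<nu>\<in>UNIV. u $ \<nu> * cnj (v $ \<nu>))"

definition herm_form :: "complex ^ 'k ^ 'n \<Rightarrow> complex ^ 'k ^ 'n \<Rightarrow> complex" where
  "herm_form u v = (\<Sum>j\<in>UNIV. herm (u $ j) (v $ j))"

text \<open>\<open>g = (g\<^sub>1, \<dots>, g\<^sub>r\<^sub>+\<^sub>1)\<close> is indexed by \<open>'r option\<close> with \<open>CARD('r) = r\<close>: the indices
  \<open>Some i\<close> stand for \<open>1, \<dots>, r\<close> and \<open>None\<close> for \<open>r + 1\<close>. The following is the value of
  \<open>dg\<^sub>1 \<and> \<dots> \<and> dg\<^sub>r\<close> at \<open>z\<close> on the vectors \<open>v\<close>; the enumeration of \<open>'r\<close> does not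
  matter if it is the same for forms and vectors.\<close>

definition wedge_dg ::
  "(complex ^ 'n \<Rightarrow> complex ^ ('r::finite option)) \<Rightarrow> complex ^ 'n \<Rightarrow> ('r \<Rightarrow> complex ^ 'n) \<Rightarrow> complex"
  where "wedge_dg g z v =
    det (\<chi> i j. frechet_derivative (\<lambda>w. g w $ Some i) (at z) (v j) :: complex ^ 'r ^ 'r)"

text \<open>\<open>beta g z $ j\<close> is the coefficient \<open>\<beta>\<^sub>j\<close> of \<open>dz\<^sub>j\<close> in \<open>\<beta>\<close>, acting on
  \<open>\<complex>\<^sup>k\<close> by \<open>dot\<close>; \<open>beta_star g z $ j\<close> is the coefficient of \<open>d\<bar>z\<^sub>j\<close> in
  \<open>\<beta>\<^sup>* = -\<bar>\<partial>g\<^sup>*\<close>.\<close>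

definition beta :: "(complex ^ 'n \<Rightarrow> complex ^ 'k) \<Rightarrow> complex ^ 'n \<Rightarrow> complex ^ 'k ^ 'n" where
  "beta g z = (\<chi> j \<nu>. of_real ((norm (g z))\<^sup>2) *
     (- d_z j (\<lambda>w. g w $ \<nu> / of_real ((norm (g w))\<^sup>2)) z))"

definition g_star :: "(complex ^ 'n \<Rightarrow> complex ^ 'k) \<Rightarrow> complex ^ 'n \<Rightarrow> complex ^ 'k" where
  "g_star g z = (\<chi> \<nu>. cnj (g z $ \<nu>) / of_real ((norm (g z))\<^sup>2))"

definition beta_star :: "(complex ^ 'n \<Rightarrow> complex ^ 'k) \<Rightarrow> complex ^ 'n \<Rightarrow> complex ^ 'k ^ 'n" where
  "beta_star g z = (\<chi> j \<nu>. - d_zbar j (\<lambda>w. g_star g w $ \<nu>) z)"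

text \<open>The Nakano form. It takes real values because \<open>levi \<psi> z\<close> is Hermitian for
  \<open>\<psi>\<close> of class \<open>C\<^sup>2\<close>, so that positivity may be tested on the real part.\<close>

definition nakano_form ::
  "(complex ^ 'n \<Rightarrow> real) \<Rightarrow> (complex ^ 'n \<Rightarrow> complex ^ 'k) \<Rightarrow> complex ^ 'n \<Rightarrow> complex ^ 'k ^ 'n \<Rightarrow> complex"
  where "nakano_form \<psi> g z u =
    (\<Sum>j\<in>UNIV. \<Sum>l\<in>UNIV. levi \<psi> z $ j $ l * herm (u $ j) (u $ l))
    - of_real (1 / (norm (g z))\<^sup>2 * (norm (\<Sum>j\<in>UNIV. dot (beta g z $ j) (u $ j)))\<^sup>2)"

definition nakano_positive ::
  "(complex ^ 'n) set \<Rightarrow> (complex ^ 'n \<Rightarrow> real) \<Rightarrow> (complex ^ 'n \<Rightarrow> complex ^ 'k) \<Rightarrow> bool" where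
  "nakano_positive D \<psi> g \<longleftrightarrow> (\<forall>z\<in>D. \<forall>u. u \<noteq> 0 \<longrightarrow> 0 < Re (nakano_form \<psi> g z u))"

text \<open>The operator \<open>[i\<partial>\<bar>\<partial>\<psi> \<otimes> Id + i\<beta>\<^sup>* \<and> \<beta>, \<Lambda>]\<close> on \<open>(n,1)\<close>-forms: the curvature
  \<open>\<Sum>\<^sub>j\<^sub>l dz\<^sub>j \<and> d\<bar>z\<^sub>l \<otimes> \<Theta>\<^sub>j\<^sub>l\<close> with \<open>\<Theta>\<^sub>j\<^sub>l = \<psi>\<^sub>j\<^sub>l Id - \<beta>\<^sub>l\<^sup>*\<beta>\<^sub>j\<close> sends \<open>u\<close> to
  \<open>(\<Sum>\<^sub>j \<Theta>\<^sub>j\<^sub>l u\<^sub>j)\<^sub>l\<close>. The lemmas below show that it is complex linear with quadratic form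
  \<open>nakano_form\<close>, which determines it.\<close>

definition curv_op ::
  "(complex ^ 'n \<Rightarrow> real) \<Rightarrow> (complex ^ 'n \<Rightarrow> complex ^ 'k) \<Rightarrow> complex ^ 'n \<Rightarrow> complex ^ 'k ^ 'n \<Rightarrow> complex ^ 'k ^ 'n"
  where "curv_op \<psi> g z u =
    (\<chi> l. \<Sum>j\<in>UNIV. levi \<psi> z $ j $ l *s (u $ j) - dot (beta g z $ j) (u $ j) *s (beta_star g z $ l))"

text \<open>Coefficients of \<open>\<beta>\<^sup>* \<and> dz\<close>, using \<open>d\<bar>z\<^sub>j \<and> dz = (-1)\<^sup>n dz \<and> d\<bar>z\<^sub>j\<close>.\<close>

definition beta_star_wedge_dz ::
  "(complex ^ 'n \<Rightarrow> complex ^ 'k) \<Rightarrow> complex ^ 'n \<Rightarrow> complex ^ 'k ^ 'n" where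
  "beta_star_wedge_dz g z = (\<chi> j. (- 1) ^ CARD('n) *s (beta_star g z $ j))"

text \<open>The integrand is non-negative, and \<open>curv_op\<close> is bijective, whenever
  \<open>nakano_positive D \<psi> g\<close> holds; the functional is only used under this assumption.\<close>

definition I_functional ::
  "(complex ^ 'n) set \<Rightarrow> (complex ^ 'n \<Rightarrow> real) \<Rightarrow> (complex ^ 'n \<Rightarrow> real) \<Rightarrow>
   (complex ^ 'n \<Rightarrow> complex ^ 'k) \<Rightarrow> (complex ^ 'n \<Rightarrow> complex) \<Rightarrow> ennreal" where
  "I_functional D \<phi> \<psi> g f =
    (\<integral>\<^sup>+ z\<in>D. ennreal
       ((1 / (norm (g z))\<^sup>2 +
         Re (herm_form (inv (curv_op \<psi> g z) (beta_star_wedge_dz g z)) (beta_star_wedge_dz g z)))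
        * (norm (f z))\<^sup>2 * exp (- \<phi> z - \<psi> z)) \<partial>lborel)"

section \<open>Consistency of the conventions\<close>

lemma d_zbar_cnj:
  assumes "F differentiable (at z)"
  shows "d_zbar j (\<lambda>w. cnj (F w)) z = cnj (d_z j F z)"
proof -
  have "((\<lambda>w. cnj (F w)) has_derivative (\<lambda>v. cnj (frechet_derivative F (at z) v))) (at z)"
    using assms by (intro has_derivative_cnj) (simp add: frechet_derivative_works)
  from frechet_derivative_at[OF this, symmetric]
  show ?thesis by (simp add: d_zbar_def d_z_def)
qed

text \<open>\<open>beta_star\<close> is the adjoint of \<open>beta\<close> for the quotient metric \<open>|q|\<^sup>2/|g|\<^sup>2\<close>.\<close>

lemma beta_star_adjoint:
  fixes g :: "complex ^ 'n \<Rightarrow> complex ^ 'k"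
  assumes "\<And>\<nu>. (\<lambda>w. g w $ \<nu>) \<in> holomorphic_functions D" and "z \<in> D" and "g z \<noteq> 0"
  shows "beta_star g z $ j $ \<nu> = cnj (beta g z $ j $ \<nu>) / of_real ((norm (g z))\<^sup>2)"
proof -
  have comp: "(\<lambda>w. g w $ \<mu>) differentiable (at z)" for \<mu>
    using assms(1)[of \<mu>] assms(2) by (auto simp: holomorphic_functions_def differentiable_def)
  have nrm: "of_real ((norm (x :: complex ^ 'k))\<^sup>2) = (\<Sum>\<mu>\<in>UNIV. x $ \<mu> * cnj (x $ \<mu>))" for x
    unfolding norm_vec_def L2_set_def
    by (simp add: sum_nonneg complex_norm_square[symmetric] flip: of_real_power)
  have "(\<lambda>w. g w $ \<mu> * cnj (g w $ \<mu>)) differentiable (at z)" for \<mu>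
  proof -
    obtain L where "((\<lambda>w. g w $ \<mu>) has_derivative L) (at z)"
      using comp[of \<mu>] by (auto simp: differentiable_def)
    from has_derivative_mult[OF this has_derivative_cnj[OF this]] show ?thesis
      by (rule differentiableI)
  qed
  hence "(\<lambda>w. of_real ((norm (g w))\<^sup>2) :: complex) differentiable (at z)"
    unfolding nrm by (intro differentiable_sum) auto
  hence "(\<lambda>w. g w $ \<nu> / of_real ((norm (g w))\<^sup>2)) differentiable (at z)"
    using comp assms(3) by (intro differentiable_divide) auto
  from d_zbar_cnj[OF this, of j] show ?thesis
    using assms(3) by (simp add: beta_star_def beta_def g_star_def)
qed

lemma herm_form_curv_op:
  fixes g :: "complex ^ 'n \<Rightarrow> complex ^ 'k"
  assumes "\<And>\<nu>. (\<lambda>w. g w $ \<nu>) \<in> holomorphic_functions D" and "z \<in> D" and "g z \<noteq> 0"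
  shows "herm_form (curv_op \<psi> g z u) u = nakano_form \<psi> g z u"
proof -
  define q where "q = (\<Sum>j\<in>UNIV. dot (beta g z $ j) (u $ j))"
  have star: "herm (beta_star g z $ l) (u $ l)
      = cnj (dot (beta g z $ l) (u $ l)) / of_real ((norm (g z))\<^sup>2)" for l
    by (simp add: herm_def dot_def beta_star_adjoint[OF assms] sum_divide_distrib)
  have lin: "herm (\<Sum>j\<in>UNIV. a j *s x j - b j *s y) w
      = (\<Sum>j\<in>UNIV. a j * herm (x j) w) - (\<Sum>j\<in>UNIV. b j) * herm y w"
    for a b :: "'n \<Rightarrow> complex" and x :: "'n \<Rightarrow> complex ^ 'k" and y w
  proof -
    have "herm (\<Sum>j\<in>UNIV. a j *s x j - b j *s y) w
        = (\<Sum>j\<in>UNIV. \<Sum>\<nu>\<in>UNIV. (a j * x j $ \<nu> - b j * y $ \<nu>) * cnj (w $ \<nu>))"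
      unfolding herm_def by (subst sum.swap) (simp add: sum_distrib_right)
    also have "\<dots> = (\<Sum>j\<in>UNIV. a j * herm (x j) w - b j * herm y w)"
      by (simp add: herm_def algebra_simps sum_subtractf sum_distrib_left)
    finally show ?thesis by (simp add: sum_subtractf sum_distrib_right)
  qed
  have "herm_form (curv_op \<psi> g z u) u =
      (\<Sum>l\<in>UNIV. (\<Sum>j\<in>UNIV. levi \<psi> z $ j $ l * herm (u $ j) (u $ l))
         - q * (cnj (dot (beta g z $ l) (u $ l)) / of_real ((norm (g z))\<^sup>2)))"
    by (simp add: herm_form_def curv_op_def lin star q_def)
  also have "\<dots> = (\<Sum>l\<in>UNIV. \<Sum>j\<in>UNIV. levi \<psi> z $ j $ l * herm (u $ j) (u $ l))
      - q * cnj q / of_real ((norm (g z))\<^sup>2)"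
    by (simp add: sum_subtractf q_def sum_distrib_left sum_divide_distrib)
  also have "\<dots> = nakano_form \<psi> g z u"
    unfolding nakano_form_def q_def[symmetric]
    by (subst sum.swap) (simp add: complex_norm_square[symmetric] field_simps)
  finally show ?thesis .
qed

lemma curv_op_linear:
  "curv_op \<psi> g z (u + v) = curv_op \<psi> g z u + curv_op \<psi> g z v"
  "curv_op \<psi> g z (\<chi> j. c *s (u $ j)) = (\<chi> j. c *s (curv_op \<psi> g z u $ j))"
  by (simp_all add: curv_op_def dot_def vec_eq_iff algebra_simps sum.distrib sum_subtractf
      sum_distrib_left)

end

theory Submission
  imports Defs "HOL-Complex_Analysis.Conformal_Mappings" "HOL-Probability.Distributions"
begin

text \<open>Let \<open>z\<^sub>0\<close> be a point where some sum of \<open>r\<close> eigenvalues of \<open>i\<partial>\<bar>\<partial>\<phi>\<close> is negative, and let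
\<open>v\<^sub>1, \<dots>, v\<^sub>r\<close> be orthonormal eigenvectors for these eigenvalues. The trace of the Levi form over the
frame \<open>v\<^sub>1, \<dots>, v\<^sub>r\<close> depends continuously on the base point, and the zeros of \<open>f\<close> are nowhere dense in
\<open>D\<close>; so the trace is still negative at a nearby point \<open>a\<close> with \<open>f a \<noteq> 0\<close>. At \<open>a\<close> the vectors need not be
eigenvectors any more, but only the trace matters. It is shown that the division estimate forces the
trace to be nonnegative at every point where \<open>f\<close> does not vanish (\<open>frame_trace_nonneg\<close>).

The estimate is tested, for large \<open>s\<close>, on the affine morphism
\<open>g(z) = (\<langle>z - a, v\<^sub>1\<rangle>, \<dots>, \<langle>z - a, v\<^sub>r\<rangle>, sqrt(s))\<close> and the weight \<open>\<psi>(z) = s|z - a|\<^sup>2 - 2 Re (\<alpha> \<cdot> (z - a))\<close>.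
Since \<open>i\<partial>\<bar>\<partial>\<psi>\<close> is \<open>s\<close> times the Euclidean metric, \<open>\<beta>\<^sup>*\<close> is an eigenvector of the curvature operator, and
with \<open>t = \<Sum>\<^sub>i |\<langle>z - a, v\<^sub>i\<rangle>|\<^sup>2\<close> the integrand of the functional is at most
\<open>|f|\<^sup>2 exp(-\<phi>-\<psi>) / (s + t - r/s)\<close> (\<open>I_integrand_scalar_levi\<close>, \<open>norm_beta_affine_map\<close>).
The linear term \<open>\<alpha>\<close> is chosen so that, up to a constant, \<open>|f|\<^sup>2 exp(-\<phi>-\<psi>) = \<mu> exp(-s|w|\<^sup>2)\<close> near \<open>a\<close>, where
\<open>w = z - a\<close> and \<open>\<mu> = 1 + O(|w|\<^sup>2)\<close> (\<open>local_model\<close>).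

For the lower bound write \<open>h = f k\<close> near \<open>a\<close> and \<open>q = \<Sum>\<^sub>i \<langle>w, v\<^sub>i\<rangle> k\<^sub>i\<close>, so that the last component of \<open>k\<close>
is \<open>(1 - q)/sqrt(s)\<close>. The function \<open>q\<close> is holomorphic and vanishes at \<open>a\<close>, hence integrates to zero against
every weight invariant under \<open>w \<mapsto> cis(\<theta>) w\<close> (\<open>integral_holomorphic_circle_invariant\<close>). The cross term
between \<open>q\<close> and \<open>\<mu> - 1\<close> is absorbed by \<open>\<Sum>\<^sub>i |k\<^sub>i|\<^sup>2\<close>, because \<open>|q|\<^sup>2 \<le> t \<Sum>\<^sub>i |k\<^sub>i|\<^sup>2\<close>
(\<open>solution_lower_bound_pointwise\<close>). With \<open>y = t - r/s\<close>, comparison of the two bounds gives on a ball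
around \<open>a\<close>, up to terms of lower order,
\<open>\<integral> \<mu> (y - y\<^sup>2/(s + y)) exp(-s|w|\<^sup>2) \<le> 0\<close> (\<open>inequality_at_scale\<close>). Under the Gaussian
\<open>y\<close> has mean zero, and after the substitution \<open>w = x/sqrt(s)\<close> dominated convergence leaves only the covariance
of \<open>|\<langle>x, v\<^sub>1\<rangle>|\<^sup>2 + \<dots> + |\<langle>x, v\<^sub>r\<rangle>|\<^sup>2\<close> with the quadratic part of \<open>\<mu>\<close> (\<open>limit_inequality\<close>). The
pluriharmonic part of this quadratic form does not contribute, and the rest is \<open>-i\<partial>\<bar>\<partial>\<phi>\<close>; so the covariance is
a positive multiple of minus the trace of the Levi form over \<open>v\<^sub>1, \<dots>, v\<^sub>r\<close>
(\<open>gaussian_covariance_quadratic\<close>), and the trace is nonnegative.\<close>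

section \<open>Gaussian integrals on Euclidean spaces\<close>

lemma bilinear_expansion:
  fixes B :: "'a::euclidean_space \<Rightarrow> 'a \<Rightarrow> real"
  assumes "\<And>x. linear (B x)" "\<And>y. linear (\<lambda>x. B x y)"
  shows "B u v = (\<Sum>b\<in>Basis. \<Sum>c\<in>Basis. (u \<bullet> b) * (v \<bullet> c) * B b c)"
proof -
  have "B u v = B (\<Sum>b\<in>Basis. (u \<bullet> b) *\<^sub>R b) (\<Sum>c\<in>Basis. (v \<bullet> c) *\<^sub>R c)"
    by (simp add: euclidean_representation)
  also have "\<dots> = (\<Sum>b\<in>Basis. (u \<bullet> b) * B b (\<Sum>c\<in>Basis. (v \<bullet> c) *\<^sub>R c))"
    by (simp add: linear_sum[OF assms(2)] linear_cmul[OF assms(2)] del: euclidean_representation)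
  also have "\<dots> = (\<Sum>b\<in>Basis. \<Sum>c\<in>Basis. (u \<bullet> b) * (v \<bullet> c) * B b c)"
    by (simp add: linear_sum[OF assms(1)] linear_cmul[OF assms(1)] sum_distrib_left mult_ac)
  finally show ?thesis .
qed

text \<open>An isometry takes balls to balls of the same volume. By the Vitali covering theorem an open set is, up to
a null set, a countable disjoint union of balls; this gives one inequality between the measures of a set and
its preimage, and the inverse isometry gives the other one.\<close>

lemma emeasure_open_isometry_vimage_ge:
  fixes U V :: "'a::euclidean_space \<Rightarrow> 'a"
  assumes iso: "\<And>x y. dist (U x) (U y) = dist x y" and UV: "\<And>x. U (V x) = x" and S: "open S"
  shows "emeasure lborel S \<le> emeasure lborel (U -` S)"
proof -
  have pre: "U -` ball c e = ball (V c) e" for c e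
    using iso[of "V c"] by (auto simp: UV ball_def)
  have contU: "continuous_on UNIV U"
    using iso by (auto simp: continuous_on_iff)
  define K where "K = {p. 0 < snd p \<and> ball (fst p) (snd p) \<subseteq> S}"
  have "\<exists>i. i \<in> K \<and> x \<in> ball (fst i) (snd i) \<and> snd i < d" if x: "x \<in> S" and d: "0 < d" for x d
  proof -
    obtain e where e: "0 < e" "ball x e \<subseteq> S" using S x by (auto simp: open_contains_ball)
    have "ball x (min e (d/2)) \<subseteq> S" using e(2) by auto
    then show ?thesis using e(1) d
      by (intro exI[of _ "(x, min e (d/2))"]) (auto simp: K_def)
  qed
  from Vitali_covering_theorem_balls[of S K fst snd, OF this]
  obtain C where C: "countable C" "C \<subseteq> K"
      "pairwise (\<lambda>i j. disjnt (ball (fst i) (snd i)) (ball (fst j) (snd j))) C"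
      "negligible (S - (\<Union>i\<in>C. ball (fst i) (snd i)))"
    by blast
  define T where "T = (\<Union>i\<in>C. ball (fst i) (snd i))"
  have T: "T \<subseteq> S" "open T" using C(2) by (auto simp: T_def K_def)
  have dis: "disjoint_family_on (\<lambda>i. ball (fst i) (snd i)) C"
    using C(3) unfolding disjoint_family_on_def pairwise_def disjnt_def by blast
  then have dis': "disjoint_family_on (\<lambda>i. U -` ball (fst i) (snd i)) C"
    unfolding disjoint_family_on_def by blast
  have "emeasure lborel S = emeasure lborel T"
  proof -
    have "S - T \<in> null_sets lborel"
      using C(4) S T by (auto simp: T_def[symmetric] negligible_iff_null_sets null_sets_def)
    then have "emeasure lborel (T \<union> (S - T)) = emeasure lborel T"
      using T by (intro emeasure_Un_null_set) auto
    then show ?thesis using T by (simp add: Un_absorb1)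
  qed
  also have "\<dots> = (\<integral>\<^sup>+i. emeasure lborel (ball (fst i) (snd i)) \<partial>count_space C)"
    unfolding T_def by (intro emeasure_UN_countable C dis) auto
  also have "\<dots> = (\<integral>\<^sup>+i. emeasure lborel (U -` ball (fst i) (snd i)) \<partial>count_space C)"
    using C(2) by (intro nn_integral_cong) (auto simp: pre K_def emeasure_ball)
  also have "\<dots> = emeasure lborel (\<Union>i\<in>C. U -` ball (fst i) (snd i))"
    by (rule emeasure_UN_countable[symmetric]) (auto simp: C pre dis'[unfolded pre])
  also have "\<dots> \<le> emeasure lborel (U -` S)"
    using T open_vimage[OF S contU] by (intro emeasure_mono) (auto simp: T_def)
  finally show ?thesis .
qed

lemma distr_lborel_orthogonal:
  fixes U :: "'a::euclidean_space \<Rightarrow> 'a"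
  assumes U: "orthogonal_transformation U"
  shows "distr lborel borel U = lborel"
proof (rule lborel_eqI[symmetric])
  have Ui: "orthogonal_transformation (inv U)" using U by (rule orthogonal_transformation_inv)
  have contU: "continuous_on UNIV U"
    using orthogonal_transformation_linear[OF U]
    by (intro linear_continuous_on) (simp add: linear_conv_bounded_linear)
  have [measurable]: "U \<in> borel_measurable borel"
    using contU by (rule borel_measurable_continuous_onI)
  have iso: "dist (U x) (U y) = dist x y" "dist (inv U x) (inv U y) = dist x y" for x y
    using U Ui unfolding orthogonal_transformation_isometry by auto
  have inv: "U (inv U x) = x" "inv U (U x) = x" for x
    using orthogonal_transformation_bij[OF U] by (auto simp: bij_def surj_f_inv_f)
  fix l u :: 'a assume lu: "\<And>b. b \<in> Basis \<Longrightarrow> l \<bullet> b \<le> u \<bullet> b"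
  have op: "open (U -` box l u)" using contU by (intro open_vimage) auto
  have "inv U -` (U -` box l u) = box l u" by (auto simp: inv)
  then have "emeasure lborel (U -` box l u) = emeasure lborel (box l u)"
    using emeasure_open_isometry_vimage_ge[of U "inv U" "box l u"]
      emeasure_open_isometry_vimage_ge[of "inv U" U "U -` box l u"] iso inv op
    by (intro antisym) auto
  then show "emeasure (distr lborel borel U) (box l u) = (\<Prod>b\<in>Basis. (u - l) \<bullet> b)"
    using lu by (subst emeasure_distr) (auto simp: emeasure_lborel_box)
qed simp

lemma integral_affine_orthogonal:
  fixes U :: "'a::euclidean_space \<Rightarrow> 'a" and F :: "'a \<Rightarrow> real"
  assumes U: "orthogonal_transformation U" and "0 < \<delta>" and [measurable]: "F \<in> borel_measurable borel"
  shows "(\<integral>z. F z \<partial>lborel) = \<delta> ^ DIM('a) * (\<integral>x. F (a + \<delta> *\<^sub>R U x) \<partial>lborel)"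
proof -
  have [measurable]: "U \<in> borel_measurable borel"
    using orthogonal_transformation_linear[OF U]
    by (intro borel_measurable_continuous_onI linear_continuous_on) (simp add: linear_conv_bounded_linear)
  have "(\<integral>z. F z \<partial>lborel) = \<delta> ^ DIM('a) * (\<integral>x. F (a + \<delta> *\<^sub>R x) \<partial>lborel)"
    using \<open>0 < \<delta>\<close> by (subst lborel_affine[of \<delta> a]) (auto simp: integral_density integral_distr)
  also have "(\<integral>x. F (a + \<delta> *\<^sub>R x) \<partial>lborel) = (\<integral>x. F (a + \<delta> *\<^sub>R x) \<partial>(distr lborel borel U))"
    by (simp add: distr_lborel_orthogonal[OF U])
  also have "\<dots> = (\<integral>x. F (a + \<delta> *\<^sub>R U x) \<partial>lborel)"
    by (rule integral_distr) auto
  finally show ?thesis .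
qed


text \<open>Even monomials against the Gaussian factor into one-dimensional integrals by Fubini's theorem.\<close>

lemma gaussian_monomial:
  fixes k :: "'a::euclidean_space \<Rightarrow> nat"
  shows "has_bochner_integral lborel (\<lambda>x::'a. (\<Prod>b\<in>Basis. (x \<bullet> b) ^ (2 * k b)) * exp (- (norm x)\<^sup>2))
      (\<Prod>b\<in>Basis. sqrt pi * (fact (2 * k b) / (2 ^ (2 * k b) * fact (k b))))"
proof -
  let ?c = "\<lambda>k. sqrt pi * (fact (2 * k) / (2 ^ (2 * k) * fact k))"
  have "has_bochner_integral lborel (\<lambda>x::real. exp (- x\<^sup>2) * x ^ (2 * m)) (?c m)" for m :: nat
    using has_bochner_integral_even_function[OF gaussian_moment_even_pos[of m]] by simp
  then have 1: "(\<integral>\<^sup>+x. ennreal (exp (- x\<^sup>2) * x ^ (2 * m)) \<partial>lborel) = ennreal (?c m)" for m :: nat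
    by (subst nn_integral_eq_integral)
      (auto simp: has_bochner_integral_iff zero_le_even_power)
  have eq: "(\<Prod>b\<in>Basis. exp (- (x \<bullet> b)\<^sup>2) * (x \<bullet> b) ^ (2 * k b))
      = (\<Prod>b\<in>Basis. (x \<bullet> b) ^ (2 * k b)) * exp (- (norm x)\<^sup>2)" for x :: 'a
  proof -
    have "(norm x)\<^sup>2 = (\<Sum>b\<in>Basis. (x \<bullet> b)\<^sup>2)"
      unfolding power2_norm_eq_inner by (subst euclidean_inner) (simp add: power2_eq_square)
    then show ?thesis by (simp add: prod.distrib exp_sum sum_negf[symmetric] mult.commute)
  qed
  have nn: "0 \<le> (\<Prod>b\<in>Basis. (x \<bullet> b) ^ (2 * k b)) * exp (- (norm x)\<^sup>2)" for x :: 'a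
    by (intro mult_nonneg_nonneg prod_nonneg) (auto simp: zero_le_even_power)
  have "(\<integral>\<^sup>+x. ennreal ((\<Prod>b\<in>Basis. (x \<bullet> b) ^ (2 * k b)) * exp (- (norm x)\<^sup>2)) \<partial>lborel)
      = (\<integral>\<^sup>+x. (\<Prod>b\<in>Basis. ennreal (exp (- (x \<bullet> b)\<^sup>2) * (x \<bullet> b) ^ (2 * k b))) \<partial>lborel)"
    by (simp add: eq[symmetric] prod_ennreal zero_le_even_power)
  also have "\<dots> = (\<Prod>b\<in>(Basis::'a set). ennreal (?c (k b)))"
    by (subst nn_integral_lborel_prod) (auto simp: 1)
  also have "\<dots> = ennreal (\<Prod>b\<in>(Basis::'a set). ?c (k b))"
    by (intro prod_ennreal) auto
  finally show ?thesis
    by (intro has_bochner_integral_nn_integral) (auto simp: nn intro!: prod_nonneg)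
qed


lemma gaussian_moments:
  fixes b c :: "'a::euclidean_space"
  defines "G \<equiv> (\<integral>x. exp (- (norm (x::'a))\<^sup>2) \<partial>lborel)"
  assumes b: "b \<in> Basis" and c: "c \<in> Basis"
  shows "0 < G" "has_bochner_integral lborel (\<lambda>x::'a. exp (- (norm x)\<^sup>2)) G"
    "has_bochner_integral lborel (\<lambda>x. (x \<bullet> b)\<^sup>2 * exp (- (norm x)\<^sup>2)) (G / 2)"
    "has_bochner_integral lborel (\<lambda>x. (x \<bullet> b)\<^sup>2 * (x \<bullet> c)\<^sup>2 * exp (- (norm x)\<^sup>2))
       (if b = c then 3 * G / 4 else G / 4)"
proof -
  define w :: "nat \<Rightarrow> real" where "w k = fact (2 * k) / (2 ^ (2 * k) * fact k)" for k
  have w: "w 0 = 1" "w (Suc 0) = 1 / 2" "w (Suc (Suc 0)) = 3 / 4" by (simp_all add: w_def fact_numeral)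
  have "has_bochner_integral lborel (\<lambda>x::'a. exp (- (norm x)\<^sup>2)) (sqrt pi ^ DIM('a))"
    using gaussian_monomial[of "\<lambda>_::'a. 0"] by simp
  then have G: "G = sqrt pi ^ DIM('a)" by (simp add: G_def has_bochner_integral_iff)
  have two: "has_bochner_integral lborel (\<lambda>x. (x \<bullet> b) ^ (2 * i) * (x \<bullet> c) ^ (2 * j) * exp (- (norm x)\<^sup>2))
      (G * (if b = c then w (i + j) else w i * w j))" for i j
  proof -
    define k where "k d = (if d = b then i else 0) + (if d = c then j else 0)" for d
    have "(\<Prod>d\<in>Basis. (x \<bullet> d) ^ (2 * k d)) = (\<Prod>d\<in>Basis. (if d = b then (x \<bullet> d) ^ (2 * i) else 1) *
        (if d = c then (x \<bullet> d) ^ (2 * j) else 1))" for x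
      by (intro prod.cong) (auto simp: k_def power_add distrib_left)
    then have m: "(\<Prod>d\<in>Basis. (x \<bullet> d) ^ (2 * k d)) = (x \<bullet> b) ^ (2 * i) * (x \<bullet> c) ^ (2 * j)" for x
      using b c by (simp add: prod.distrib)
    have "(\<Prod>d\<in>Basis. w (k d)) = (\<Prod>d\<in>Basis. (if d = b then (if b = c then w (i + j) else w i) else 1) *
        (if d = c then (if b = c then 1 else w j) else 1))"
      by (intro prod.cong) (auto simp: k_def w)
    then have "(\<Prod>d\<in>Basis. w (k d)) = (if b = c then w (i + j) else w i * w j)"
      using b c by (simp add: prod.distrib)
    then show ?thesis
      using gaussian_monomial[of k, folded w_def] by (simp add: m prod.distrib G)
  qed
  show "0 < G" by (simp add: G)
  show "has_bochner_integral lborel (\<lambda>x::'a. exp (- (norm x)\<^sup>2)) G" 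
    using two[of 0 0] by (cases "b = c") (simp_all add: w)
  show "has_bochner_integral lborel (\<lambda>x. (x \<bullet> b)\<^sup>2 * exp (- (norm x)\<^sup>2)) (G / 2)"
    using two[of "Suc 0" 0] by (cases "b = c") (simp_all add: w)
  show "has_bochner_integral lborel (\<lambda>x. (x \<bullet> b)\<^sup>2 * (x \<bullet> c)\<^sup>2 * exp (- (norm x)\<^sup>2))
       (if b = c then 3 * G / 4 else G / 4)"
    using two[of "Suc 0" "Suc 0"] by (cases "b = c") (simp_all add: w mult.commute)
qed

lemma gaussian_integrable_power:
  "integrable lborel (\<lambda>x::'a::euclidean_space. norm x ^ (2 * k) * exp (- (norm x)\<^sup>2))"
proof (rule Bochner_Integration.integrable_bound)
  have i: "integrable lborel (\<lambda>x::'a. (x \<bullet> b) ^ (2 * k) * exp (- (norm x)\<^sup>2))" if b: "b \<in> Basis" for b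
  proof -
    have "(\<Prod>d\<in>Basis. (x \<bullet> d) ^ (2 * (if d = b then k else 0))) = (x \<bullet> b) ^ (2 * k)" for x
      by (subst prod.remove[OF _ b]) auto
    then show ?thesis
      using gaussian_monomial[of "\<lambda>d. if d = b then k else 0"] by (simp add: has_bochner_integral_iff)
  qed
  show "integrable lborel (\<lambda>x::'a. real DIM('a) ^ k * (\<Sum>b\<in>Basis. (x \<bullet> b) ^ (2 * k) * exp (- (norm x)\<^sup>2)))"
    by (intro integrable_mult_right Bochner_Integration.integrable_sum i)
  have "norm x ^ (2 * k) \<le> real DIM('a) ^ k * (\<Sum>b\<in>Basis. (x \<bullet> b) ^ (2 * k))" for x :: 'a
  proof -
    define m where "m = Max ((\<lambda>b. (x \<bullet> b)\<^sup>2) ` Basis)"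
    have m: "(x \<bullet> b)\<^sup>2 \<le> m" if "b \<in> Basis" for b unfolding m_def using that by (intro Max_ge) auto
    have "m \<in> (\<lambda>b. (x \<bullet> b)\<^sup>2) ` Basis" unfolding m_def by (intro Max_in) auto
    then obtain b where b: "b \<in> Basis" "m = (x \<bullet> b)\<^sup>2" by blast
    have "(norm x)\<^sup>2 = (\<Sum>b\<in>Basis. (x \<bullet> b)\<^sup>2)"
      unfolding power2_norm_eq_inner by (subst euclidean_inner) (simp add: power2_eq_square)
    also have "\<dots> \<le> real DIM('a) * m" using sum_bounded_above[of Basis "\<lambda>b. (x \<bullet> b)\<^sup>2" m] m by simp
    finally have "((norm x)\<^sup>2) ^ k \<le> (real DIM('a) * m) ^ k" by (intro power_mono) auto
    also have "m ^ k \<le> (\<Sum>b\<in>Basis. (x \<bullet> b) ^ (2 * k))"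
      unfolding b(2) power_mult[symmetric] using b(1) by (intro member_le_sum) (auto simp: zero_le_even_power)
    then have "(real DIM('a) * m) ^ k \<le> real DIM('a) ^ k * (\<Sum>b\<in>Basis. (x \<bullet> b) ^ (2 * k))"
      by (simp add: power_mult_distrib)
    finally show ?thesis by (simp add: power_mult)
  qed
  then have "norm x ^ (2 * k) * exp (- (norm x)\<^sup>2)
      \<le> real DIM('a) ^ k * (\<Sum>b\<in>Basis. (x \<bullet> b) ^ (2 * k)) * exp (- (norm x)\<^sup>2)" for x :: 'a
    by (intro mult_right_mono) auto
  then show "AE x in lborel. norm (norm x ^ (2 * k) * exp (- (norm x)\<^sup>2))
      \<le> norm (real DIM('a) ^ k * (\<Sum>b\<in>Basis. ((x::'a) \<bullet> b) ^ (2 * k) * exp (- (norm x)\<^sup>2)))"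
    by (intro AE_I2) (simp add: sum_distrib_right[symmetric] mult.assoc[symmetric] sum_nonneg zero_le_even_power)
qed simp

lemma gaussian_integrable_bound:
  fixes F :: "'a::euclidean_space \<Rightarrow> real"
  assumes [measurable]: "F \<in> borel_measurable borel"
    and F: "\<And>x. \<bar>F x\<bar> \<le> C * (1 + norm x ^ (2 * k))"
  shows "integrable lborel (\<lambda>x. F x * exp (- (norm x)\<^sup>2))"
proof (rule Bochner_Integration.integrable_bound)
  show "integrable lborel (\<lambda>x::'a. C * (norm x ^ (2 * 0) * exp (- (norm x)\<^sup>2) + norm x ^ (2 * k) * exp (- (norm x)\<^sup>2)))"
    by (intro integrable_mult_right Bochner_Integration.integrable_add gaussian_integrable_power)
  have "\<bar>F x\<bar> * exp (- (norm x)\<^sup>2) \<le> \<bar>C * (norm x ^ (2 * 0) * exp (- (norm x)\<^sup>2) + norm x ^ (2 * k) * exp (- (norm x)\<^sup>2))\<bar>" for x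
  proof -
    have "\<bar>F x\<bar> * exp (- (norm x)\<^sup>2) \<le> C * (1 + norm x ^ (2 * k)) * exp (- (norm x)\<^sup>2)"
      using F by (intro mult_right_mono) auto
    then show ?thesis by (simp add: algebra_simps)
  qed
  then show "AE x in lborel. norm (F x * exp (- (norm x)\<^sup>2))
      \<le> norm (C * (norm x ^ (2 * 0) * exp (- (norm x)\<^sup>2) + norm x ^ (2 * k) * exp (- (norm x)\<^sup>2)))"
    by (intro AE_I2) (simp add: abs_mult)
qed simp

text \<open>The integrand is odd in the coordinate \<open>b\<close> and is therefore killed by the reflection in the hyperplane
orthogonal to \<open>b\<close>.\<close>

lemma gaussian_mixed_moment:
  fixes b c d :: "'a::euclidean_space"
  assumes b: "b \<in> Basis" and c: "c \<in> Basis" and d: "d \<in> Basis" and "b \<noteq> c"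
  shows "has_bochner_integral lborel (\<lambda>x. (x \<bullet> b) * (x \<bullet> c) * ((x \<bullet> d)\<^sup>2 - 1/2) * exp (- (norm x)\<^sup>2)) 0"
proof -
  let ?F = "\<lambda>x::'a. (x \<bullet> b) * (x \<bullet> c) * ((x \<bullet> d)\<^sup>2 - 1/2)"
  have bnd: "\<bar>?F x\<bar> \<le> 2 * (1 + norm x ^ (2 * 2))" for x
  proof -
    have le: "\<bar>x \<bullet> e\<bar> \<le> norm x" if "e \<in> Basis" for e using that by (rule Basis_le_norm)
    have "(x \<bullet> d)\<^sup>2 \<le> (norm x)\<^sup>2" using le[OF d] by (simp add: abs_le_square_iff[symmetric])
    then have 1: "\<bar>(x \<bullet> d)\<^sup>2 - 1/2\<bar> \<le> (norm x)\<^sup>2 + 1/2" by (simp add: abs_le_iff add_increasing)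
    have "\<bar>x \<bullet> b\<bar> * \<bar>x \<bullet> c\<bar> * \<bar>(x \<bullet> d)\<^sup>2 - 1/2\<bar> \<le> norm x * norm x * ((norm x)\<^sup>2 + 1/2)"
      using le[OF b] le[OF c] 1 by (intro mult_mono) auto
    also have "\<dots> = ((norm x)\<^sup>2)\<^sup>2 + (norm x)\<^sup>2 / 2" by (simp add: power2_eq_square algebra_simps)
    also have "\<dots> \<le> 2 * (1 + ((norm x)\<^sup>2)\<^sup>2)"
    proof -
      have "y\<^sup>2 + y / 2 \<le> 2 * (1 + y\<^sup>2)" for y :: real
      proof -
        have "2 * y \<le> y\<^sup>2 + 1" using zero_le_power2[of "y - 1"] by (simp add: power2_diff)
        then show ?thesis using zero_le_power2[of y] unfolding distrib_left by linarith
      qed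
      then show ?thesis .
    qed
    finally show ?thesis by (simp add: abs_mult power_mult[symmetric])
  qed
  have int: "integrable lborel (\<lambda>x. ?F x * exp (- (norm x)\<^sup>2))"
    by (rule gaussian_integrable_bound[OF _ bnd]) simp
  define R where "R x = x - (2 * (x \<bullet> b)) *\<^sub>R b" for x :: 'a
  have bb: "b \<bullet> b = 1" "c \<bullet> b = 0" "b \<bullet> c = 0" using b c \<open>b \<noteq> c\<close> by (auto simp: inner_Basis)
  have "linear R" unfolding R_def by (intro linearI) (auto simp: algebra_simps inner_add_left)
  moreover have "R x \<bullet> R y = x \<bullet> y" for x y
    by (simp add: R_def inner_diff_left inner_diff_right bb algebra_simps inner_commute)
  ultimately have orth: "orthogonal_transformation R" by (simp add: orthogonal_transformation_def)
  have nR: "norm (R x) = norm x" for x using orth by (rule orthogonal_transformation_norm)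
  have Rb: "R x \<bullet> b = - (x \<bullet> b)" "R x \<bullet> c = x \<bullet> c" "(R x \<bullet> d)\<^sup>2 = (x \<bullet> d)\<^sup>2" for x
    using d b by (auto simp: R_def inner_diff_left bb inner_Basis)
  have "(\<integral>x. ?F x * exp (- (norm x)\<^sup>2) \<partial>lborel) = (\<integral>x. ?F (R x) * exp (- (norm (R x))\<^sup>2) \<partial>lborel)"
    using integral_affine_orthogonal[OF orth, of 1 "\<lambda>x. ?F x * exp (- (norm x)\<^sup>2)" 0] by simp
  also have "\<dots> = - (\<integral>x. ?F x * exp (- (norm x)\<^sup>2) \<partial>lborel)"
    unfolding Rb nR by (subst integral_minus[symmetric]) (simp add: mult.assoc)
  finally show ?thesis using int by (simp add: has_bochner_integral_iff)
qed

text \<open>The factor \<open>\<Sum>\<^sub>d (x \<bullet> d)\<^sup>2 - card J / 2\<close> is the centred square length of the projection to the coordinates in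
\<open>J\<close>. It is uncorrelated with all products \<open>(x \<bullet> b) * (x \<bullet> c)\<close> except the squares with \<open>b = c \<in> J\<close>, so that
its covariance with a quadratic form reads off the trace over \<open>J\<close>.\<close>

lemma gaussian_covariance_quadratic:
  fixes B :: "'a::euclidean_space \<Rightarrow> 'a \<Rightarrow> real" and J :: "'a set"
  defines "G \<equiv> (\<integral>x. exp (- (norm (x::'a))\<^sup>2) \<partial>lborel)"
  assumes bil: "\<And>x. linear (B x)" "\<And>y. linear (\<lambda>x. B x y)" and J: "J \<subseteq> Basis"
  shows "has_bochner_integral lborel
     (\<lambda>x. B x x * ((\<Sum>d\<in>J. (x \<bullet> d)\<^sup>2) - real (card J) / 2) * exp (- (norm x)\<^sup>2))
     (G / 2 * (\<Sum>d\<in>J. B d d))"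
proof -
  have fin: "finite J" using J finite_Basis by (rule finite_subset)
  have Bexp: "B x x = (\<Sum>b\<in>Basis. \<Sum>c\<in>Basis. (x \<bullet> b) * (x \<bullet> c) * B b c)" for x
    by (rule bilinear_expansion[OF bil])
  have mom: "has_bochner_integral lborel (\<lambda>x. (x \<bullet> b) * (x \<bullet> c) * ((x \<bullet> d)\<^sup>2 - 1/2) * exp (- (norm x)\<^sup>2))
      (if b = c \<and> c = d then G / 2 else 0)"
    if b: "b \<in> Basis" and c: "c \<in> Basis" and d: "d \<in> Basis" for b c d :: 'a
  proof (cases "b = c")
    case False
    then show ?thesis using gaussian_mixed_moment[OF b c d] by simp
  next
    case True
    have "has_bochner_integral lborel
       (\<lambda>x. (x \<bullet> b)\<^sup>2 * (x \<bullet> d)\<^sup>2 * exp (- (norm x)\<^sup>2) - (1/2) * ((x \<bullet> b)\<^sup>2 * exp (- (norm x)\<^sup>2)))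
       ((if b = d then 3 * G / 4 else G / 4) - (1/2) * (G / 2))"
      unfolding G_def
      by (intro has_bochner_integral_diff has_bochner_integral_mult_right
          gaussian_moments(3)[OF b b] gaussian_moments(4)[OF b d])
    then show ?thesis
      using True by (auto simp: algebra_simps power2_eq_square)
  qed
  have "has_bochner_integral lborel
     (\<lambda>x. \<Sum>b\<in>Basis. \<Sum>c\<in>Basis. \<Sum>d\<in>J. B b c * ((x \<bullet> b) * (x \<bullet> c) * ((x \<bullet> d)\<^sup>2 - 1/2) * exp (- (norm x)\<^sup>2)))
     (\<Sum>b\<in>Basis. \<Sum>c\<in>Basis. \<Sum>d\<in>J. B b c * (if b = c \<and> c = d then G / 2 else 0))"
    using J by (intro has_bochner_integral_sum has_bochner_integral_mult_right mom) auto
  moreover have "(\<Sum>b\<in>Basis. \<Sum>c\<in>Basis. \<Sum>d\<in>J. B b c * ((x \<bullet> b) * (x \<bullet> c) * ((x \<bullet> d)\<^sup>2 - 1/2) * exp (- (norm x)\<^sup>2)))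
      = B x x * ((\<Sum>d\<in>J. (x \<bullet> d)\<^sup>2) - real (card J) / 2) * exp (- (norm x)\<^sup>2)" for x
  proof -
    have "(\<Sum>d\<in>J. (x \<bullet> d)\<^sup>2) - real (card J) / 2 = (\<Sum>d\<in>J. (x \<bullet> d)\<^sup>2 - 1/2)"
      by (simp add: sum_subtractf)
    then show ?thesis
      unfolding Bexp by (simp only: sum_distrib_right) (simp add: sum_distrib_left sum_distrib_right mult_ac)
  qed
  moreover have "(\<Sum>b\<in>Basis. \<Sum>c\<in>Basis. \<Sum>d\<in>J. B b c * (if b = c \<and> c = d then G / 2 else 0))
      = G / 2 * (\<Sum>d\<in>J. B d d)"
  proof -
    have "(\<Sum>b\<in>Basis. \<Sum>c\<in>Basis. \<Sum>d\<in>J. B b c * (if b = c \<and> c = d then G / 2 else 0))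
      = (\<Sum>d\<in>J. \<Sum>b\<in>Basis. \<Sum>c\<in>Basis. B b c * (if b = c \<and> c = d then G / 2 else 0))"
      by (subst sum.swap[of _ J]) (auto intro!: sum.cong simp: sum.swap[of _ J])
    also have "\<dots> = (\<Sum>d\<in>J. \<Sum>b\<in>Basis. if b = d then B d d * (G / 2) else 0)"
    proof (intro sum.cong refl)
      fix d b :: 'a assume "d \<in> J" "b \<in> Basis"
      have "(\<Sum>c\<in>Basis. B b c * (if b = c \<and> c = d then G / 2 else 0)) = (\<Sum>c\<in>Basis. if c = b then (if b = d then B d d * (G/2) else 0) else 0)"
        by (intro sum.cong) auto
      then show "(\<Sum>c\<in>Basis. B b c * (if b = c \<and> c = d then G / 2 else 0)) = (if b = d then B d d * (G / 2) else 0)"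
        using \<open>b \<in> Basis\<close> by simp
    qed
    also have "\<dots> = (\<Sum>d\<in>J. B d d * (G / 2))"
      using J by (intro sum.cong) auto
    finally show ?thesis by (simp add: sum_distrib_left mult.commute)
  qed
  ultimately show ?thesis by simp
qed

lemma gaussian_centered_sum_squares:
  fixes J :: "'a::euclidean_space set"
  assumes J: "J \<subseteq> Basis"
  shows "has_bochner_integral lborel
     (\<lambda>x. ((\<Sum>d\<in>J. (x \<bullet> d)\<^sup>2) - real (card J) / 2) * exp (- (norm x)\<^sup>2)) 0"
proof -
  let ?G = "\<integral>x. exp (- (norm (x::'a))\<^sup>2) \<partial>lborel"
  have "has_bochner_integral lborel
     (\<lambda>x. \<Sum>d\<in>J. (x \<bullet> d)\<^sup>2 * exp (- (norm x)\<^sup>2) - (1/2) * exp (- (norm x)\<^sup>2)) (\<Sum>d\<in>J. ?G / 2 - (1/2) * ?G)"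
    using J by (intro has_bochner_integral_sum has_bochner_integral_diff has_bochner_integral_mult_right
        gaussian_moments(2)[OF SOME_Basis SOME_Basis] gaussian_moments(3)[OF _ SOME_Basis]) auto
  then show ?thesis
    by (simp add: sum_subtractf algebra_simps sum_distrib_left)
qed

section \<open>Second derivatives and the Levi form\<close>

text \<open>The derivative in direction \<open>u\<close> of the directional derivative along \<open>v\<close>; for functions of class \<open>C\<^sup>2\<close> it is
bilinear and symmetric.\<close>

definition second_derivative :: "('a::real_normed_vector \<Rightarrow> real) \<Rightarrow> 'a \<Rightarrow> 'a \<Rightarrow> 'a \<Rightarrow> real" where
  "second_derivative \<phi> z u v = frechet_derivative (\<lambda>x. frechet_derivative \<phi> (at x) v) (at z) u"

lemma Ck_on_2D:
  fixes \<phi> :: "'a::real_normed_vector \<Rightarrow> real"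
  assumes "Ck_on 2 \<phi> D"
  shows "\<And>x. x \<in> D \<Longrightarrow> (\<phi> has_derivative frechet_derivative \<phi> (at x)) (at x)"
    "\<And>x v. x \<in> D \<Longrightarrow> ((\<lambda>x. frechet_derivative \<phi> (at x) v) has_derivative (\<lambda>u. second_derivative \<phi> x u v)) (at x)"
    "\<And>u v. continuous_on D (\<lambda>x. second_derivative \<phi> x u v)"
  using assms by (auto simp: numeral_2_eq_2 second_derivative_def frechet_derivative_works)

lemma second_derivative_linear:
  fixes \<phi> :: "'a::real_normed_vector \<Rightarrow> real"
  assumes "Ck_on 2 \<phi> D" "open D" "z \<in> D"
  shows "linear (\<lambda>u. second_derivative \<phi> z u v)" "linear (second_derivative \<phi> z u)"
proof -
  note d = Ck_on_2D[OF assms(1)]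
  show "linear (\<lambda>u. second_derivative \<phi> z u v)"
    using d(2)[OF assms(3)] by (rule has_derivative_linear)
  have lin: "linear (frechet_derivative \<phi> (at x))" if "x \<in> D" for x
    using d(1)[OF that] by (rule has_derivative_linear)
  have uniq: "second_derivative \<phi> z u w = M u"
    if "\<And>x. x \<in> D \<Longrightarrow> frechet_derivative \<phi> (at x) w = m x" "(m has_derivative M) (at z)" for w m M
  proof -
    have "((\<lambda>x. frechet_derivative \<phi> (at x) w) has_derivative M) (at z)"
      by (rule has_derivative_transform_within_open[OF that(2) assms(2,3)]) (simp add: that(1))
    from frechet_derivative_at[OF this] show ?thesis by (simp add: second_derivative_def)
  qed
  show "linear (second_derivative \<phi> z u)"
  proof (rule linearI)
    fix v w
    show "second_derivative \<phi> z u (v + w) = second_derivative \<phi> z u v + second_derivative \<phi> z u w"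
      by (rule uniq[OF _ has_derivative_add[OF d(2)[OF assms(3)] d(2)[OF assms(3)]]])
        (simp add: linear_add[OF lin])
  next
    fix c v
    show "second_derivative \<phi> z u (c *\<^sub>R v) = c *\<^sub>R second_derivative \<phi> z u v"
      by (rule uniq[OF _ has_derivative_scaleR_right[OF d(2)[OF assms(3)]]])
        (simp add: linear_cmul[OF lin])
  qed
qed

lemma second_derivative_bound:
  fixes \<phi> :: "'a::euclidean_space \<Rightarrow> real"
  assumes "Ck_on 2 \<phi> D" "open D" "compact K" "K \<subseteq> D"
  obtains C where "0 \<le> C" "\<And>z w. z \<in> K \<Longrightarrow> \<bar>second_derivative \<phi> z w w\<bar> \<le> C * (norm w)\<^sup>2"
proof -
  have "\<exists>M. \<forall>z\<in>K. \<bar>second_derivative \<phi> z b c\<bar> \<le> M" for b c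
  proof -
    have "compact ((\<lambda>z. second_derivative \<phi> z b c) ` K)"
      using assms Ck_on_2D(3)[OF assms(1)] by (intro compact_continuous_image) (auto intro: continuous_on_subset)
    then show ?thesis by (fastforce dest: compact_imp_bounded simp: bounded_iff)
  qed
  then obtain M where M: "\<And>b c z. z \<in> K \<Longrightarrow> \<bar>second_derivative \<phi> z b c\<bar> \<le> M b c" by metis
  have "\<bar>second_derivative \<phi> z w w\<bar> \<le> (\<Sum>b\<in>Basis. \<Sum>c\<in>Basis. \<bar>M b c\<bar>) * (norm w)\<^sup>2" if z: "z \<in> K" for z w
  proof -
    have "\<bar>second_derivative \<phi> z w w\<bar>
        = \<bar>\<Sum>b\<in>Basis. \<Sum>c\<in>Basis. (w \<bullet> b) * (w \<bullet> c) * second_derivative \<phi> z b c\<bar>"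
      using second_derivative_linear[OF assms(1,2)] z assms(4) by (subst bilinear_expansion) auto
    also have "\<dots> \<le> (\<Sum>b\<in>Basis. \<Sum>c\<in>Basis. \<bar>(w \<bullet> b) * (w \<bullet> c) * second_derivative \<phi> z b c\<bar>)"
      by (intro order_trans[OF sum_abs] sum_mono order_refl)
    also have "\<dots> \<le> (\<Sum>b\<in>Basis. \<Sum>c\<in>Basis. \<bar>M b c\<bar> * (norm w)\<^sup>2)"
    proof (intro sum_mono)
      fix b c :: 'a assume bc: "b \<in> Basis" "c \<in> Basis"
      have "\<bar>w \<bullet> b\<bar> * \<bar>w \<bullet> c\<bar> * \<bar>second_derivative \<phi> z b c\<bar> \<le> norm w * norm w * \<bar>M b c\<bar>"
        using bc M[OF z, of b c] by (intro mult_mono) (auto intro: Basis_le_norm)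
      then show "\<bar>(w \<bullet> b) * (w \<bullet> c) * second_derivative \<phi> z b c\<bar> \<le> \<bar>M b c\<bar> * (norm w)\<^sup>2"
        by (simp add: abs_mult power2_eq_square mult_ac)
    qed
    finally show ?thesis by (simp add: sum_distrib_right)
  qed
  then show thesis by (intro that[of "\<Sum>b\<in>Basis. \<Sum>c\<in>Basis. \<bar>M b c\<bar>"]) (auto intro!: sum_nonneg)
qed

lemma derivative_along_line:
  fixes \<phi> :: "'a::real_normed_vector \<Rightarrow> real"
  assumes "(\<phi> has_derivative L) (at (a + t *\<^sub>R w))"
  shows "((\<lambda>s. \<phi> (a + s *\<^sub>R w)) has_real_derivative L w) (at t)"
proof -
  have "((\<lambda>s. a + s *\<^sub>R w) has_derivative (\<lambda>s. s *\<^sub>R w)) (at t)"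
    by (auto intro!: derivative_eq_intros)
  from has_derivative_compose[OF this assms]
  have "((\<lambda>s. \<phi> (a + s *\<^sub>R w)) has_derivative (\<lambda>s. L (s *\<^sub>R w))) (at t)" .
  then show ?thesis
    by (rule has_derivative_imp_has_field_derivative)
      (simp add: linear_cmul[OF has_derivative_linear[OF assms]])
qed

lemma taylor_second_order:
  fixes \<phi> :: "'a::euclidean_space \<Rightarrow> real"
  assumes "Ck_on 2 \<phi> D" "\<And>t. 0 \<le> t \<Longrightarrow> t \<le> 1 \<Longrightarrow> a + t *\<^sub>R w \<in> D"
  obtains t where "0 \<le> t" "t \<le> 1"
    "\<phi> (a + w) = \<phi> a + frechet_derivative \<phi> (at a) w + second_derivative \<phi> (a + t *\<^sub>R w) w w / 2"
proof -
  note d = Ck_on_2D[OF assms(1)]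
  define diff :: "nat \<Rightarrow> real \<Rightarrow> real" where
    "diff m t = (if m = 0 then \<phi> (a + t *\<^sub>R w) else if m = 1 then frechet_derivative \<phi> (at (a + t *\<^sub>R w)) w
       else second_derivative \<phi> (a + t *\<^sub>R w) w w)" for m t
  have "\<exists>t>0. t \<le> 1 \<and> diff 0 1 = (\<Sum>m<2. diff m 0 / fact m * 1 ^ m) + diff 2 t / fact 2 * 1 ^ 2"
  proof (rule Maclaurin2)
    show "\<forall>m t. m < 2 \<and> 0 \<le> t \<and> t \<le> 1 \<longrightarrow> (diff m has_real_derivative diff (Suc m) t) (at t)"
    proof (intro allI impI)
      fix m :: nat and t :: real assume A: "m < 2 \<and> 0 \<le> t \<and> t \<le> 1"
      have in_D: "a + t *\<^sub>R w \<in> D" using assms(2) A by auto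
      consider "m = 0" | "m = 1" using A by linarith
      then show "(diff m has_real_derivative diff (Suc m) t) (at t)"
        by cases (use derivative_along_line[OF d(1)[OF in_D]] derivative_along_line[OF d(2)[OF in_D]]
           in \<open>simp_all add: diff_def[abs_def]\<close>)
    qed
  qed auto
  then obtain t where "0 < t" "t \<le> 1"
    "diff 0 1 = (\<Sum>m<2. diff m 0 / fact m * 1 ^ m) + diff 2 t / fact 2 * 1 ^ 2" by blast
  then show thesis by (intro that[of t]) (auto simp: diff_def numeral_2_eq_2)
qed

text \<open>The mean value theorem, applied twice, expresses the second difference quotient as a mixed second derivative
at a nearby point, with the direction \<open>u\<close> differentiated first. The quotient is symmetric in \<open>u\<close> and \<open>v\<close>, which
yields the symmetry of the second derivative.\<close>

lemma second_difference_limit: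
  fixes \<phi> :: "'a::real_normed_vector \<Rightarrow> real"
  assumes "Ck_on 2 \<phi> D" "open D" "z \<in> D" "0 < e"
  obtains \<delta> where "0 < \<delta>"
    "\<And>h. 0 < h \<Longrightarrow> h < \<delta> \<Longrightarrow>
       \<bar>(\<phi> (z + h *\<^sub>R u + h *\<^sub>R v) - \<phi> (z + h *\<^sub>R u) - \<phi> (z + h *\<^sub>R v) + \<phi> z) / h\<^sup>2 - second_derivative \<phi> z v u\<bar> < e"
proof -
  note d = Ck_on_2D[OF assms(1)]
  have "isCont (\<lambda>x. second_derivative \<phi> x v u) z"
    using d(3) assms(2,3) by (simp add: continuous_on_eq_continuous_at)
  then obtain r1 where r1: "0 < r1" "\<And>x. dist x z < r1 \<Longrightarrow> \<bar>second_derivative \<phi> x v u - second_derivative \<phi> z v u\<bar> < e"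
    using assms(4) by (auto simp: continuous_at_eps_delta dist_real_def)
  obtain r2 where r2: "0 < r2" "ball z r2 \<subseteq> D" using assms(2,3) by (auto simp: open_contains_ball)
  define \<delta> where "\<delta> = min r1 r2 / (norm u + norm v + 1)"
  have pos: "0 < norm u + norm v + 1" by (simp add: add_nonneg_pos)
  show thesis
  proof (rule that[of \<delta>])
    show "0 < \<delta>" using r1 r2 pos by (simp add: \<delta>_def)
    fix h assume h: "0 < h" "h < \<delta>"
    have small: "dist (z + s *\<^sub>R (h *\<^sub>R u) + t *\<^sub>R (h *\<^sub>R v)) z < min r1 r2" if "0 \<le> s" "s \<le> 1" "0 \<le> t" "t \<le> 1" for s t
    proof -
      have "norm (s *\<^sub>R (h *\<^sub>R u) + t *\<^sub>R (h *\<^sub>R v)) \<le> s * h * norm u + t * h * norm v"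
        using norm_triangle_ineq[of "s *\<^sub>R (h *\<^sub>R u)" "t *\<^sub>R (h *\<^sub>R v)"] that h by simp
      also have "\<dots> \<le> 1 * h * norm u + 1 * h * norm v"
        using that h by (intro add_mono mult_right_mono) auto
      also have "\<dots> \<le> h * (norm u + norm v + 1)" using h by (simp add: algebra_simps)
      also have "\<dots> < \<delta> * (norm u + norm v + 1)" using h pos by (intro mult_strict_right_mono)
      also have "\<dots> = min r1 r2" using pos by (simp add: \<delta>_def)
      finally show ?thesis by (simp add: dist_norm add.assoc)
    qed
    have inD: "z + s *\<^sub>R (h *\<^sub>R u) + t *\<^sub>R (h *\<^sub>R v) \<in> D" if "0 \<le> s" "s \<le> 1" "0 \<le> t" "t \<le> 1" for s t
      using small[OF that] r2 by (auto simp: subset_iff dist_commute)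
    define k where "k s = \<phi> (z + h *\<^sub>R v + s *\<^sub>R (h *\<^sub>R u)) - \<phi> (z + s *\<^sub>R (h *\<^sub>R u))" for s
    define k' where "k' s = frechet_derivative \<phi> (at (z + h *\<^sub>R v + s *\<^sub>R (h *\<^sub>R u))) (h *\<^sub>R u)
       - frechet_derivative \<phi> (at (z + s *\<^sub>R (h *\<^sub>R u))) (h *\<^sub>R u)" for s
    have "\<exists>s>0. s < 1 \<and> k 1 - k 0 = (1 - 0) * k' s"
    proof (rule MVT2)
      fix s :: real assume "0 \<le> s" "s \<le> 1"
      then show "(k has_real_derivative k' s) (at s)"
        unfolding k_def k'_def
        using inD[of s 1] inD[of s 0]
        by (intro DERIV_diff derivative_along_line d(1)) (auto simp: algebra_simps)
    qed simp
    then obtain s where s: "0 < s" "s < 1" "k 1 - k 0 = k' s" by auto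
    define l where "l t = frechet_derivative \<phi> (at (z + s *\<^sub>R (h *\<^sub>R u) + t *\<^sub>R (h *\<^sub>R v))) (h *\<^sub>R u)" for t
    have "\<exists>t>0. t < 1 \<and> l 1 - l 0 = (1 - 0) * second_derivative \<phi> (z + s *\<^sub>R (h *\<^sub>R u) + t *\<^sub>R (h *\<^sub>R v)) (h *\<^sub>R v) (h *\<^sub>R u)"
    proof (rule MVT2)
      fix t :: real assume "0 \<le> t" "t \<le> 1"
      then show "(l has_real_derivative second_derivative \<phi> (z + s *\<^sub>R (h *\<^sub>R u) + t *\<^sub>R (h *\<^sub>R v)) (h *\<^sub>R v) (h *\<^sub>R u)) (at t)"
        unfolding l_def using inD[of s t] s by (intro derivative_along_line d(2)) auto
    qed simp
    then obtain t where t: "0 < t" "t < 1"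
      "l 1 - l 0 = second_derivative \<phi> (z + s *\<^sub>R (h *\<^sub>R u) + t *\<^sub>R (h *\<^sub>R v)) (h *\<^sub>R v) (h *\<^sub>R u)" by auto
    let ?p = "z + s *\<^sub>R (h *\<^sub>R u) + t *\<^sub>R (h *\<^sub>R v)"
    have pD: "?p \<in> D" using inD[of s t] s t by auto
    have "k' s = l 1 - l 0" by (simp add: k'_def l_def algebra_simps)
    moreover have "k 1 - k 0 = \<phi> (z + h *\<^sub>R u + h *\<^sub>R v) - \<phi> (z + h *\<^sub>R u) - \<phi> (z + h *\<^sub>R v) + \<phi> z"
      by (simp add: k_def algebra_simps)
    moreover have "second_derivative \<phi> ?p (h *\<^sub>R v) (h *\<^sub>R u) = h\<^sup>2 * second_derivative \<phi> ?p v u"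
      using linear_cmul[OF second_derivative_linear(1)[OF assms(1,2) pD]]
        linear_cmul[OF second_derivative_linear(2)[OF assms(1,2) pD]]
      by (simp add: power2_eq_square)
    ultimately have "(\<phi> (z + h *\<^sub>R u + h *\<^sub>R v) - \<phi> (z + h *\<^sub>R u) - \<phi> (z + h *\<^sub>R v) + \<phi> z) / h\<^sup>2 = second_derivative \<phi> ?p v u"
      using s t h by simp
    then show "\<bar>(\<phi> (z + h *\<^sub>R u + h *\<^sub>R v) - \<phi> (z + h *\<^sub>R u) - \<phi> (z + h *\<^sub>R v) + \<phi> z) / h\<^sup>2 - second_derivative \<phi> z v u\<bar> < e"
      using r1(2)[of ?p] small[of s t] s t by simp
  qed
qed

lemma second_derivative_commute:
  fixes \<phi> :: "'a::real_normed_vector \<Rightarrow> real"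
  assumes "Ck_on 2 \<phi> D" "open D" "z \<in> D"
  shows "second_derivative \<phi> z u v = second_derivative \<phi> z v u"
proof (rule ccontr)
  assume "\<not> ?thesis"
  then have e: "0 < \<bar>second_derivative \<phi> z u v - second_derivative \<phi> z v u\<bar> / 2" (is "0 < ?e") by simp
  obtain d1 where d1: "0 < d1" "\<And>h. 0 < h \<Longrightarrow> h < d1 \<Longrightarrow>
       \<bar>(\<phi> (z + h *\<^sub>R u + h *\<^sub>R v) - \<phi> (z + h *\<^sub>R u) - \<phi> (z + h *\<^sub>R v) + \<phi> z) / h\<^sup>2 - second_derivative \<phi> z v u\<bar> < ?e"
    using second_difference_limit[OF assms e, of u v] by blast
  obtain d2 where d2: "0 < d2" "\<And>h. 0 < h \<Longrightarrow> h < d2 \<Longrightarrow>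
       \<bar>(\<phi> (z + h *\<^sub>R v + h *\<^sub>R u) - \<phi> (z + h *\<^sub>R v) - \<phi> (z + h *\<^sub>R u) + \<phi> z) / h\<^sup>2 - second_derivative \<phi> z u v\<bar> < ?e"
    using second_difference_limit[OF assms e, of v u] by blast
  define h where "h = min d1 d2 / 2"
  have h: "0 < h" "h < d1" "h < d2" using d1(1) d2(1) by (auto simp: h_def min_def)
  define Q where "Q = (\<phi> (z + h *\<^sub>R u + h *\<^sub>R v) - \<phi> (z + h *\<^sub>R u) - \<phi> (z + h *\<^sub>R v) + \<phi> z) / h\<^sup>2"
  have "Q = (\<phi> (z + h *\<^sub>R v + h *\<^sub>R u) - \<phi> (z + h *\<^sub>R v) - \<phi> (z + h *\<^sub>R u) + \<phi> z) / h\<^sup>2"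
    unfolding Q_def by (simp add: add.assoc add.commute[of "h *\<^sub>R v"])
  then have "\<bar>Q - second_derivative \<phi> z v u\<bar> < ?e" "\<bar>Q - second_derivative \<phi> z u v\<bar> < ?e"
    using d1(2)[OF h(1,2)] d2(2)[OF h(1,3)] unfolding Q_def by metis+
  moreover have False if "\<bar>q - b\<bar> < \<bar>a - b\<bar> / 2" "\<bar>q - a\<bar> < \<bar>a - b\<bar> / 2" for q a b :: real
    using that by (auto simp: abs_if split: if_splits)
  ultimately show False by blast
qed


lemma complex_vec_Basis: "(Basis :: (complex ^ 'n) set) = range (\<lambda>j. axis j 1) \<union> range (\<lambda>j. axis j \<i>)"
  by (auto simp: Basis_vec_def Basis_complex_def)

lemma sum_complex_vec_Basis:
  fixes f :: "complex ^ 'n \<Rightarrow> 'b::comm_monoid_add"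
  shows "(\<Sum>b\<in>Basis. f b) = (\<Sum>j\<in>UNIV. f (axis j 1) + f (axis j \<i>))"
proof -
  have inj: "inj (\<lambda>j. axis j c :: complex ^ 'n)" if "c \<noteq> 0" for c
    using that by (auto simp: inj_on_def axis_eq_axis)
  have "range (\<lambda>j. axis j 1 :: complex ^ 'n) \<inter> range (\<lambda>j. axis j \<i>) = {}"
    by (auto simp: axis_eq_axis)
  then show ?thesis
    unfolding complex_vec_Basis
    by (simp add: sum.union_disjoint sum.reindex inj sum.distrib)
qed

lemma levi_nth:
  fixes \<phi> :: "complex ^ 'n \<Rightarrow> real"
  assumes "Ck_on 2 \<phi> D" "open D" "z \<in> D"
  defines "S \<equiv> second_derivative \<phi> z"
  shows "levi \<phi> z $ j $ l = Complex ((S (axis j 1) (axis l 1) + S (axis j \<i>) (axis l \<i>)) / 4)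
     ((S (axis j 1) (axis l \<i>) - S (axis j \<i>) (axis l 1)) / 4)"
proof -
  note d = Ck_on_2D[OF assms(1)]
  have fd: "frechet_derivative (\<lambda>w. complex_of_real (\<phi> w)) (at x) = (\<lambda>v. of_real (frechet_derivative \<phi> (at x) v))"
    if "x \<in> D" for x
    using has_derivative_of_real[OF d(1)[OF that]] by (rule frechet_derivative_at[symmetric])
  define m where "m x = (complex_of_real (frechet_derivative \<phi> (at x) (axis l 1))
     + \<i> * of_real (frechet_derivative \<phi> (at x) (axis l \<i>))) * (1 / 2)" for x
  have "(m has_derivative (\<lambda>u. (of_real (S u (axis l 1)) + \<i> * of_real (S u (axis l \<i>))) * (1 / 2))) (at z)"
    unfolding m_def S_def
    by (intro has_derivative_mult_left has_derivative_mult_right has_derivative_add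
        has_derivative_of_real d(2) assms)
  then have "((\<lambda>x. d_zbar l (\<lambda>w. of_real (\<phi> w)) x) has_derivative
      (\<lambda>u. (of_real (S u (axis l 1)) + \<i> * of_real (S u (axis l \<i>))) * (1 / 2))) (at z)"
    by (rule has_derivative_transform_within_open[OF _ assms(2,3)]) (simp add: m_def d_zbar_def fd)
  from frechet_derivative_at[OF this, symmetric]
  show ?thesis
    by (simp add: levi_def d_z_def complex_eq_iff)
qed

lemma levi_hermitian:
  fixes \<phi> :: "complex ^ 'n \<Rightarrow> real"
  assumes "Ck_on 2 \<phi> D" "open D" "z \<in> D"
  shows "levi \<phi> z $ l $ j = cnj (levi \<phi> z $ j $ l)"
  using second_derivative_commute[OF assms]
  by (simp add: levi_nth[OF assms] complex_eq_iff diff_divide_distrib)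

text \<open>On the complex line spanned by \<open>v\<close> the Levi form is a quarter of the Laplacian.\<close>

lemma Re_levi_form:
  fixes \<phi> :: "complex ^ 'n \<Rightarrow> real"
  assumes "Ck_on 2 \<phi> D" "open D" "z \<in> D"
  shows "Re (\<Sum>j\<in>UNIV. \<Sum>l\<in>UNIV. levi \<phi> z $ j $ l * v $ j * cnj (v $ l))
     = (second_derivative \<phi> z v v + second_derivative \<phi> z (\<i> *s v) (\<i> *s v)) / 4"
proof -
  let ?S = "second_derivative \<phi> z"
  have ex: "?S v v = (\<Sum>j\<in>UNIV. \<Sum>l\<in>UNIV. Re (v $ j) * Re (v $ l) * ?S (axis j 1) (axis l 1)
      + Re (v $ j) * Im (v $ l) * ?S (axis j 1) (axis l \<i>) + Im (v $ j) * Re (v $ l) * ?S (axis j \<i>) (axis l 1)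
      + Im (v $ j) * Im (v $ l) * ?S (axis j \<i>) (axis l \<i>))" for v
  proof -
    have "?S v v = (\<Sum>b\<in>Basis. \<Sum>c\<in>Basis. (v \<bullet> b) * (v \<bullet> c) * ?S b c)"
      by (rule bilinear_expansion) (rule second_derivative_linear[OF assms])+
    then show ?thesis
      by (simp add: sum_complex_vec_Basis inner_axis inner_complex_def sum.distrib add_ac)
  qed
  show ?thesis
    unfolding ex[of v] ex[of "\<i> *s v"] sum.distrib[symmetric] sum_divide_distrib Re_sum
    by (intro sum.cong refl) (simp add: levi_nth[OF assms] field_simps)
qed

section \<open>Diagonalisation of Hermitian matrices\<close>

text \<open>A maximum point \<open>x\<close> of the Rayleigh quotient on the unit sphere of \<open>V\<close> is an eigenvector: along
\<open>x + t y\<close> with \<open>y = T x - \<mu> x \<in> V\<close> the first order term of the quotient is \<open>2 t |y|\<^sup>2\<close>, which is incompatible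
with a maximum unless \<open>y = 0\<close>.\<close>

lemma symmetric_operator_eigenvector:
  fixes T :: "'a::euclidean_space \<Rightarrow> 'a"
  assumes lin: "linear T" and sym: "\<And>x y. T x \<bullet> y = x \<bullet> T y"
    and V: "subspace V" "\<And>x. x \<in> V \<Longrightarrow> T x \<in> V" and w: "w \<in> V" "w \<noteq> 0"
  obtains x \<mu> where "x \<in> V" "norm x = 1" "T x = \<mu> *\<^sub>R x"
proof -
  let ?K = "V \<inter> sphere 0 1"
  have "compact ?K" using closed_subspace[OF V(1)] by (intro closed_Int_compact) auto
  moreover have "(1 / norm w) *\<^sub>R w \<in> ?K" using w V(1) by (auto intro: subspace_scale)
  moreover have "continuous_on ?K (\<lambda>x. T x \<bullet> x)"
    using lin by (intro continuous_intros linear_continuous_on) (simp add: linear_conv_bounded_linear)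
  ultimately obtain x where x: "x \<in> ?K" "\<And>y. y \<in> ?K \<Longrightarrow> T y \<bullet> y \<le> T x \<bullet> x"
    using continuous_attains_sup[of ?K "\<lambda>x. T x \<bullet> x"] by blast
  define \<mu> where "\<mu> = T x \<bullet> x"
  have xx: "x \<bullet> x = 1" using x(1) by (simp add: norm_eq_1[symmetric])
  have le: "T y \<bullet> y \<le> \<mu> * (y \<bullet> y)" if y: "y \<in> V" for y
  proof (cases "y = 0")
    case True
    then show ?thesis using linear_0[OF lin] by simp
  next
    case False
    have "(1 / norm y) *\<^sub>R y \<in> ?K" using False y V(1) by (auto intro: subspace_scale)
    from x(2)[OF this] have "T y \<bullet> y / (norm y)\<^sup>2 \<le> \<mu>"
      by (simp add: linear_cmul[OF lin] \<mu>_def power2_eq_square field_simps)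
    then show ?thesis using False by (simp add: field_simps power2_norm_eq_inner)
  qed
  define y where "y = T x - \<mu> *\<^sub>R x"
  have yV: "y \<in> V" using x(1) V by (auto simp: y_def intro!: subspace_diff subspace_scale)
  define c where "c = \<mu> * (y \<bullet> y) - T y \<bullet> y"
  have ineq: "2 * t * (y \<bullet> y) \<le> t\<^sup>2 * c" for t
  proof -
    have 1: "T (x + t *\<^sub>R y) \<bullet> (x + t *\<^sub>R y) \<le> \<mu> * ((x + t *\<^sub>R y) \<bullet> (x + t *\<^sub>R y))"
      using x(1) yV V(1) by (intro le) (auto intro: subspace_add subspace_scale)
    have 2: "T (x + t *\<^sub>R y) \<bullet> (x + t *\<^sub>R y) = \<mu> + 2 * t * (T x \<bullet> y) + t\<^sup>2 * (T y \<bullet> y)"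
      by (simp add: linear_add[OF lin] linear_cmul[OF lin] inner_add_left inner_add_right \<mu>_def sym[of y x]
          inner_commute[of y "T x"] power2_eq_square algebra_simps)
    have 3: "(x + t *\<^sub>R y) \<bullet> (x + t *\<^sub>R y) = 1 + 2 * t * (x \<bullet> y) + t\<^sup>2 * (y \<bullet> y)"
      by (simp add: inner_add_left inner_add_right xx inner_commute[of y x] power2_eq_square algebra_simps)
    have 4: "y \<bullet> y = T x \<bullet> y - \<mu> * (x \<bullet> y)"
      by (subst (1) y_def) (simp add: inner_diff_left)
    have alg: "2 * t * k \<le> t\<^sup>2 * (\<mu> * k - q)"
      if "\<mu> + 2 * t * p + t\<^sup>2 * q \<le> \<mu> * (1 + 2 * t * d + t\<^sup>2 * k)" "k = p - \<mu> * d" for k p q d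
    proof -
      have "2 * t * k = 2 * t * p - 2 * t * (\<mu> * d)" by (simp add: that(2) algebra_simps)
      then show ?thesis using that(1) by (simp add: algebra_simps)
    qed
    show ?thesis unfolding c_def using alg[OF 1[unfolded 2 3] 4] .
  qed
  have "y \<bullet> y = 0"
  proof (rule ccontr)
    assume "y \<bullet> y \<noteq> 0"
    then have p: "0 < y \<bullet> y" by simp
    have "2 * (y \<bullet> y) \<le> c" using ineq[of 1] by simp
    then have "0 < c" using p by linarith
    have "2 * ((y \<bullet> y) / c) * (y \<bullet> y) \<le> ((y \<bullet> y) / c)\<^sup>2 * c" by (rule ineq)
    then have "(y \<bullet> y) * (y \<bullet> y) \<le> 0" using \<open>0 < c\<close> by (simp add: power2_eq_square field_simps)
    moreover have "0 < (y \<bullet> y) * (y \<bullet> y)" by (rule mult_pos_pos[OF p p])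
    ultimately show False by simp
  qed
  then have "T x = \<mu> *\<^sub>R x" by (simp add: y_def)
  then show thesis using that[of x \<mu>] x(1) by auto
qed

lemma inner_eq_Re_herm: "x \<bullet> y = Re (herm x y)"
  by (simp add: inner_vec_def herm_def inner_complex_def)

lemma inner_ii_eq_Im_herm: "x \<bullet> (\<i> *s y) = Im (herm x y)"
  by (simp add: inner_vec_def herm_def inner_complex_def)

lemma herm_self: "herm x x = of_real ((norm x)\<^sup>2)"
  by (simp add: complex_eq_iff inner_eq_Re_herm[symmetric] power2_norm_eq_inner)
    (simp add: herm_def mult.commute)

lemma herm_commute: "herm y x = cnj (herm x y)"
  by (simp add: herm_def mult.commute)

lemma herm_add_left: "herm (x + y) z = herm x z + herm y z"
  by (simp add: herm_def distrib_right sum.distrib)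

lemma herm_smult_left: "herm (c *s x) z = c * herm x z"
  by (simp add: herm_def sum_distrib_left mult.assoc)

lemma herm_smult_right: "herm x (c *s z) = cnj c * herm x z"
  by (simp add: herm_def sum_distrib_left mult_ac)

lemma herm_matrix:
  fixes A :: "complex ^ 'n ^ 'n"
  assumes "\<And>i j. A $ i $ j = cnj (A $ j $ i)"
  shows "herm (A *v x) y = herm x (A *v y)"
proof -
  have "herm (A *v x) y = (\<Sum>i\<in>UNIV. \<Sum>j\<in>UNIV. A $ i $ j * x $ j * cnj (y $ i))"
    by (simp add: herm_def matrix_vector_mult_def sum_distrib_right)
  also have "\<dots> = (\<Sum>j\<in>UNIV. \<Sum>i\<in>UNIV. A $ i $ j * x $ j * cnj (y $ i))" by (rule sum.swap)
  also have "\<dots> = herm x (A *v y)"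
    unfolding herm_def matrix_vector_mult_def
    by (subst (2) assms) (simp add: sum_distrib_left mult_ac)
  finally show ?thesis .
qed

definition orthonormal :: "(complex ^ 'n) set \<Rightarrow> bool" where
  "orthonormal S \<longleftrightarrow> (\<forall>u\<in>S. \<forall>v\<in>S. herm u v = (if u = v then 1 else 0))"

text \<open>Together with its multiples by \<open>\<i>\<close>, a Hermitian orthonormal set is orthogonal for the real inner product; so
the number of its elements is controlled by half of the real dimension.\<close>

lemma orthonormal_independent:
  assumes S: "orthonormal S"
  shows "independent (S \<union> (\<lambda>u. \<i> *s u) ` S)" and "S \<inter> (\<lambda>u. \<i> *s u) ` S = {}" and "finite S"
proof -
  have h: "herm u v = (if u = v then 1 else 0)" if "u \<in> S" "v \<in> S" for u v
    using S that by (auto simp: orthonormal_def)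
  have nz: "u \<noteq> 0" if "u \<in> S" for u using h[OF that that] by (auto simp: herm_def)
  have po: "pairwise orthogonal (S \<union> (\<lambda>u. \<i> *s u) ` S)"
    unfolding pairwise_def orthogonal_def
    by (auto simp: inner_eq_Re_herm herm_smult_left herm_smult_right h split: if_splits)
  have "\<i> *s u \<noteq> 0" if "u \<in> S" for u
    using nz[OF that] by (simp add: vec_eq_iff)
  then have "0 \<notin> S \<union> (\<lambda>u. \<i> *s u) ` S" using nz by fastforce
  with po show ind: "independent (S \<union> (\<lambda>u. \<i> *s u) ` S)" by (rule pairwise_orthogonal_independent)
  show "S \<inter> (\<lambda>u. \<i> *s u) ` S = {}"
  proof (rule ccontr)
    assume "\<not> ?thesis"
    then obtain u where u: "u \<in> S" "\<i> *s u \<in> S" by auto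
    have "herm (\<i> *s u) u = \<i>" using h[OF u(1) u(1)] by (simp add: herm_smult_left)
    then show False using h[OF u(2,1)] by (auto split: if_splits simp: complex_eq_iff)
  qed
  from ind show "finite S" using independent_imp_finite by blast
qed

lemma card_ii_image: "card ((\<lambda>u. \<i> *s u) ` S) = card (S :: (complex ^ 'n) set)"
  by (rule card_image) (auto simp: inj_on_def vec_eq_iff)

text \<open>Eigenvectors are added one by one: as long as there are fewer than \<open>CARD('n)\<close> of them, their Hermitian
orthogonal complement is nonzero and invariant, and \<open>A\<close> is a symmetric operator on it for the real inner
product.\<close>

lemma hermitian_eigenbasis_set:
  fixes A :: "complex ^ 'n ^ 'n"
  assumes A: "\<And>i j. A $ i $ j = cnj (A $ j $ i)" and k: "k \<le> CARD('n)"
  shows "\<exists>S. orthonormal S \<and> card S = k \<and> (\<forall>u\<in>S. \<exists>\<mu>::real. A *v u = of_real \<mu> *s u)"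
  using k
proof (induction k)
  case 0
  show ?case by (intro exI[of _ "{}"]) (simp add: orthonormal_def)
next
  case (Suc k)
  then obtain S where S: "orthonormal S" "card S = k" and ev: "\<And>u. u \<in> S \<Longrightarrow> \<exists>\<mu>::real. A *v u = of_real \<mu> *s u"
    by auto
  note ind = orthonormal_independent[OF S(1)]
  let ?W = "S \<union> (\<lambda>u. \<i> *s u) ` S"
  define V where "V = {x. \<forall>u\<in>S. herm x u = 0}"
  have "card ?W = 2 * k"
    using ind S(2) by (subst card_Un_disjoint) (auto simp: card_ii_image)
  then have "dim ?W < DIM(complex ^ 'n)"
    using Suc.prems ind(1) by (simp add: dim_eq_card_independent)
  then obtain w where w: "w \<noteq> 0" "\<And>x. x \<in> span ?W \<Longrightarrow> orthogonal w x"
    by (rule orthogonal_to_subspace_exists) blast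
  have "herm w u = 0" if "u \<in> S" for u
  proof -
    have "orthogonal w u" "orthogonal w (\<i> *s u)" using that by (auto intro!: w(2) span_base)
    then show ?thesis
      by (simp add: orthogonal_def complex_eq_iff inner_eq_Re_herm[symmetric] inner_ii_eq_Im_herm[symmetric])
  qed
  then have wV: "w \<in> V" by (simp add: V_def)
  have rs: "c *\<^sub>R x = of_real c *s x" for c and x :: "complex ^ 'n"
    unfolding vec_eq_iff vector_scaleR_component by (simp add: scaleR_conv_of_real)
  obtain x \<mu> where x: "x \<in> V" "norm x = 1" "A *v x = \<mu> *\<^sub>R x"
  proof (rule symmetric_operator_eigenvector[of "\<lambda>x. A *v x" V w])
    show "linear (\<lambda>x. A *v x)"
      by (intro linearI) (simp_all add: matrix_vector_right_distrib rs vector_scalar_commute)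
    show "(A *v x) \<bullet> y = x \<bullet> (A *v y)" for x y
      using herm_matrix[OF A] by (simp add: inner_eq_Re_herm)
    show "subspace V"
      by (auto simp: subspace_def V_def herm_add_left rs herm_smult_left) (simp add: herm_def)
    show "A *v y \<in> V" if "y \<in> V" for y
      unfolding V_def
    proof (intro CollectI ballI)
      fix u assume u: "u \<in> S"
      obtain m :: real where "A *v u = of_real m *s u" using ev[OF u] by blast
      then show "herm (A *v y) u = 0"
        using that u by (simp add: herm_matrix[OF A] herm_smult_right V_def)
    qed
  qed (use wV w in auto)
  have xS: "x \<notin> S"
  proof
    assume "x \<in> S"
    then have "herm x x = 0" using x(1) by (simp add: V_def)
    then show False using x(2) by (simp add: herm_self)
  qed
  show ?case
  proof (intro exI[of _ "insert x S"] conjI ballI)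
    have "herm x u = 0" "herm u x = 0" if "u \<in> S" for u
      using x(1) that herm_commute[of u x] by (auto simp: V_def)
    then show "orthonormal (insert x S)"
      using S(1) x(2) xS by (auto simp: orthonormal_def herm_self)
    show "card (insert x S) = Suc k" using xS S(2) ind(3) by simp
    show "\<exists>\<mu>::real. A *v u = of_real \<mu> *s u" if "u \<in> insert x S" for u
      using that ev x(3) by (auto simp: rs)
  qed
qed

lemma hermitian_eigenbasis:
  fixes A :: "complex ^ 'n ^ 'n"
  assumes A: "\<And>i j. A $ i $ j = cnj (A $ j $ i)"
  obtains U :: "'n \<Rightarrow> complex ^ 'n" and \<mu> :: "'n \<Rightarrow> real"
  where "\<And>i j. herm (U i) (U j) = (if i = j then 1 else 0)" "\<And>j. A *v U j = of_real (\<mu> j) *s U j"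
proof -
  obtain S where S: "orthonormal S" "card S = CARD('n)" "\<And>u. u \<in> S \<Longrightarrow> \<exists>\<mu>::real. A *v u = of_real \<mu> *s u"
    using hermitian_eigenbasis_set[OF A order_refl] by blast
  then obtain U where U: "bij_betw U (UNIV :: 'n set) S"
    using orthonormal_independent(3)[OF S(1)] by (metis finite_same_card_bij finite)
  have US: "U i \<in> S" for i using U by (auto simp: bij_betw_def)
  have inj: "U i = U j \<longleftrightarrow> i = j" for i j using U by (auto simp: bij_betw_def inj_on_def)
  obtain \<mu> :: "'n \<Rightarrow> real" where "\<And>j. A *v U j = of_real (\<mu> j) *s U j" using S(3)[OF US] by metis
  moreover have "herm (U i) (U j) = (if i = j then 1 else 0)" for i j
    using S(1) US by (auto simp: orthonormal_def inj)
  ultimately show thesis using that by blast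
qed

lemma poly_det:
  fixes M :: "complex poly ^ 'n ^ 'n"
  shows "poly (det M) x = det (\<chi> i j. poly (M $ i $ j) x)"
  by (simp add: det_def poly_sum poly_prod)

text \<open>Conjugation by the matrix with columns \<open>U j\<close> makes \<open>x - A\<close> diagonal for every number \<open>x\<close>. Comparing
polynomials through their values avoids matrices over the polynomial ring.\<close>

lemma eigenvalues_eigenbasis:
  fixes A :: "complex ^ 'n ^ 'n" and U :: "'n \<Rightarrow> complex ^ 'n" and \<mu> :: "'n \<Rightarrow> real"
  assumes U: "\<And>i j. herm (U i) (U j) = (if i = j then 1 else 0)"
    and ev: "\<And>j. A *v U j = of_real (\<mu> j) *s U j"
  shows "eigenvalues A = image_mset (\<lambda>j. complex_of_real (\<mu> j)) (mset_set UNIV)"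
proof -
  define P :: "complex ^ 'n ^ 'n" where "P = (\<chi> i j. U j $ i)"
  define Q :: "complex ^ 'n ^ 'n" where "Q = (\<chi> i j. cnj (U i $ j))"
  have "Q ** P = mat 1"
    using U by (simp add: matrix_matrix_mult_def P_def Q_def mat_def vec_eq_iff herm_def mult.commute)
  from arg_cong[OF this, of det] have "det Q * det P = 1" by (simp add: det_mul)
  then have detP: "det P \<noteq> 0" by auto
  have "char_polynomial A = (\<Prod>j\<in>UNIV. [:- of_real (\<mu> j), 1:])"
  proof (rule poly_eq_poly_eq_iff[THEN iffD1], rule ext)
    fix x
    let ?X = "(\<chi> i j. (if i = j then x else 0) - A $ i $ j) :: complex ^ 'n ^ 'n"
    let ?D = "(\<chi> i j. if i = j then x - of_real (\<mu> j) else 0) :: complex ^ 'n ^ 'n"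
    have AU: "(\<Sum>k\<in>UNIV. A $ i $ k * U j $ k) = of_real (\<mu> j) * U j $ i" for i j
      using ev[of j] by (simp add: vec_eq_iff matrix_vector_mult_def)
    have "?X ** P = P ** ?D"
    proof (simp add: vec_eq_iff matrix_matrix_mult_def P_def, intro allI)
      fix i j
      have "(\<Sum>k\<in>UNIV. ((if i = k then x else 0) - A $ i $ k) * U j $ k)
          = (\<Sum>k\<in>UNIV. if k = i then x * U j $ i else 0) - (\<Sum>k\<in>UNIV. A $ i $ k * U j $ k)"
        unfolding sum_subtractf[symmetric] by (intro sum.cong) (auto simp: left_diff_distrib)
      also have "\<dots> = (x - of_real (\<mu> j)) * U j $ i" by (simp add: AU left_diff_distrib)
      also have "\<dots> = (\<Sum>k\<in>UNIV. U k $ i * (if k = j then x - of_real (\<mu> j) else 0))"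
        by (simp add: if_distrib[of "(*) _"] mult.commute cong: if_cong)
      finally show "(\<Sum>k\<in>UNIV. ((if i = k then x else 0) - A $ i $ k) * U j $ k)
          = (\<Sum>k\<in>UNIV. U k $ i * (if k = j then x - of_real (\<mu> j) else 0))" .
    qed
    from arg_cong[OF this, of det] have "det ?X * det P = det P * det ?D" by (simp add: det_mul)
    then have "det ?X = det ?D" using detP by simp
    also have "\<dots> = (\<Prod>j\<in>UNIV. x - of_real (\<mu> j))"
      by (subst det_diagonal) auto
    finally have "det ?X = (\<Prod>j\<in>UNIV. x - of_real (\<mu> j))" .
    moreover have "poly (char_polynomial A) x = det ?X"
      unfolding char_polynomial_def poly_det
      by (rule arg_cong[of _ _ det]) (auto simp: vec_eq_iff)
    ultimately show "poly (char_polynomial A) x = poly (\<Prod>j\<in>UNIV. [:- of_real (\<mu> j), 1:]) x"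
      by (simp add: poly_prod)
  qed
  then have "eigenvalues A = (\<Sum>j\<in>UNIV. proots [:- complex_of_real (\<mu> j), 1:])"
    unfolding eigenvalues_def by (simp add: proots_prod)
  also have "\<dots> = (\<Sum>j\<in>UNIV. {#complex_of_real (\<mu> j)#})"
    by (simp)
  also have "\<dots> = image_mset (\<lambda>j. complex_of_real (\<mu> j)) (mset_set UNIV)"
    unfolding sum_unfold_sum_mset by (simp)
  finally show ?thesis .
qed

text \<open>The frame consists of the conjugates of the eigenvectors, because the Levi form pairs the row index with
\<open>v\<close> and the column index with its conjugate. The index map \<open>\<sigma>\<close> selects those members of the eigenbasis
that belong to \<open>M\<close>.\<close>

lemma eigenvalue_sum_frame:
  fixes A :: "complex ^ 'n ^ 'n"
  assumes A: "\<And>i j. A $ i $ j = cnj (A $ j $ i)"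
    and M: "M \<subseteq># eigenvalues A" "size M = CARD('r::finite)"
  obtains v :: "'n \<Rightarrow> complex ^ 'n" and \<sigma> :: "'r::finite \<Rightarrow> 'n"
  where "\<And>i j. herm (v i) (v j) = (if i = j then 1 else 0)" "inj \<sigma>"
    "(\<Sum>c\<in>#M. Re c) = (\<Sum>i\<in>UNIV. Re (\<Sum>j\<in>UNIV. \<Sum>l\<in>UNIV. A $ j $ l * v (\<sigma> i) $ j * cnj (v (\<sigma> i) $ l)))"
proof -
  obtain U :: "'n \<Rightarrow> complex ^ 'n" and \<mu> :: "'n \<Rightarrow> real"
    where U: "\<And>i j. herm (U i) (U j) = (if i = j then 1 else 0)" and ev: "\<And>j. A *v U j = of_real (\<mu> j) *s U j"
    using hermitian_eigenbasis[OF A] by blast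
  obtain X where "image_mset (\<lambda>j. complex_of_real (\<mu> j)) (mset_set UNIV) = M + X"
    using M(1) eigenvalues_eigenbasis[OF U ev] by (metis mset_subset_eq_exists_conv)
  then obtain N N' where N: "mset_set UNIV = N + N'" "image_mset (\<lambda>j. complex_of_real (\<mu> j)) N = M"
    using image_mset_eq_plusD by metis
  have NJ: "mset_set (set_mset N) = N"
  proof (rule multiset_eqI)
    fix x
    have "N \<subseteq># mset_set UNIV" unfolding N(1) by simp
    from mset_subset_eq_count[OF this, of x] have "count N x \<le> 1" by simp
    moreover have "1 \<le> count N x" if "x \<in># N" using that by (simp add: Suc_le_eq)
    ultimately have "count N x = (if x \<in># N then 1 else 0)" by (metis le_antisym not_in_iff)
    then show "count (mset_set (set_mset N)) x = count N x" by (simp add: count_mset_set')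
  qed
  have "size M = card (set_mset N)" unfolding N(2)[symmetric] by (metis NJ size_image_mset size_mset_set)
  then have "card (set_mset N) = CARD('r)" using M(2) by simp
  then obtain \<sigma> where \<sigma>: "bij_betw \<sigma> (UNIV :: 'r set) (set_mset N)"
    by (metis finite_same_card_bij finite)
  define v :: "'n \<Rightarrow> complex ^ 'n" where "v j = (\<chi> k. cnj (U j $ k))" for j
  show thesis
  proof (rule that[of v \<sigma>])
    show "herm (v i) (v j) = (if i = j then 1 else 0)" for i j
      using U[of j i] by (auto simp: herm_def v_def mult.commute)
    show "inj \<sigma>" using \<sigma> by (simp add: bij_betw_def)
    have q: "(\<Sum>j\<in>UNIV. \<Sum>l\<in>UNIV. A $ j $ l * v i $ j * cnj (v i $ l)) = of_real (\<mu> i)" for i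
    proof -
      have "(\<Sum>j\<in>UNIV. \<Sum>l\<in>UNIV. A $ j $ l * v i $ j * cnj (v i $ l)) = herm (A *v U i) (U i)"
        by (simp add: herm_def v_def matrix_vector_mult_def sum_distrib_left sum_distrib_right mult_ac)
      also have "\<dots> = of_real (\<mu> i)" by (simp add: ev herm_smult_left U)
      finally show ?thesis .
    qed
    have "(\<Sum>c\<in>#M. Re c) = (\<Sum>j\<in>#N. \<mu> j)" unfolding N(2)[symmetric] by (simp add: multiset.map_comp o_def)
    also have "\<dots> = (\<Sum>j\<in>set_mset N. \<mu> j)" by (subst NJ[symmetric]) (simp add: sum_unfold_sum_mset)
    also have "\<dots> = (\<Sum>i\<in>UNIV. \<mu> (\<sigma> i))" by (rule sum.reindex_bij_betw[OF \<sigma>, symmetric])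
    finally show "(\<Sum>c\<in>#M. Re c) = (\<Sum>i\<in>UNIV. Re (\<Sum>j\<in>UNIV. \<Sum>l\<in>UNIV. A $ j $ l * v (\<sigma> i) $ j * cnj (v (\<sigma> i) $ l)))"
      by (simp add: q)
  qed
qed

section \<open>Holomorphic functions of several variables\<close>

lemma holomorphic_functionsI:
  assumes "\<And>z. z \<in> D \<Longrightarrow> (f has_derivative L z) (at z)" "\<And>z c v. z \<in> D \<Longrightarrow> L z (c *s v) = c * L z v"
  shows "f \<in> holomorphic_functions D"
  using assms unfolding holomorphic_functions_def by blast

lemma holomorphic_functionsD:
  assumes "f \<in> holomorphic_functions D" "z \<in> D"
  shows "(f has_derivative frechet_derivative f (at z)) (at z)"
    "frechet_derivative f (at z) (c *s v) = c * frechet_derivative f (at z) v"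
proof -
  obtain L where L: "(f has_derivative L) (at z)" "\<And>c v. L (c *s v) = c * L v"
    using assms unfolding holomorphic_functions_def by blast
  have "frechet_derivative f (at z) = L" using frechet_derivative_at[OF L(1)] by simp
  then show "(f has_derivative frechet_derivative f (at z)) (at z)"
    "frechet_derivative f (at z) (c *s v) = c * frechet_derivative f (at z) v"
    using L by simp_all
qed

lemma holomorphic_functions_subset:
  "f \<in> holomorphic_functions D \<Longrightarrow> E \<subseteq> D \<Longrightarrow> f \<in> holomorphic_functions E"
  unfolding holomorphic_functions_def by blast

lemma holomorphic_functions_continuous:
  assumes "f \<in> holomorphic_functions D"
  shows "continuous_on D f"
  using holomorphic_functionsD(1)[OF assms] has_derivative_continuous
  by (intro continuous_at_imp_continuous_on) blast

lemma holomorphic_functions_const: "(\<lambda>z. c) \<in> holomorphic_functions D"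
  by (rule holomorphic_functionsI[where L = "\<lambda>_ _. 0"]) auto

lemma holomorphic_functions_mult:
  assumes "f \<in> holomorphic_functions D" "g \<in> holomorphic_functions D"
  shows "(\<lambda>z. f z * g z) \<in> holomorphic_functions D"
  by (rule holomorphic_functionsI[OF has_derivative_mult[OF holomorphic_functionsD(1)[OF assms(1)] holomorphic_functionsD(1)[OF assms(2)]]])
    (simp_all add: holomorphic_functionsD(2)[OF assms(1)] holomorphic_functionsD(2)[OF assms(2)] algebra_simps)

lemma holomorphic_functions_sum:
  assumes "\<And>i. i \<in> I \<Longrightarrow> f i \<in> holomorphic_functions D"
  shows "(\<lambda>z. \<Sum>i\<in>I. f i z) \<in> holomorphic_functions D"
  by (rule holomorphic_functionsI[where L = "\<lambda>z v. \<Sum>i\<in>I. frechet_derivative (f i) (at z) v"])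
    (auto intro!: has_derivative_sum holomorphic_functionsD(1)[OF assms] sum.cong
      simp: sum_distrib_left holomorphic_functionsD(2)[OF assms])

lemma holomorphic_functions_compose:
  assumes f: "f \<in> holomorphic_functions D" and k: "k holomorphic_on S" "open S" "\<And>z. z \<in> D \<Longrightarrow> f z \<in> S"
  shows "(\<lambda>z. k (f z)) \<in> holomorphic_functions D"
proof -
  define L where "L z = frechet_derivative f (at z)" for z
  have L: "(f has_derivative L z) (at z)" "L z (c *s v) = c * L z v" if "z \<in> D" for z c v
    using holomorphic_functionsD[OF f that] by (simp_all add: L_def)
  have "((\<lambda>z. k (f z)) has_derivative (\<lambda>v. deriv k (f z) * L z v)) (at z)" if "z \<in> D" for z
    using holomorphic_derivI[OF k(1,2) k(3)[OF that]] has_derivative_compose[OF L(1)[OF that]]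
    by (auto simp: has_field_derivative_def)
  then show ?thesis by (rule holomorphic_functionsI) (auto simp: L)
qed

lemma holomorphic_functions_divide:
  assumes "f \<in> holomorphic_functions D" "g \<in> holomorphic_functions D" "\<And>z. z \<in> D \<Longrightarrow> g z \<noteq> 0"
  shows "(\<lambda>z. f z / g z) \<in> holomorphic_functions D"
  unfolding divide_inverse using assms
  by (intro holomorphic_functions_mult holomorphic_functions_compose[where k = inverse and S = "- {0}"])
    (auto intro!: holomorphic_intros)

lemma dot_add_right: "dot a (u + v) = dot a u + dot a v"
  and dot_diff_right: "dot a (u - v) = dot a u - dot a v"
  and dot_smult_right: "dot a (c *s v) = c * dot a v"
  by (simp_all add: dot_def algebra_simps sum.distrib sum_subtractf sum_distrib_left)

lemma dot_scaleR_right: "dot a (c *\<^sub>R v) = c *\<^sub>R dot a v"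
  by (simp add: dot_def scaleR_sum_right)

lemma has_derivative_dot: "(dot a has_derivative dot a) F"
proof -
  have "linear (dot a)" by (intro linearI dot_add_right dot_scaleR_right)
  then show ?thesis by (simp add: bounded_linear_imp_has_derivative linear_conv_bounded_linear)
qed

lemma has_derivative_affine_dot: "((\<lambda>z. dot b (z - a) + c) has_derivative dot b) F"
proof -
  have "(\<lambda>z. dot b (z - a) + c) = (\<lambda>z. dot b z + (c - dot b a))" by (simp add: dot_diff_right fun_eq_iff)
  then show ?thesis using has_derivative_add_const[OF has_derivative_dot] by simp
qed

lemma holomorphic_functions_dot: "(\<lambda>z. dot b (z - a)) \<in> holomorphic_functions D"
  by (rule holomorphic_functionsI[where L = "\<lambda>_. dot b"])
    (use has_derivative_affine_dot[of b a 0] in \<open>simp_all add: dot_smult_right\<close>)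

lemma holomorphic_on_complex_line:
  fixes a w :: "complex ^ 'n"
  assumes f: "f \<in> holomorphic_functions D" and S: "\<And>\<zeta>. \<zeta> \<in> S \<Longrightarrow> a + \<zeta> *s w \<in> D"
  shows "(\<lambda>\<zeta>. f (a + \<zeta> *s w)) holomorphic_on S"
proof -
  define L where "L z = frechet_derivative f (at z)" for z
  have L: "(f has_derivative L z) (at z)" "L z (c *s v) = c * L z v" if "z \<in> D" for z c v
    using holomorphic_functionsD[OF f that] by (simp_all add: L_def)
  have lin: "linear (\<lambda>\<zeta>::complex. \<zeta> *s w)"
    by (intro linearI) (auto simp: vec_eq_iff algebra_simps)
  have "((\<lambda>\<zeta>. f (a + \<zeta> *s w)) has_field_derivative L (a + \<zeta> *s w) w) (at \<zeta>)" if "\<zeta> \<in> S" for \<zeta>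
  proof -
    have "((\<lambda>\<zeta>. a + \<zeta> *s w) has_derivative (\<lambda>\<zeta>. \<zeta> *s w)) (at \<zeta>)"
      using lin by (auto intro!: derivative_eq_intros bounded_linear_imp_has_derivative simp: linear_conv_bounded_linear)
    from has_derivative_compose[OF this L(1)[OF S[OF that]]]
    show ?thesis
      by (rule has_derivative_imp_has_field_derivative) (simp add: L(2)[OF S[OF that]])
  qed
  then have fd: "(\<lambda>\<zeta>. f (a + \<zeta> *s w)) field_differentiable (at \<zeta>)" if "\<zeta> \<in> S" for \<zeta>
    using that field_differentiable_def by blast
  show ?thesis
  proof (rule holomorphic_onI)
    fix \<zeta> assume "\<zeta> \<in> S"
    then show "(\<lambda>\<zeta>. f (a + \<zeta> *s w)) field_differentiable (at \<zeta> within S)"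
      by (rule field_differentiable_at_within[OF fd])
  qed
qed

lemma continuous_on_smult:
  fixes w :: "'a::topological_space \<Rightarrow> complex ^ 'n"
  assumes "continuous_on S c" "continuous_on S w"
  shows "continuous_on S (\<lambda>p. c p *s w p)"
  unfolding vector_scalar_mult_def using assms
  by (intro continuous_on_vec_lambda continuous_on_mult continuous_on_component)

lemma norm_smult: "norm (c *s w) = norm c * norm (w :: complex ^ 'n)"
  by (simp add: norm_vec_def norm_mult L2_set_right_distrib)

text \<open>Join a point of the ball to \<open>b\<close> by a complex line: on its convex intersection with the ball the
one-variable identity theorem applies.\<close>

lemma holomorphic_functions_eq_0_on_ball:
  fixes a b :: "complex ^ 'n"
  assumes f: "f \<in> holomorphic_functions (ball a R)" and b: "b \<in> ball a R" and e: "0 < e"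
    and zero: "\<And>z. z \<in> ball b e \<Longrightarrow> f z = 0" and z: "z \<in> ball a R"
  shows "f z = 0"
proof -
  define w where "w = z - b"
  define S where "S = (\<lambda>\<zeta>. b + \<zeta> *s w) -` ball a R"
  have cont: "continuous_on UNIV (\<lambda>\<zeta>. b + \<zeta> *s w)"
    by (intro continuous_on_add continuous_on_const continuous_on_smult continuous_on_id)
  have opS: "open S" unfolding S_def using cont by (intro open_vimage) auto
  have "convex S"
    unfolding convex_alt
  proof (intro ballI allI impI)
    fix x y and u :: real assume "x \<in> S" "y \<in> S" "0 \<le> u \<and> u \<le> 1"
    then have A: "b + x *s w \<in> ball a R" "b + y *s w \<in> ball a R" "0 \<le> u" "u \<le> 1" by (auto simp: S_def)
    have "b + ((1 - u) *\<^sub>R x + u *\<^sub>R y) *s w = (1 - u) *\<^sub>R (b + x *s w) + u *\<^sub>R (b + y *s w)"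
      by (simp add: vec_eq_iff algebra_simps)
    also have "\<dots> \<in> ball a R" using A convex_ball[of a R] unfolding convex_alt by blast
    finally show "(1 - u) *\<^sub>R x + u *\<^sub>R y \<in> S" by (simp add: S_def)
  qed
  then have conn: "connected S" by (rule convex_connected)
  have hol: "(\<lambda>\<zeta>. f (b + \<zeta> *s w)) holomorphic_on S"
    using f by (rule holomorphic_on_complex_line) (auto simp: S_def)
  define d where "d = e / (norm w + 1)"
  have d: "0 < d" using e by (simp add: d_def add_nonneg_pos)
  have near: "f (b + \<zeta> *s w) = 0" if "\<zeta> \<in> ball 0 d" for \<zeta>
  proof (rule zero)
    have "norm \<zeta> * norm w \<le> norm \<zeta> * (norm w + 1)" by (intro mult_left_mono) auto
    also have "\<dots> < d * (norm w + 1)"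
      using that by (intro mult_strict_right_mono) (auto simp: add_nonneg_pos)
    also have "\<dots> = e"
    proof -
      have "norm w + 1 \<noteq> 0" using norm_ge_zero[of w] by linarith
      then show ?thesis by (simp add: d_def)
    qed
    finally show "b + \<zeta> *s w \<in> ball b e" by (simp add: dist_norm norm_smult)
  qed
  have "f (b + 1 *s w) = 0"
  proof (rule analytic_continuation[OF hol opS conn, of "S \<inter> ball 0 d" 0])
    show "0 \<in> S" using b by (simp add: S_def)
    show "0 islimpt S \<inter> ball 0 d"
      using opS d \<open>0 \<in> S\<close> by (intro open_imp_islimpt) auto
    show "1 \<in> S" using z by (simp add: S_def w_def)
  qed (use near in auto)
  then show ?thesis by (simp add: w_def)
qed

text \<open>The set of points with a neighbourhood on which \<open>f\<close> vanishes is open and relatively closed in \<open>D\<close>, hence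
empty.\<close>

lemma holomorphic_functions_nonzero_dense:
  fixes D :: "(complex ^ 'n) set"
  assumes D: "open D" "connected D" and f: "f \<in> holomorphic_functions D" and z0: "z0 \<in> D" "f z0 \<noteq> 0"
    and a: "a \<in> D" "0 < e"
  obtains b where "b \<in> D" "dist a b < e" "f b \<noteq> 0"
proof (rule ccontr)
  assume no: "\<not> thesis"
  define Z where "Z = {z\<in>D. \<exists>e>0. \<forall>y\<in>ball z e. f y = 0}"
  obtain e' where e': "0 < e'" "ball a e' \<subseteq> D" using D(1) a(1) by (auto simp: open_contains_ball)
  have "f y = 0" if "y \<in> ball a (min e e')" for y
  proof (rule ccontr)
    assume "f y \<noteq> 0"
    moreover have "y \<in> D" "dist a y < e" using that e'(2) by auto
    ultimately show False using no \<open>\<And>b. b \<in> D \<Longrightarrow> dist a b < e \<Longrightarrow> f b \<noteq> 0 \<Longrightarrow> thesis\<close> by blast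
  qed
  then have aZ: "a \<in> Z" using a e' by (auto simp: Z_def intro!: exI[of _ "min e e'"])
  have "openin (top_of_set D) Z"
  proof -
    have "open Z"
      unfolding open_contains_ball
    proof
      fix z assume "z \<in> Z"
      then obtain e1 where e1: "0 < e1" "\<forall>y\<in>ball z e1. f y = 0" "z \<in> D" by (auto simp: Z_def)
      obtain e2 where e2: "0 < e2" "ball z e2 \<subseteq> D" using D(1) e1(3) by (auto simp: open_contains_ball)
      have "ball z (min e1 e2) \<subseteq> Z"
      proof
        fix y assume y: "y \<in> ball z (min e1 e2)"
        have "y \<in> ball z e1" using y by simp
        then obtain e3 where "0 < e3" "ball y e3 \<subseteq> ball z e1"
          using open_contains_ball[of "ball z e1"] open_ball by blast
        then show "y \<in> Z" using y e1 e2 by (auto simp: Z_def)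
      qed
      then show "\<exists>e>0. ball z e \<subseteq> Z" using e1 e2 by (intro exI[of _ "min e1 e2"]) auto
    qed
    then show ?thesis by (intro open_openin_trans) (auto simp: Z_def D)
  qed
  moreover have "closedin (top_of_set D) Z"
  proof -
    have "z \<in> Z" if z: "z \<in> D" "z islimpt Z" for z
    proof -
      obtain R where R: "0 < R" "ball z R \<subseteq> D" using D(1) z(1) by (auto simp: open_contains_ball)
      obtain b where b: "b \<in> Z" "b \<in> ball z R"
        using z(2) R(1) by (auto simp: islimpt_approachable dist_commute)
      then obtain e1 where "0 < e1" "\<And>y. y \<in> ball b e1 \<Longrightarrow> f y = 0" by (auto simp: Z_def)
      then have "f y = 0" if "y \<in> ball z R" for y
        using holomorphic_functions_eq_0_on_ball[OF holomorphic_functions_subset[OF f R(2)] b(2)] that by blast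
      then show ?thesis using z(1) R(1) by (auto simp: Z_def)
    qed
    then show ?thesis by (auto simp: closedin_limpt Z_def)
  qed
  ultimately have "Z = D" using D(2) aZ by (auto simp: connected_clopen)
  then have "f z0 = 0" using z0 by (force simp: Z_def)
  with z0 show False by simp
qed

text \<open>On every complex line through \<open>a\<close> the function has vanishing first derivative at \<open>a\<close>, and Cauchy's
inequality bounds the second derivative in terms of the maximum over the larger ball, uniformly in the line.\<close>

lemma holomorphic_functions_second_order:
  fixes a :: "complex ^ 'n"
  assumes f: "f \<in> holomorphic_functions D" and \<rho>: "0 < \<rho>" "cball a (2 * \<rho>) \<subseteq> D"
    and crit: "(f has_derivative (\<lambda>_. 0)) (at a)"
  obtains C where "0 \<le> C" "\<And>w. norm w \<le> \<rho> \<Longrightarrow> norm (f (a + w) - f a) \<le> C * (norm w)\<^sup>2"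
proof -
  have "compact ((\<lambda>z. f z - f a) ` cball a (2 * \<rho>))"
    using holomorphic_functions_continuous[OF f] \<rho>(2)
    by (intro compact_continuous_image continuous_intros) (auto intro: continuous_on_subset)
  then obtain M where M: "\<And>z. z \<in> cball a (2 * \<rho>) \<Longrightarrow> norm (f z - f a) \<le> M"
    by (fastforce dest: compact_imp_bounded simp: bounded_iff)
  have M0: "0 \<le> M" using M[of a] \<rho> by simp
  define B where "B = fact 2 * (M + 1) / (1/2)^2"
  have B0: "0 \<le> B" using M0 by (simp add: B_def)
  have "norm (f (a + w) - f a) \<le> B / (2 * \<rho>)\<^sup>2 * (norm w)\<^sup>2" if w: "norm w \<le> \<rho>" for w
  proof (cases "w = 0")
    case False
    define u where "u = (complex_of_real (2 * \<rho> / norm w)) *s w"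
    have nu: "norm u = 2 * \<rho>" using False \<rho> by (simp add: u_def norm_smult norm_divide)
    define g where "g \<zeta> = f (a + \<zeta> *s u) - f a" for \<zeta>
    have inD: "a + \<zeta> *s u \<in> cball a (2 * \<rho>)" if "norm \<zeta> \<le> 1" for \<zeta>
      using that \<rho> mult_right_mono[of "norm \<zeta>" 1 "2 * \<rho>"] by (simp add: dist_norm norm_smult nu)
    have hol: "g holomorphic_on ball 0 1"
      unfolding g_def using inD \<rho>(2)
      by (intro holomorphic_intros holomorphic_on_complex_line[OF f]) (auto simp: subset_iff)
    have gb: "norm (g \<zeta>) \<le> M" if "norm \<zeta> \<le> 1" for \<zeta> unfolding g_def using M[OF inD[OF that]] .
    have g0: "g 0 = 0" by (simp add: g_def)
    have "((\<lambda>\<zeta>. f (a + \<zeta> *s u)) has_derivative (\<lambda>\<zeta>. 0)) (at 0)"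
    proof -
      have "bounded_linear (\<lambda>\<zeta>::complex. \<zeta> *s u)"
        unfolding linear_conv_bounded_linear[symmetric] by (auto intro!: linearI simp: vec_eq_iff algebra_simps)
      then have "((\<lambda>\<zeta>. a + \<zeta> *s u) has_derivative (\<lambda>\<zeta>. \<zeta> *s u)) (at 0)"
        by (auto intro!: derivative_eq_intros bounded_linear_imp_has_derivative)
      from has_derivative_compose[OF this, of f "\<lambda>_. 0"] crit show ?thesis by simp
    qed
    then have "(g has_field_derivative 0) (at 0)"
      unfolding g_def has_field_derivative_def by (auto intro!: derivative_eq_intros)
    then have g1: "deriv g 0 = 0" by (rule DERIV_imp_deriv)
    have sub: "ball z (1/2) \<subseteq> ball 0 1" if "z \<in> cball 0 (1/2)" for z :: complex
    proof
      fix x assume "x \<in> ball z (1/2)"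
      then show "x \<in> ball 0 1" using that norm_triangle_ineq[of z "x - z"] by (auto simp: dist_norm norm_minus_commute)
    qed
    have in1: "z \<in> ball 0 1" if "z \<in> cball 0 (1/2)" for z :: complex using that by auto
    have hb: "norm ((deriv ^^ 2) g z) \<le> B" if z: "z \<in> cball 0 (1/2)" for z
      unfolding B_def
    proof (rule Cauchy_higher_deriv_bound)
      show "g holomorphic_on ball z (1/2)" using hol sub[OF z] by (rule holomorphic_on_subset)
      have "cball z (1/2) \<subseteq> cball 0 1"
      proof
        fix x assume "x \<in> cball z (1/2)"
        then show "x \<in> cball 0 1" using z norm_triangle_ineq[of z "x - z"] by (auto simp: dist_norm norm_minus_commute)
      qed
      have "continuous_on (cball 0 1) g"
        unfolding g_def
        using inD \<rho>(2)
        by (intro holomorphic_on_imp_continuous_on holomorphic_intros holomorphic_on_complex_line[OF f]) (auto simp: subset_iff)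
      then show "continuous_on (cball z (1/2)) g"
        using \<open>cball z (1/2) \<subseteq> cball 0 1\<close> by (rule continuous_on_subset)
      show "g y \<in> ball 0 (M + 1)" if "y \<in> ball z (1/2)" for y
        using sub[OF z] that gb[of y] by (fastforce simp: subset_iff)
    qed auto
    have d1: "((deriv ^^ i) g has_field_derivative (deriv ^^ Suc i) g x) (at x within cball 0 (1/2))"
      if "x \<in> cball 0 (1/2)" for i x
    proof -
      have "(deriv ^^ i) g holomorphic_on ball 0 1" using hol by (intro holomorphic_higher_deriv) auto
      from holomorphic_derivI[OF this _ in1[OF that]] show ?thesis
        by (simp add: has_field_derivative_at_within)
    qed
    have d2: "norm ((deriv ^^ Suc 1) g x) \<le> B" if "x \<in> cball 0 (1/2)" for x
      using hb[OF that] by (simp add: numeral_2_eq_2)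
    have "norm ((deriv ^^ 0) g \<zeta> - (\<Sum>i\<le>1. (deriv ^^ i) g 0 * (\<zeta> - 0) ^ i / fact i)) \<le> B * norm (\<zeta> - 0) ^ Suc 1 / fact 1"
      if \<zeta>: "\<zeta> \<in> cball 0 (1/2)" for \<zeta>
      by (rule complex_Taylor[OF convex_cball, of 0 "1/2" 1 "\<lambda>i. (deriv ^^ i) g" B 0 \<zeta>])
        (use d1 d2 \<zeta> in auto)
    then have est: "norm (g \<zeta>) \<le> B * (norm \<zeta>)\<^sup>2" if "\<zeta> \<in> cball 0 (1/2)" for \<zeta>
      using that by (auto simp: g0 g1 power2_eq_square)
    have "complex_of_real (norm w / (2 * \<rho>)) \<in> cball 0 (1/2)" using w \<rho> by (simp add: norm_divide field_simps)
    from est[OF this] have "norm (g (of_real (norm w / (2 * \<rho>)))) \<le> B * (norm w / (2 * \<rho>))\<^sup>2"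
      using \<rho> by (simp add: norm_divide)
    moreover have "complex_of_real (norm w / (2 * \<rho>)) *s u = w"
      using False \<rho> by (simp add: u_def vec_eq_iff)
    ultimately show ?thesis by (simp add: g_def power_divide)
  qed simp
  then show thesis using B0 \<rho> by (intro that[of "B / (2 * \<rho>)\<^sup>2"]) auto
qed

lemma circle_mean_value:
  assumes "g holomorphic_on S" "open S" "cball 0 1 \<subseteq> S"
  shows "((\<lambda>x. g (cis (2 * pi * x))) has_integral g 0) {0..1}"
proof -
  have "((\<lambda>u. g u / (u - 0)) has_contour_integral (2 * of_real pi * \<i> * g 0)) (circlepath 0 1)"
    using assms by (intro Cauchy_integral_circlepath_simple) (auto intro: holomorphic_on_subset)
  then have "((\<lambda>x. g (circlepath 0 1 x) / circlepath 0 1 x * vector_derivative (circlepath 0 1) (at x))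
       has_integral (2 * of_real pi * \<i> * g 0)) {0..1}"
    by (simp add: has_contour_integral)
  moreover have "g (circlepath 0 1 x) / circlepath 0 1 x * vector_derivative (circlepath 0 1) (at x)
     = 2 * of_real pi * \<i> * g (cis (2 * pi * x))" for x
    unfolding vector_derivative_circlepath by (simp add: circlepath cis_conv_exp mult_ac)
  ultimately have "((\<lambda>x. 2 * of_real pi * \<i> * g (cis (2 * pi * x))) has_integral (2 * of_real pi * \<i> * g 0)) {0..1}"
    by simp
  from has_integral_mult_right[OF this, of "1 / (2 * of_real pi * \<i>)"] show ?thesis by simp
qed

lemma orthogonal_transformation_cis: "orthogonal_transformation (\<lambda>w. cis t *s (w :: complex ^ 'n))"
proof (rule orthogonal_transformation[THEN iffD2], intro conjI allI)
  show "linear (\<lambda>w. cis t *s (w :: complex ^ 'n))" by (intro linearI) (auto simp: vec_eq_iff algebra_simps)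
qed (simp add: norm_smult)

text \<open>The rotations \<open>w \<mapsto> cis t *s w\<close> preserve the weight, the ball and Lebesgue measure. Averaging the integrand
over them replaces \<open>f\<close> by its mean over circles around \<open>a\<close> in complex lines, which is \<open>f a = 0\<close>.\<close>

lemma integral_holomorphic_circle_invariant:
  fixes a :: "complex ^ 'n" and k :: "complex ^ 'n \<Rightarrow> real"
  assumes f: "f \<in> holomorphic_functions D" "open D" and \<rho>: "0 < \<rho>" "cball a \<rho> \<subseteq> D" and fa: "f a = 0"
    and k: "continuous_on UNIV k" "\<And>t w. k (cis t *s w) = k w"
  shows "(\<integral>w. indicator (cball 0 \<rho>) w * (k w * Re (f (a + w))) \<partial>lborel) = 0"
proof -
  define \<Phi> where "\<Phi> w = indicator (cball 0 \<rho>) w * (k w * Re (f (a + w)))" for w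
  have cont: "continuous_on (cball 0 \<rho>) (\<lambda>w. k w * Re (f (a + w)))"
  proof -
    have "continuous_on (cball 0 \<rho>) (\<lambda>w. f (a + w))"
      using \<rho>(2) by (intro continuous_on_compose2[OF holomorphic_functions_continuous[OF f(1)]] continuous_intros)
        (auto simp: subset_iff dist_norm)
    then show ?thesis using k(1) by (intro continuous_intros) (auto intro: continuous_on_subset)
  qed
  have meas[measurable]: "\<Phi> \<in> borel_measurable borel"
    unfolding \<Phi>_def using borel_measurable_continuous_on_indicator[OF _ cont] by simp
  obtain M where M: "\<And>w. w \<in> cball 0 \<rho> \<Longrightarrow> \<bar>k w * Re (f (a + w))\<bar> \<le> M"
    using compact_continuous_image[OF cont] by (fastforce dest: compact_imp_bounded simp: bounded_iff)
  have bound: "\<bar>\<Phi> w\<bar> \<le> M * indicator (cball 0 \<rho>) w" for w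
    using M[of w] by (auto simp: \<Phi>_def indicator_def)
  define H where "H p = indicator {0..1} (fst p) * \<Phi> (cis (2 * pi * fst p) *s snd p)" for p :: "real \<times> (complex ^ 'n)"
  have cts: "continuous_on UNIV (\<lambda>p. cis (2 * pi * fst p) *s (snd p :: complex ^ 'n))"
    by (intro continuous_on_smult continuous_intros)
  have [measurable]: "(\<lambda>p. cis (2 * pi * fst p) *s (snd p :: complex ^ 'n)) \<in> borel_measurable borel"
    by (rule borel_measurable_continuous_onI[OF cts])
  have Hm: "H \<in> borel_measurable borel"
    unfolding H_def
  proof (intro borel_measurable_times measurable_compose[OF _ meas])
    have "fst \<in> borel \<rightarrow>\<^sub>M (borel :: real measure)"
      by (intro borel_measurable_continuous_onI continuous_on_fst continuous_on_id)
    from measurable_compose[OF this, of "indicator {0..1}" borel]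
    show "(\<lambda>p::real \<times> (complex ^ 'n). indicator {0..1} (fst p) :: real) \<in> borel_measurable borel" by simp
  qed fact
  have Hint: "integrable (lborel \<Otimes>\<^sub>M lborel) H"
    unfolding lborel_prod
  proof (rule Bochner_Integration.integrable_bound)
    show "integrable lborel (\<lambda>p::real \<times> (complex ^ 'n). M * indicator ({0..1} \<times> cball 0 \<rho>) p :: real)"
      by (intro integrable_mult_right integrable_real_indicator emeasure_compact_finite) (auto intro!: compact_Times borel_closed closed_Times)
    show "AE p in lborel. norm (H p) \<le> norm (M * indicator ({0..1} \<times> cball 0 \<rho>) p)"
    proof (intro AE_I2)
      fix p
      have "\<bar>\<Phi> (cis (2 * pi * fst p) *s snd p)\<bar> \<le> M * indicator (cball 0 \<rho>) (cis (2 * pi * fst p) *s snd p)" by (rule bound)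
      also have "\<dots> = M * indicator (cball 0 \<rho>) (snd p)" by (simp add: indicator_def norm_smult)
      finally show "norm (H p) \<le> norm (M * indicator ({0..1} \<times> cball 0 \<rho>) p)"
        by (cases p) (auto simp: H_def indicator_def)
    qed
  qed (use Hm in simp)
  have inner1: "(\<integral>w. H (x, w) \<partial>lborel) = indicator {0..1} x * (\<integral>w. \<Phi> w \<partial>lborel)" for x
  proof -
    have "(\<integral>w. \<Phi> w \<partial>lborel) = (\<integral>w. \<Phi> (cis (2 * pi * x) *s w) \<partial>lborel)"
      using integral_affine_orthogonal[OF orthogonal_transformation_cis, of 1 \<Phi> 0] by simp
    then show ?thesis by (simp add: H_def)
  qed
  have inner2: "(\<integral>x. H (x, w) \<partial>lborel) = 0" for w
  proof (cases "w \<in> cball 0 \<rho>")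
    case False
    then have "H (x, w) = 0" for x by (simp add: H_def \<Phi>_def norm_smult)
    then show ?thesis by simp
  next
    case True
    let ?g = "\<lambda>\<zeta>. f (a + \<zeta> *s w)"
    have "continuous_on UNIV (\<lambda>\<zeta>. a + \<zeta> *s w)"
      by (intro continuous_on_add continuous_on_const continuous_on_smult continuous_on_id)
    then have op: "open ((\<lambda>\<zeta>. a + \<zeta> *s w) -` D)" using f(2) by (intro open_vimage) auto
    have sub: "cball 0 1 \<subseteq> (\<lambda>\<zeta>. a + \<zeta> *s w) -` D"
    proof
      fix \<zeta> :: complex assume "\<zeta> \<in> cball 0 1"
      then have "norm \<zeta> * norm w \<le> 1 * \<rho>" using True by (intro mult_mono) auto
      then show "\<zeta> \<in> (\<lambda>\<zeta>. a + \<zeta> *s w) -` D" using \<rho>(2) by (auto simp: subset_iff dist_norm norm_smult)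
    qed
    have hol: "?g holomorphic_on ((\<lambda>\<zeta>. a + \<zeta> *s w) -` D)"
      using f(1) by (rule holomorphic_on_complex_line) auto
    have "((\<lambda>x. ?g (cis (2 * pi * x))) has_integral ?g 0) {0..1}"
      by (rule circle_mean_value[OF hol op sub])
    from has_integral_linear[OF this bounded_linear_Re]
    have "((\<lambda>x. Re (?g (cis (2 * pi * x)))) has_integral 0) {0..1}"
      using fa by (simp add: o_def)
    from has_integral_mult_right[OF this, of "k w"]
    have I: "((\<lambda>x. k w * Re (?g (cis (2 * pi * x)))) has_integral 0) {0..1}" by simp
    have "continuous_on {0..1} (\<lambda>x. k w * Re (?g (cis (2 * pi * x))))"
      using sub by (intro continuous_intros continuous_on_compose2[OF holomorphic_on_imp_continuous_on[OF hol]]) auto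
    then have "set_integrable lborel {0..1} (\<lambda>x. k w * Re (?g (cis (2 * pi * x))))"
      by (rule borel_integrable_atLeastAtMost')
    from trans[OF set_borel_integral_eq_integral(2)[OF this] integral_unique[OF I]]
    have "(LINT x:{0..1}|lborel. k w * Re (?g (cis (2 * pi * x)))) = 0" .
    moreover have "H (x, w) = indicator {0..1} x *\<^sub>R (k w * Re (?g (cis (2 * pi * x))))" for x
      using True by (simp add: H_def \<Phi>_def norm_smult k(2))
    ultimately show ?thesis unfolding set_lebesgue_integral_def by presburger
  qed
  have "(\<integral>w. \<Phi> w \<partial>lborel) = (\<integral>x. (\<integral>w. H (x, w) \<partial>lborel) \<partial>lborel)"
    unfolding inner1 by (simp add: integral_indicator_finite_real measure_lborel_Icc)
  also have "\<dots> = (\<integral>w. (\<integral>x. H (x, w) \<partial>lborel) \<partial>lborel)"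
    using lborel_pair.Fubini_integral[of "\<lambda>x w. H (x, w)"] Hint by (simp add: case_prod_beta')
  also have "\<dots> = 0" by (simp add: inner2)
  finally show ?thesis by (simp add: \<Phi>_def)
qed

section \<open>The second fundamental form of an affine morphism\<close>

lemma norm_vec_power2: "(norm (x :: 'a::real_normed_vector ^ 'k))\<^sup>2 = (\<Sum>i\<in>UNIV. (norm (x $ i))\<^sup>2)"
  by (simp add: norm_vec_def L2_set_def sum_nonneg)

text \<open>With \<open>G j = \<partial>g/\<partial>z\<^sub>j\<close>, the coefficient \<open>\<beta>\<^sub>j\<close> is minus the component of \<open>G j\<close> orthogonal to \<open>g\<close>. In
particular its norm is at most that of \<open>G j\<close>.\<close>

lemma beta_nth:
  fixes g :: "complex ^ 'n \<Rightarrow> complex ^ 'k"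
  assumes g: "\<And>\<nu>. (\<lambda>w. g w $ \<nu>) \<in> holomorphic_functions D" and z: "z \<in> D" "g z \<noteq> 0"
  defines "G \<equiv> (\<lambda>j. (\<chi> \<nu>. frechet_derivative (\<lambda>w. g w $ \<nu>) (at z) (axis j 1)))"
  shows "beta g z $ j = - (G j - (herm (G j) (g z) / of_real ((norm (g z))\<^sup>2)) *s g z)"
proof -
  define L where "L \<nu> = frechet_derivative (\<lambda>w. g w $ \<nu>) (at z)" for \<nu>
  have L: "((\<lambda>w. g w $ \<nu>) has_derivative L \<nu>) (at z)" "L \<nu> (c *s v) = c * L \<nu> v" for \<nu> c v
    using holomorphic_functionsD[OF g z(1)] by (simp_all add: L_def)
  have ii: "axis j \<i> = \<i> *s (axis j 1 :: complex ^ 'n)" by (simp add: vec_eq_iff axis_def)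
  define N where "N w = complex_of_real ((norm (g w))\<^sup>2)" for w
  have N: "N w = (\<Sum>\<mu>\<in>UNIV. g w $ \<mu> * cnj (g w $ \<mu>))" for w
    unfolding N_def herm_self[symmetric] herm_def ..
  have Nz: "N z \<noteq> 0" using z(2) by (simp add: N_def)
  define dN where "dN v = (\<Sum>\<mu>\<in>UNIV. g z $ \<mu> * cnj (L \<mu> v) + L \<mu> v * cnj (g z $ \<mu>))" for v
  have dN: "(N has_derivative dN) (at z)"
    unfolding N dN_def
    by (intro has_derivative_sum has_derivative_mult has_derivative_cnj L)
  have "((\<lambda>w. g w $ \<nu> / N w) has_derivative (\<lambda>v. (L \<nu> v * N z - g z $ \<nu> * dN v) / (N z * N z))) (at z)" for \<nu>
    by (rule has_derivative_divide'[OF L(1) dN Nz])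
  from frechet_derivative_at[OF this]
  have fd: "frechet_derivative (\<lambda>w. g w $ \<nu> / N w) (at z) = (\<lambda>v. (L \<nu> v * N z - g z $ \<nu> * dN v) / (N z * N z))" for \<nu>
    by simp
  have dzN: "(dN (axis j 1) - \<i> * dN (axis j \<i>)) / 2 = herm (G j) (g z)"
  proof -
    have "dN (axis j 1) - \<i> * dN (axis j \<i>) = (\<Sum>\<mu>\<in>UNIV. 2 * (L \<mu> (axis j 1) * cnj (g z $ \<mu>)))"
      unfolding dN_def sum_distrib_left sum_subtractf[symmetric]
      by (intro sum.cong refl) (simp add: ii L(2) algebra_simps)
    then show ?thesis by (simp add: herm_def G_def L_def sum_distrib_left[symmetric])
  qed
  have "d_z j (\<lambda>w. g w $ \<nu> / N w) z = (G j $ \<nu> * N z - g z $ \<nu> * herm (G j) (g z)) / (N z * N z)" for \<nu>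
  proof -
    have "d_z j (\<lambda>w. g w $ \<nu> / N w) z
        = ((L \<nu> (axis j 1) - \<i> * L \<nu> (axis j \<i>)) / 2 * N z - g z $ \<nu> * ((dN (axis j 1) - \<i> * dN (axis j \<i>)) / 2)) / (N z * N z)"
      unfolding d_z_def fd by (simp only: divide_inverse) (simp add: algebra_simps)
    also have "(L \<nu> (axis j 1) - \<i> * L \<nu> (axis j \<i>)) / 2 = G j $ \<nu>"
      by (simp add: ii L(2)) (simp add: G_def L_def)
    finally show ?thesis unfolding dzN .
  qed
  then show ?thesis
    unfolding beta_def N_def[symmetric] using Nz by (simp add: vec_eq_iff field_simps)
qed

lemma herm_add_right: "herm x (y + z) = herm x y + herm x z"
  by (simp add: herm_def distrib_left sum.distrib)

lemma norm_projection_le: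
  fixes G y :: "complex ^ 'k"
  assumes "y \<noteq> 0"
  shows "norm (G - (herm G y / of_real ((norm y)\<^sup>2)) *s y) \<le> norm G"
proof -
  define t where "t = herm G y / of_real ((norm y)\<^sup>2)"
  define P where "P = G - t *s y"
  have t: "t * of_real ((norm y)\<^sup>2) = herm G y" using assms by (simp add: t_def)
  have "P = G + (- t) *s y" by (simp add: P_def)
  then have "herm P y = herm G y + (- t) * herm y y" by (simp only: herm_add_left herm_smult_left)
  then have Py: "herm P y = 0" using t by (simp add: herm_self)
  then have yP: "herm y P = 0" using herm_commute[of y P] by simp
  have G: "G = P + t *s y" by (simp add: P_def)
  have "herm G G = herm P P + t * cnj t * herm y y"
    unfolding G herm_add_left herm_add_right herm_smult_left herm_smult_right Py yP by simp
  then have "complex_of_real ((norm G)\<^sup>2) = of_real ((norm P)\<^sup>2 + (norm t)\<^sup>2 * (norm y)\<^sup>2)"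
    by (simp only: herm_self complex_norm_square of_real_add of_real_mult)
  then have "(norm G)\<^sup>2 = (norm P)\<^sup>2 + (norm t)\<^sup>2 * (norm y)\<^sup>2" by (simp only: of_real_eq_iff)
  then have "(norm P)\<^sup>2 \<le> (norm G)\<^sup>2" by simp
  then show ?thesis by (simp add: P_def t_def)
qed

lemma norm_beta_le:
  fixes g :: "complex ^ 'n \<Rightarrow> complex ^ 'k"
  assumes g: "\<And>\<nu>. (\<lambda>w. g w $ \<nu>) \<in> holomorphic_functions D" and z: "z \<in> D" "g z \<noteq> 0"
  shows "(norm (beta g z))\<^sup>2 \<le> (\<Sum>j\<in>UNIV. \<Sum>\<nu>\<in>UNIV. (norm (frechet_derivative (\<lambda>w. g w $ \<nu>) (at z) (axis j 1)))\<^sup>2)"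
proof -
  let ?G = "\<lambda>j. (\<chi> \<nu>. frechet_derivative (\<lambda>w. g w $ \<nu>) (at z) (axis j 1)) :: complex ^ 'k"
  have "(norm (beta g z $ j))\<^sup>2 \<le> (norm (?G j))\<^sup>2" for j
    using norm_projection_le[OF z(2), of "?G j"] unfolding beta_nth[OF g z] norm_minus_cancel
    by (intro power_mono) auto
  then show ?thesis
    unfolding norm_vec_power2[of "beta g z"] by (intro sum_mono) (simp add: norm_vec_power2)
qed

lemma norm_dot_le: "norm (dot x y) \<le> norm x * norm y"
proof -
  have "norm (dot x y) \<le> (\<Sum>i\<in>UNIV. \<bar>norm (x $ i)\<bar> * \<bar>norm (y $ i)\<bar>)"
    unfolding dot_def by (rule order_trans[OF norm_sum]) (simp add: norm_mult)
  also have "\<dots> \<le> norm x * norm y" unfolding norm_vec_def by (rule L2_set_mult_ineq)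
  finally show ?thesis .
qed

lemma norm_sum_dot_le: "norm (\<Sum>j\<in>UNIV. dot (x $ j) (y $ j)) \<le> norm x * norm (y :: complex ^ 'k ^ 'n)"
proof -
  have "norm (\<Sum>j\<in>UNIV. dot (x $ j) (y $ j)) \<le> (\<Sum>j\<in>UNIV. \<bar>norm (x $ j)\<bar> * \<bar>norm (y $ j)\<bar>)"
    by (rule order_trans[OF norm_sum]) (auto intro!: sum_mono norm_dot_le)
  also have "\<dots> \<le> norm x * norm y" unfolding norm_vec_def[of x] norm_vec_def[of y] by (rule L2_set_mult_ineq)
  finally show ?thesis .
qed

text \<open>If the Levi matrix of \<open>\<psi>\<close> is \<open>s\<close> times the identity, the Nakano form differs from \<open>s |u|\<^sup>2\<close> by the square of
one linear functional, and the Cauchy-Schwarz inequality suffices.\<close>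

lemma nakano_form_scalar_levi:
  fixes g :: "complex ^ 'n \<Rightarrow> complex ^ 'k"
  assumes levi: "\<And>j l. levi \<psi> z $ j $ l = (if j = l then of_real s else 0)" and gz: "g z \<noteq> 0"
    and R: "(norm (beta g z))\<^sup>2 < s * (norm (g z))\<^sup>2" and u: "u \<noteq> 0"
  shows "0 < Re (nakano_form \<psi> g z u)"
proof -
  have "(\<Sum>l\<in>UNIV. levi \<psi> z $ j $ l * herm (u $ j) (u $ l)) = of_real (s * (norm (u $ j))\<^sup>2)" for j
    by (simp add: levi if_distrib[of "\<lambda>x. x * _"] herm_self cong: if_cong)
  then have eq: "Re (nakano_form \<psi> g z u)
      = s * (norm u)\<^sup>2 - (norm (\<Sum>j\<in>UNIV. dot (beta g z $ j) (u $ j)))\<^sup>2 / (norm (g z))\<^sup>2"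
    by (simp add: nakano_form_def norm_vec_power2[of u] sum_distrib_left)
  have "(norm (\<Sum>j\<in>UNIV. dot (beta g z $ j) (u $ j)))\<^sup>2 \<le> (norm (beta g z))\<^sup>2 * (norm u)\<^sup>2"
    unfolding power_mult_distrib[symmetric] by (intro power_mono norm_sum_dot_le) auto
  also have "\<dots> < s * (norm (g z))\<^sup>2 * (norm u)\<^sup>2"
    using R u by (intro mult_strict_right_mono) auto
  finally show ?thesis unfolding eq using gz by (simp add: field_simps)
qed

text \<open>For a scalar Levi matrix the curvature operator is \<open>s\<close> minus an operator with range spanned by
\<open>\<beta>\<^sup>*\<close>. Hence \<open>\<beta>\<^sup>*\<close> is an eigenvector with eigenvalue \<open>s - |\<beta>|\<^sup>2/|g|\<^sup>2\<close>, and the inverse operator can be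
evaluated explicitly on it.\<close>

lemma I_integrand_scalar_levi:
  fixes g :: "complex ^ 'n \<Rightarrow> complex ^ 'k"
  assumes g: "\<And>\<nu>. (\<lambda>w. g w $ \<nu>) \<in> holomorphic_functions D" and z: "z \<in> D" "g z \<noteq> 0"
    and levi: "\<And>j l. levi \<psi> z $ j $ l = (if j = l then of_real s else 0)"
    and R: "(norm (beta g z))\<^sup>2 < s * (norm (g z))\<^sup>2"
  shows "1 / (norm (g z))\<^sup>2 +
         Re (herm_form (inv (curv_op \<psi> g z) (beta_star_wedge_dz g z)) (beta_star_wedge_dz g z))
     = s / (s * (norm (g z))\<^sup>2 - (norm (beta g z))\<^sup>2)"
proof -
  define X where "X = beta_star_wedge_dz g z"
  define q where "q u = (\<Sum>j\<in>UNIV. dot (beta g z $ j) (u $ j))" for u :: "complex ^ 'k ^ 'n"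
  \<comment> \<open>The sign from moving \<open>d\<bar>z\<^sub>j\<close> past \<open>dz\<close>; it cancels in the quadratic form.\<close>
  define e :: complex where "e = (- 1) ^ CARD('n)"
  have e: "e * cnj e = 1" "e * e = 1" by (auto simp: e_def power_mult_distrib[symmetric])
  define b where "b = (norm (beta g z))\<^sup>2 / (norm (g z))\<^sup>2"
  have g0: "0 < (norm (g z))\<^sup>2" using z by simp
  have b: "b < s" using R g0 by (simp add: b_def field_simps)
  have star: "beta_star g z $ j $ \<nu> = cnj (beta g z $ j $ \<nu>) / of_real ((norm (g z))\<^sup>2)" for j \<nu>
    using beta_star_adjoint[OF g z] .
  have X: "X $ j = e *s (beta_star g z $ j)" for j by (simp add: X_def beta_star_wedge_dz_def e_def)
  have curv: "curv_op \<psi> g z u $ l = of_real s *s (u $ l) - q u *s (beta_star g z $ l)" for u l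
  proof -
    have "(\<Sum>j\<in>UNIV. levi \<psi> z $ j $ l *s (u $ j)) = of_real s *s (u $ l)"
      by (simp add: levi if_distrib[of "\<lambda>x. x *s _"] vec_eq_iff) (simp add: if_distrib if_distribR cong: if_cong)
    then show ?thesis
      by (simp add: curv_op_def sum_subtractf q_def) (simp add: vec_eq_iff sum_distrib_right)
  qed
  have q_smult: "q (\<chi> j. c *s (u $ j)) = c * q u" for c u
    by (simp add: q_def dot_smult_right sum_distrib_left)
  have bb: "(\<Sum>j\<in>UNIV. \<Sum>\<nu>\<in>UNIV. beta g z $ j $ \<nu> * cnj (beta g z $ j $ \<nu>)) = of_real ((norm (beta g z))\<^sup>2)"
    unfolding norm_vec_power2[of "beta g z"] norm_vec_power2[where 'k = 'k] of_real_sum complex_norm_square ..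
  have q_star: "q (beta_star g z) = of_real b"
    unfolding q_def dot_def star b_def of_real_divide bb[symmetric] sum_divide_distrib by simp
  have "inj (curv_op \<psi> g z)"
  proof (rule injI)
    fix u v assume uv: "curv_op \<psi> g z u = curv_op \<psi> g z v"
    have qd: "q u - q v = q (u - v)" by (simp add: q_def dot_diff_right sum_subtractf)
    have *: "of_real s *s (u $ l - v $ l) = (q u - q v) *s (beta_star g z $ l)" for l
      using arg_cong[OF uv, of "\<lambda>x. x $ l"] unfolding curv
      by (simp add: vec_eq_iff algebra_simps)
    have "of_real s * q (u - v) = q (\<chi> l. of_real s *s ((u - v) $ l))" by (rule q_smult[symmetric])
    also have "(\<chi> l. of_real s *s ((u - v) $ l)) = (\<chi> l. (q u - q v) *s (beta_star g z $ l))"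
      unfolding vector_minus_component * ..
    also have "q \<dots> = (q u - q v) * of_real b" by (simp only: q_smult q_star)
    finally have "(of_real s - of_real b) * (q u - q v) = 0" unfolding qd by (simp add: algebra_simps)
    then have "q u = q v" using b by (simp flip: of_real_diff)
    moreover have "s \<noteq> 0" using b by (auto simp: b_def)
      (metis divide_nonneg_pos g0 linorder_not_less zero_le_power2)
    ultimately show "u = v" using * by (simp add: vec_eq_iff)
  qed
  moreover have "curv_op \<psi> g z (\<chi> l. (1 / of_real (s - b)) *s (X $ l)) = X"
  proof -
    have qX: "q X = e * of_real b" using q_smult[of e "beta_star g z"] by (simp add: X[symmetric] q_star)
    have "curv_op \<psi> g z (\<chi> l. (1 / of_real (s - b)) *s (X $ l)) $ l = X $ l" for l
    proof -
      have "of_real (s - b) \<noteq> (0::complex)" using b by simp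
      then have d: "(1 / of_real (s - b)) * of_real (s - b) = (1::complex)" by simp
      have "of_real s * (d * (e * x)) - d * (e * of_real b) * x = (d * of_real (s - b)) * (e * x)"
        for d x :: complex by (simp add: algebra_simps)
      from this[of "1 / of_real (s - b)"] show ?thesis
        unfolding curv q_smult qX d vec_eq_iff by (simp add: X mult.assoc del: of_real_diff)
    qed
    then show ?thesis by (simp add: vec_eq_iff)
  qed
  ultimately have inv: "inv (curv_op \<psi> g z) X = (\<chi> l. (1 / of_real (s - b)) *s (X $ l))"
    by (rule inv_f_eq)
  have XX: "herm_form X X = of_real (b / (norm (g z))\<^sup>2)"
  proof -
    have "herm (X $ j) (X $ j) = (\<Sum>\<nu>\<in>UNIV. beta g z $ j $ \<nu> * cnj (beta g z $ j $ \<nu>)) / of_real ((norm (g z))\<^sup>2 * (norm (g z))\<^sup>2)" for j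
    proof -
      have "herm (X $ j) (X $ j) = herm (beta_star g z $ j) (beta_star g z $ j)"
        using e(1) by (simp add: X herm_smult_left herm_smult_right mult.assoc[symmetric] mult.commute[of "cnj e"])
      then show ?thesis by (simp add: herm_def star sum_divide_distrib mult.commute)
    qed
    then have "herm_form X X = of_real ((norm (beta g z))\<^sup>2) / of_real ((norm (g z))\<^sup>2 * (norm (g z))\<^sup>2)"
      by (simp add: herm_form_def sum_divide_distrib[symmetric] bb)
    then show ?thesis by (simp add: b_def)
  qed
  have "herm_form (inv (curv_op \<psi> g z) X) X = of_real (1 / (s - b)) * herm_form X X"
    unfolding inv herm_form_def by (simp add: herm_smult_left sum_distrib_left)
  also have "\<dots> = of_real (b / ((norm (g z))\<^sup>2 * (s - b)))" by (simp add: XX)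
  finally have "Re (herm_form (inv (curv_op \<psi> g z) X) X) = b / ((norm (g z))\<^sup>2 * (s - b))"
    by (simp only: Re_complex_of_real)
  then have "1 / (norm (g z))\<^sup>2 + Re (herm_form (inv (curv_op \<psi> g z) X) X) = s / ((norm (g z))\<^sup>2 * (s - b))"
    using b g0 by (simp add: field_simps)
  also have "(norm (g z))\<^sup>2 * (s - b) = s * (norm (g z))\<^sup>2 - (norm (beta g z))\<^sup>2"
    using g0 by (simp add: b_def field_simps)
  finally show ?thesis by (simp add: X_def)
qed


text \<open>A quadratic weight with Levi matrix \<open>s\<close> times the identity. The pluriharmonic linear term leaves the Levi
matrix unchanged; it serves to centre the Gaussian \<open>exp (- shifted_weight)\<close> relative to another weight.\<close>

definition shifted_weight :: "real \<Rightarrow> complex ^ 'n \<Rightarrow> complex ^ 'n \<Rightarrow> complex ^ 'n \<Rightarrow> real" where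
  "shifted_weight s a \<alpha> z = s * (norm (z - a))\<^sup>2 - 2 * Re (dot \<alpha> (z - a))"

lemma Ck_on_affine:
  fixes A :: "'a::real_normed_vector \<Rightarrow> real"
  assumes "bounded_linear A"
  shows "Ck_on k (\<lambda>x. A x + c) D"
proof -
  have const: "Ck_on k (\<lambda>x::'a. c::real) D" for k c
    by (induction k arbitrary: c) auto
  have d: "((\<lambda>x. A x + c) has_derivative A) (at x)" for x
    using assms by (intro has_derivative_add_const bounded_linear_imp_has_derivative)
  show ?thesis
  proof (cases k)
    case 0
    have "continuous_on D (\<lambda>x. A x + c)"
      using d by (meson continuous_at_imp_continuous_on has_derivative_continuous)
    then show ?thesis using 0 by simp
  next
    case (Suc k')
    have "frechet_derivative (\<lambda>x. A x + c) (at x) = A" for x using frechet_derivative_at[OF d] by simp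
    moreover have "(\<lambda>x. A x + c) differentiable (at x)" for x using d by (rule differentiableI)
    ultimately show ?thesis using Suc const by simp
  qed
qed

lemma shifted_weight_derivative:
  "(shifted_weight s a \<alpha> has_derivative (\<lambda>v. 2 * s * ((z - a) \<bullet> v) - 2 * Re (dot \<alpha> v))) (at z)"
proof -
  have 1: "((\<lambda>z. s * ((z - a) \<bullet> (z - a))) has_derivative (\<lambda>v. s * ((z - a) \<bullet> v + v \<bullet> (z - a)))) (at z)"
  proof -
    have "((\<lambda>z. z - a) has_derivative (\<lambda>v. v)) (at z)" by (auto intro!: derivative_eq_intros)
    then show ?thesis by (intro has_derivative_mult_right has_derivative_inner)
  qed
  have 2: "((\<lambda>z. 2 * Re (dot \<alpha> (z - a))) has_derivative (\<lambda>v. 2 * Re (dot \<alpha> v))) (at z)"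
    using has_derivative_affine_dot[of \<alpha> a 0]
    by (intro has_derivative_mult_right has_derivative_Re) simp
  show ?thesis
    unfolding shifted_weight_def[abs_def] power2_norm_eq_inner
    by (rule has_derivative_eq_rhs[OF has_derivative_diff[OF 1 2]]) (simp add: fun_eq_iff inner_commute)
qed

text \<open>The derivative is an affine function of \<open>z\<close>, written as linear part plus constant for use with
\<open>Ck_on_affine\<close>.\<close>

lemma shifted_weight_frechet:
  "frechet_derivative (shifted_weight s a \<alpha>) (at z) v = (2 * s) * (z \<bullet> v) + (- (2 * s) * (a \<bullet> v) - 2 * Re (dot \<alpha> v))"
  unfolding frechet_derivative_at[OF shifted_weight_derivative[of s a \<alpha> z], symmetric]
  by (simp add: inner_diff_left algebra_simps)

lemma smooth_on_shifted_weight: "smooth_on (shifted_weight s a \<alpha>) D"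
  unfolding smooth_on_def
proof
  fix k
  show "Ck_on k (shifted_weight s a \<alpha>) D"
  proof (cases k)
    case 0
    have "continuous_on D (shifted_weight s a \<alpha>)"
      using shifted_weight_derivative by (meson continuous_at_imp_continuous_on has_derivative_continuous)
    then show ?thesis using 0 by simp
  next
    case (Suc k')
    have "Ck_on k' (\<lambda>x. frechet_derivative (shifted_weight s a \<alpha>) (at x) v) D" for v
      unfolding shifted_weight_frechet
      by (intro Ck_on_affine bounded_linear_mult_const bounded_linear_const_mult bounded_linear_inner_left)
    moreover have "shifted_weight s a \<alpha> differentiable (at x)" for x
      using shifted_weight_derivative by (rule differentiableI)
    ultimately show ?thesis using Suc by simp
  qed
qed

lemma levi_shifted_weight:
  "levi (shifted_weight s a \<alpha>) z $ j $ l = (if j = l then of_real s else 0)"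
proof -
  have C2: "Ck_on 2 (shifted_weight s a \<alpha>) UNIV" using smooth_on_shifted_weight unfolding smooth_on_def by blast
  have S: "second_derivative (shifted_weight s a \<alpha>) z u v = 2 * s * (u \<bullet> v)" for u v
  proof -
    have "((\<lambda>x. frechet_derivative (shifted_weight s a \<alpha>) (at x) v) has_derivative (\<lambda>u. 2 * s * (u \<bullet> v))) (at z)"
      unfolding shifted_weight_frechet
      by (intro has_derivative_add_const bounded_linear_imp_has_derivative bounded_linear_const_mult bounded_linear_inner_left)
    from frechet_derivative_at[OF this, symmetric] show ?thesis by (simp add: second_derivative_def)
  qed
  show ?thesis
    unfolding levi_nth[OF C2 open_UNIV UNIV_I] S by (auto simp: inner_axis_axis inner_complex_def complex_eq_iff)
qed

text \<open>On the circle \<open>z + cis t *s w\<close> the weight is its value at \<open>z\<close>, plus \<open>s |w|\<^sup>2\<close>, plus a combination of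
\<open>cos t\<close> and \<open>sin t\<close> with mean zero.\<close>

lemma plurisubharmonic_shifted_weight:
  assumes "0 \<le> s"
  shows "plurisubharmonic_on (shifted_weight s a \<alpha>) D"
  unfolding plurisubharmonic_on_def
proof (intro conjI ballI allI impI)
  fix z c assume "z \<in> D" and c: "shifted_weight s a \<alpha> z < c"
  have "isCont (shifted_weight s a \<alpha>) z" by (rule has_derivative_continuous[OF shifted_weight_derivative])
  then have "\<forall>\<^sub>F w in at z. shifted_weight s a \<alpha> w < c"
    using c by (simp add: isCont_def order_tendstoD(2))
  then show "\<forall>\<^sub>F w in at z within D. shifted_weight s a \<alpha> w < c"
    by (rule filter_leD[OF at_le[OF subset_UNIV]])
next
  fix z w assume "\<forall>\<zeta>. norm \<zeta> \<le> 1 \<longrightarrow> z + \<zeta> *s w \<in> D"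
  define \<kappa> where "\<kappa> = 2 * of_real s * cnj (herm (z - a) w) - 2 * dot \<alpha> w"
  have eq: "shifted_weight s a \<alpha> (z + cis t *s w)
      = (shifted_weight s a \<alpha> z + s * (norm w)\<^sup>2) + (Re \<kappa> * cos t - Im \<kappa> * sin t)" for t
  proof -
    have "(norm (z + cis t *s w - a))\<^sup>2 = (norm ((z - a) + cis t *s w))\<^sup>2" by (simp add: algebra_simps)
    also have "\<dots> = (norm (z - a))\<^sup>2 + 2 * ((z - a) \<bullet> (cis t *s w)) + (norm (cis t *s w))\<^sup>2"
      by (simp add: power2_norm_eq_inner inner_add_left inner_add_right inner_commute)
    also have "(z - a) \<bullet> (cis t *s w) = Re (cnj (cis t) * herm (z - a) w)"
      by (simp add: inner_eq_Re_herm herm_smult_right)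
    finally have n: "(norm (z + cis t *s w - a))\<^sup>2 = (norm (z - a))\<^sup>2 + 2 * Re (cnj (cis t) * herm (z - a) w) + (norm w)\<^sup>2"
      by (simp add: norm_smult)
    have "dot \<alpha> (z + cis t *s w - a) = dot \<alpha> (z - a) + cis t * dot \<alpha> w"
      by (simp add: dot_add_right dot_diff_right dot_smult_right)
    then show ?thesis
      unfolding shifted_weight_def n by (simp add: \<kappa>_def algebra_simps)
  qed
  have "((\<lambda>t. (shifted_weight s a \<alpha> z + s * (norm w)\<^sup>2) + (Re \<kappa> * cos t - Im \<kappa> * sin t))
     has_integral ((shifted_weight s a \<alpha> z + s * (norm w)\<^sup>2) * (2 * pi) + (Re \<kappa> * sin (2 * pi) + Im \<kappa> * cos (2 * pi))
       - ((shifted_weight s a \<alpha> z + s * (norm w)\<^sup>2) * 0 + (Re \<kappa> * sin 0 + Im \<kappa> * cos 0)))) {0..2 * pi}"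
    by (rule fundamental_theorem_of_calculus)
      (auto intro!: derivative_eq_intros simp: has_real_derivative_iff_has_vector_derivative[symmetric])
  then have "integral {0..2 * pi} (\<lambda>t. shifted_weight s a \<alpha> (z + cis t *s w))
      = (shifted_weight s a \<alpha> z + s * (norm w)\<^sup>2) * (2 * pi)"
    unfolding eq by (simp add: integral_unique)
  then show "shifted_weight s a \<alpha> z \<le> integral {0..2 * pi} (\<lambda>t. shifted_weight s a \<alpha> (z + cis t *s w)) / (2 * pi)"
    using assms by simp
qed


text \<open>The components \<open>1, \<dots>, r\<close> vanish to first order on an affine subspace through \<open>a\<close>; the constant last component
keeps the map free of zeros, and its size controls the second fundamental form.\<close>

definition affine_map :: "complex ^ 'n \<Rightarrow> ('r \<Rightarrow> complex ^ 'n) \<Rightarrow> real \<Rightarrow> complex ^ 'n \<Rightarrow> complex ^ ('r::finite option)" where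
  "affine_map a b c z = (\<chi> \<nu>. case \<nu> of None \<Rightarrow> of_real c | Some i \<Rightarrow> dot (b i) (z - a))"

lemma affine_map_nth: "affine_map a b c z $ None = of_real c" "affine_map a b c z $ Some i = dot (b i) (z - a)"
  by (simp_all add: affine_map_def)

lemma sum_option:
  fixes f :: "'r::finite option \<Rightarrow> 'b::comm_monoid_add"
  shows "(\<Sum>\<nu>\<in>UNIV. f \<nu>) = f None + (\<Sum>i\<in>UNIV. f (Some i))"
  by (simp add: UNIV_option_conv sum.reindex)

lemma norm_affine_map: "(norm (affine_map a b c z))\<^sup>2 = c\<^sup>2 + (\<Sum>i\<in>UNIV. (norm (dot (b i) (z - a)))\<^sup>2)"
  by (simp add: norm_vec_power2 sum_option affine_map_nth)

lemma affine_map_holomorphic: "(\<lambda>z. affine_map a b c z $ \<nu>) \<in> holomorphic_functions D"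
  by (cases \<nu>) (simp_all add: affine_map_nth holomorphic_functions_const holomorphic_functions_dot)

lemma affine_map_nonzero: "c \<noteq> 0 \<Longrightarrow> affine_map a b c z \<noteq> 0"
  using affine_map_nth(1)[of a b c z] by (metis of_real_eq_0_iff zero_index)

lemma affine_map_derivative:
  "frechet_derivative (\<lambda>w. affine_map a b c w $ \<nu>) (at z) v = (case \<nu> of None \<Rightarrow> 0 | Some i \<Rightarrow> dot (b i) v)"
proof (cases \<nu>)
  case (Some i)
  have "((\<lambda>w. affine_map a b c w $ \<nu>) has_derivative dot (b i)) (at z)"
    using has_derivative_affine_dot[of "b i" a 0] by (simp add: Some affine_map_nth)
  from frechet_derivative_at[OF this] show ?thesis by (simp add: Some)
qed (simp add: affine_map_nth)

lemma norm_beta_affine_map: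
  fixes b :: "'r::finite \<Rightarrow> complex ^ 'n"
  assumes "c \<noteq> 0"
  shows "(norm (beta (affine_map a b c) z))\<^sup>2 \<le> (\<Sum>i\<in>UNIV. (norm (b i))\<^sup>2)"
proof -
  have d: "dot x (axis j 1) = x $ j" for x :: "complex ^ 'n" and j
    by (simp add: dot_def axis_def if_distrib[of "(*) _"] cong: if_cong)
  have "(norm (beta (affine_map a b c) z))\<^sup>2 \<le> (\<Sum>j\<in>UNIV. \<Sum>\<nu>\<in>UNIV.
      (norm (frechet_derivative (\<lambda>w. affine_map a b c w $ \<nu>) (at z) (axis j 1)))\<^sup>2)"
    by (rule norm_beta_le[where D = UNIV]) (auto simp: affine_map_holomorphic affine_map_nonzero assms)
  also have "\<dots> = (\<Sum>j\<in>UNIV. \<Sum>i\<in>UNIV. (norm (b i $ j))\<^sup>2)"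
    by (simp add: affine_map_derivative sum_option d)
  also have "\<dots> = (\<Sum>i\<in>UNIV. (norm (b i))\<^sup>2)"
    by (subst sum.swap) (simp add: norm_vec_power2)
  finally show ?thesis .
qed

lemma wedge_affine_map:
  fixes b :: "'r::finite \<Rightarrow> complex ^ 'n"
  assumes "\<And>i j. dot (b i) (v j) = (if i = j then 1 else 0)"
  shows "wedge_dg (affine_map a b c) z v = 1"
proof -
  have "(\<chi> i j. frechet_derivative (\<lambda>w. affine_map a b c w $ Some i) (at z) (v j)) = (mat 1 :: complex ^ 'r ^ 'r)"
    by (simp add: affine_map_derivative assms mat_def vec_eq_iff)
  then show ?thesis by (simp add: wedge_dg_def)
qed

section \<open>Normal form of the weight at a point\<close>

lemma complex_linear_expansion:
  fixes L :: "complex ^ 'n \<Rightarrow> complex"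
  assumes "linear L" "\<And>c v. L (c *s v) = c * L v"
  shows "L v = (\<Sum>j\<in>UNIV. L (axis j 1) * v $ j)"
proof -
  have "L v = L (\<Sum>j\<in>UNIV. (v $ j) *s axis j 1)" by (simp add: basis_expansion)
  also have "\<dots> = (\<Sum>j\<in>UNIV. L (axis j 1) * v $ j)"
    by (simp add: linear_sum[OF assms(1)] assms(2) mult.commute)
  finally show ?thesis .
qed

lemma real_linear_eq_Re_dot:
  fixes L :: "complex ^ 'n \<Rightarrow> real"
  assumes "linear L"
  shows "L v = 2 * Re (dot (\<chi> j. Complex (L (axis j 1) / 2) (- L (axis j \<i>) / 2)) v)"
proof -
  have "L v = L (\<Sum>b\<in>Basis. (v \<bullet> b) *\<^sub>R b)" by (simp add: euclidean_representation)
  also have "\<dots> = (\<Sum>b\<in>Basis. (v \<bullet> b) * L b)"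
    by (simp add: linear_sum[OF assms] linear_cmul[OF assms] del: euclidean_representation)
  also have "\<dots> = (\<Sum>j\<in>UNIV. Re (v $ j) * L (axis j 1) + Im (v $ j) * L (axis j \<i>))"
    by (simp add: sum_complex_vec_Basis inner_axis inner_complex_def)
  also have "\<dots> = 2 * Re (dot (\<chi> j. Complex (L (axis j 1) / 2) (- L (axis j \<i>) / 2)) v)"
    unfolding dot_def Re_sum sum_distrib_left by (intro sum.cong) (auto simp: field_simps)
  finally show ?thesis .
qed

lemma taylor_limit:
  fixes \<phi> :: "'a::euclidean_space \<Rightarrow> real"
  assumes C2: "Ck_on 2 \<phi> D" and D: "open D" "a \<in> D"
  shows "((\<lambda>s. s * (\<phi> (a + (1 / sqrt s) *\<^sub>R x) - \<phi> a - frechet_derivative \<phi> (at a) ((1 / sqrt s) *\<^sub>R x)))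
     \<longlongrightarrow> second_derivative \<phi> a x x / 2) at_top"
proof (rule tendstoI)
  fix e :: real assume e: "0 < e"
  have "isCont (\<lambda>z. second_derivative \<phi> z x x) a"
    using Ck_on_2D(3)[OF C2] D by (simp add: continuous_on_eq_continuous_at)
  then obtain d where d: "0 < d" "\<And>z. dist z a < d \<Longrightarrow> \<bar>second_derivative \<phi> z x x - second_derivative \<phi> a x x\<bar> < e"
    using e by (auto simp: continuous_at_eps_delta dist_real_def)
  obtain d' where d': "0 < d'" "ball a d' \<subseteq> D" using D by (auto simp: open_contains_ball)
  have "((\<lambda>s. norm ((1 / sqrt s) *\<^sub>R x)) \<longlongrightarrow> 0) at_top"
  proof -
    have "((\<lambda>s. inverse (sqrt s)) \<longlongrightarrow> 0) at_top"
      by (intro tendsto_inverse_0_at_top sqrt_at_top)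
    then have "((\<lambda>s. (1 / sqrt s) *\<^sub>R x) \<longlongrightarrow> 0 *\<^sub>R x) at_top"
      by (intro tendsto_scaleR tendsto_const) (simp add: divide_inverse)
    then have "((\<lambda>s. (1 / sqrt s) *\<^sub>R x) \<longlongrightarrow> 0) at_top" by simp
    then show ?thesis by (rule tendsto_norm_zero)
  qed
  then have "\<forall>\<^sub>F s in at_top. norm ((1 / sqrt s) *\<^sub>R x) < min d d'"
    using d d' by (intro order_tendstoD) auto
  then show "\<forall>\<^sub>F s in at_top. dist (s * (\<phi> (a + (1 / sqrt s) *\<^sub>R x) - \<phi> a - frechet_derivative \<phi> (at a) ((1 / sqrt s) *\<^sub>R x)))
     (second_derivative \<phi> a x x / 2) < e"
    using eventually_gt_at_top[of 0]
  proof eventually_elim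
    case (elim s)
    define w where "w = (1 / sqrt s) *\<^sub>R x"
    have near: "dist (a + t *\<^sub>R w) a < min d d'" if "0 \<le> t" "t \<le> 1" for t
    proof -
      have "t * norm w \<le> 1 * norm w" using that by (intro mult_right_mono) auto
      then show ?thesis using elim that by (simp add: dist_norm w_def)
    qed
    have inD: "a + t *\<^sub>R w \<in> D" if "0 \<le> t" "t \<le> 1" for t
      using near[OF that] d'(2) by (auto simp: subset_iff dist_commute)
    obtain t where t: "0 \<le> t" "t \<le> 1" "\<phi> (a + w) = \<phi> a + frechet_derivative \<phi> (at a) w + second_derivative \<phi> (a + t *\<^sub>R w) w w / 2"
      using taylor_second_order[OF C2 inD] by blast
    obtain p where p: "p = a + t *\<^sub>R w" by simp
    have pD: "p \<in> D" using inD[OF t(1,2)] by (simp add: p)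
    have "second_derivative \<phi> p (c *\<^sub>R x) (c *\<^sub>R x) = (c * c) * second_derivative \<phi> p x x" for c
      using linear_cmul[OF second_derivative_linear(1)[OF C2 D(1) pD]]
        linear_cmul[OF second_derivative_linear(2)[OF C2 D(1) pD]] by simp
    from this[of "1 / sqrt s"] have "second_derivative \<phi> p w w = second_derivative \<phi> p x x / s"
      using elim by (simp add: w_def)
    then have "second_derivative \<phi> (a + t *\<^sub>R w) w w = second_derivative \<phi> (a + t *\<^sub>R w) x x / s"
      by (simp add: p)
    then have "s * (\<phi> (a + w) - \<phi> a - frechet_derivative \<phi> (at a) w) = second_derivative \<phi> (a + t *\<^sub>R w) x x / 2"
      using t(3) elim by simp
    moreover have "\<bar>second_derivative \<phi> (a + t *\<^sub>R w) x x - second_derivative \<phi> a x x\<bar> < e"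
      using d(2) near[OF t(1,2)] by simp
    ultimately show ?case
      unfolding w_def[symmetric] dist_real_def using e by (simp add: diff_divide_distrib[symmetric])
  qed
qed

text \<open>A multiplicative error \<open>exp (- u)\<close> with \<open>u\<close> of order \<open>1/s\<close> may be linearised.\<close>

lemma exp_minus_1_limit:
  assumes "((\<lambda>s. s * u s) \<longlongrightarrow> l) at_top"
  shows "((\<lambda>s::real. s * (exp (- u s) - 1)) \<longlongrightarrow> - l) at_top"
proof -
  define k :: "real \<Rightarrow> real" where "k x = (if x = 0 then 1 else (exp x - 1) / x)" for x
  have k: "exp x - 1 = x * k x" for x by (simp add: k_def)
  have "((\<lambda>h. (exp h - 1) / h) \<longlongrightarrow> 1) (at (0::real))"
    using DERIV_exp[of 0] unfolding DERIV_def by simp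
  then have "(k \<longlongrightarrow> 1) (at 0)"
    by (rule Lim_transform_eventually) (auto simp: k_def eventually_at intro!: exI[of _ 1])
  then have "isCont k 0" by (simp add: isCont_def k_def)
  moreover have "(u \<longlongrightarrow> 0) at_top"
  proof -
    have "((\<lambda>s. s * u s * inverse s) \<longlongrightarrow> l * 0) at_top"
      by (intro tendsto_mult assms tendsto_inverse_0_at_top filterlim_ident)
    then have "((\<lambda>s. s * u s * inverse s) \<longlongrightarrow> 0) at_top" by simp
    then show ?thesis
      by (rule Lim_transform_eventually) (auto intro!: eventually_mono[OF eventually_gt_at_top[of 0]])
  qed
  then have "((\<lambda>s. - u s) \<longlongrightarrow> 0) at_top" using tendsto_minus by fastforce
  ultimately have "((\<lambda>s. k (- u s)) \<longlongrightarrow> k 0) at_top" by (rule isCont_tendsto_compose)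
  then have "((\<lambda>s. - (s * u s) * k (- u s)) \<longlongrightarrow> - l * 1) at_top"
    by (intro tendsto_mult tendsto_minus assms) (simp add: k_def)
  then show ?thesis by (simp add: k mult.assoc)
qed

text \<open>The vector \<open>\<alpha>\<close> is a sum of two parts: the first one cancels the logarithmic derivative of \<open>f\<close> at \<open>a\<close>, so
that \<open>F = f exp(\<alpha>\<^sub>1 \<cdot> (z - a)) / f a\<close> is \<open>1 + O(|z - a|\<^sup>2)\<close>; the second one cancels the gradient of \<open>\<phi>\<close> at \<open>a\<close>.
What remains of \<open>|f|\<^sup>2 exp(-\<phi>-\<psi>)\<close> besides the Gaussian is \<open>\<mu> = |F|\<^sup>2 exp(-\<eta>)\<close>, with \<open>\<eta>\<close> the
remainder of the first order Taylor expansion of \<open>\<phi>\<close>. To second order \<open>\<mu> - 1\<close> is the pluriharmonic function \<open>2 Re (F - 1)\<close>, which is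
kept apart because it integrates to zero exactly, minus \<open>\<eta>\<close>. A term \<open>O(|z - a|)\<close> in \<open>F - 1\<close> would contribute
\<open>|F - 1|\<^sup>2\<close> at the order of \<open>\<eta>\<close>; this is why the derivative of \<open>F\<close> has to vanish.\<close>

lemma local_model:
  fixes \<phi> :: "complex ^ 'n \<Rightarrow> real" and f :: "complex ^ 'n \<Rightarrow> complex"
  assumes D: "open D" "a \<in> D" and C2: "Ck_on 2 \<phi> D" and f: "f \<in> holomorphic_functions D" "f a \<noteq> 0"
  obtains \<alpha> \<rho> C \<mu> F where "0 < \<rho>" "0 \<le> C" "cball a \<rho> \<subseteq> D" "F \<in> holomorphic_functions D" "F a = 1"
    "continuous_on (cball 0 \<rho>) \<mu>"
    "\<And>z s. z \<in> D \<Longrightarrow> (norm (f z))\<^sup>2 * exp (- \<phi> z - shifted_weight s a \<alpha> z)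
       = (norm (f a))\<^sup>2 * exp (- \<phi> a) * (\<mu> (z - a) * exp (- s * (norm (z - a))\<^sup>2))"
    "\<And>w. norm w \<le> \<rho> \<Longrightarrow> 1 / 2 \<le> \<mu> w"
    "\<And>w. norm w \<le> \<rho> \<Longrightarrow> \<bar>\<mu> w - 1\<bar> \<le> C * (norm w)\<^sup>2"
    "\<And>w. norm w \<le> \<rho> \<Longrightarrow> \<bar>\<mu> w - 1 - 2 * Re (F (a + w) - 1)\<bar> \<le> C * (norm w)\<^sup>2"
    "\<And>x. ((\<lambda>s. s * (\<mu> ((1 / sqrt s) *\<^sub>R x) - 1 - 2 * Re (F (a + (1 / sqrt s) *\<^sub>R x) - 1)))
        \<longlongrightarrow> - (second_derivative \<phi> a x x / 2)) at_top"
proof -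
  define L where "L = frechet_derivative f (at a)"
  have L: "(f has_derivative L) (at a)" "L (c *s v) = c * L v" for c v
    using holomorphic_functionsD[OF f(1) D(2)] by (simp_all add: L_def)
  define P where "P = frechet_derivative \<phi> (at a)"
  have P: "(\<phi> has_derivative P) (at a)" using Ck_on_2D(1)[OF C2 D(2)] by (simp add: P_def)
  define \<alpha>1 where "\<alpha>1 = (\<chi> j. - L (axis j 1) / f a)"
  define \<alpha>2 where "\<alpha>2 = (\<chi> j. Complex (P (axis j 1) / 2) (- P (axis j \<i>) / 2))"
  have a1: "dot \<alpha>1 v = - L v / f a" for v
    unfolding complex_linear_expansion[OF has_derivative_linear[OF L(1)] L(2), of v] \<alpha>1_def dot_def
    by (simp add: sum_negf sum_divide_distrib)
  have a2: "2 * Re (dot \<alpha>2 v) = P v" for v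
    unfolding \<alpha>2_def by (rule real_linear_eq_Re_dot[OF has_derivative_linear[OF P], symmetric])
  define F where "F z = f z * exp (dot \<alpha>1 (z - a)) / f a" for z
  have F: "F \<in> holomorphic_functions D"
    unfolding F_def using f
    by (intro holomorphic_functions_divide holomorphic_functions_mult holomorphic_functions_const
        holomorphic_functions_compose[where k = exp and S = UNIV] holomorphic_functions_dot) (auto intro: holomorphic_intros)
  have Fa: "F a = 1" using f(2) by (simp add: F_def dot_def)
  have crit: "(F has_derivative (\<lambda>_. 0)) (at a)"
  proof -
    have "((\<lambda>z. dot \<alpha>1 (z - a)) has_derivative dot \<alpha>1) (at a)" using has_derivative_affine_dot[of \<alpha>1 a 0] by simp
    from has_derivative_compose[OF this, of exp "(*) (exp (dot \<alpha>1 (a - a)))"]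
    have de: "((\<lambda>z. exp (dot \<alpha>1 (z - a))) has_derivative (\<lambda>v. exp (dot \<alpha>1 (a - a)) * dot \<alpha>1 v)) (at a)"
      using DERIV_exp has_field_derivative_def by blast
    have d0: "dot \<alpha>1 0 = 0" by (simp add: dot_def)
    from has_derivative_mult_right[OF has_derivative_mult[OF L(1) de], of "1 / f a"]
    have "((\<lambda>z. 1 / f a * (f z * exp (dot \<alpha>1 (z - a)))) has_derivative (\<lambda>_. 0)) (at a)"
      by (rule has_derivative_eq_rhs) (use f(2) in \<open>auto simp: a1 d0 fun_eq_iff field_simps\<close>)
    moreover have "F = (\<lambda>z. 1 / f a * (f z * exp (dot \<alpha>1 (z - a))))" by (simp add: F_def fun_eq_iff)
    ultimately show ?thesis by simp
  qed
  define \<eta> where "\<eta> w = \<phi> (a + w) - \<phi> a - P w" for w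
  define \<mu> where "\<mu> w = (norm (F (a + w)))\<^sup>2 * exp (- \<eta> w)" for w
  obtain \<rho>0 where \<rho>0: "0 < \<rho>0" "cball a (2 * \<rho>0) \<subseteq> D"
  proof -
    obtain e where "0 < e" "cball a e \<subseteq> D" using D by (auto simp: open_contains_cball)
    then show thesis by (intro that[of "e / 2"]) auto
  qed
  have sub: "cball a \<rho>0 \<subseteq> D" using \<rho>0 by (auto simp: subset_iff)
  obtain C1 where C1: "0 \<le> C1" "\<And>w. norm w \<le> \<rho>0 \<Longrightarrow> norm (F (a + w) - F a) \<le> C1 * (norm w)\<^sup>2"
    using holomorphic_functions_second_order[OF F \<rho>0 crit] by blast
  obtain C0 where C0: "0 \<le> C0" "\<And>z w. z \<in> cball a \<rho>0 \<Longrightarrow> \<bar>second_derivative \<phi> z w w\<bar> \<le> C0 * (norm w)\<^sup>2"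
    using second_derivative_bound[OF C2 D(1) compact_cball sub] by blast
  have eta: "\<bar>\<eta> w\<bar> \<le> C0 * (norm w)\<^sup>2" if w: "norm w \<le> \<rho>0" for w
  proof -
    have in_ball: "a + t *\<^sub>R w \<in> cball a \<rho>0" if "0 \<le> t" "t \<le> 1" for t
    proof -
      have "t * norm w \<le> 1 * norm w" using that by (intro mult_right_mono) auto
      then show ?thesis using w that by (simp add: dist_norm)
    qed
    obtain t where t: "0 \<le> t" "t \<le> 1" "\<phi> (a + w) = \<phi> a + P w + second_derivative \<phi> (a + t *\<^sub>R w) w w / 2"
      unfolding P_def using taylor_second_order[OF C2, of a w] in_ball sub by blast
    then have "\<bar>\<eta> w\<bar> = \<bar>second_derivative \<phi> (a + t *\<^sub>R w) w w\<bar> / 2" by (simp add: \<eta>_def)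
    also have "\<dots> \<le> C0 * (norm w)\<^sup>2" using C0(2)[OF in_ball[OF t(1,2)], of w] by simp
    finally show ?thesis .
  qed
  define C where "C = 4 * C0 + 3 * C1"
  \<comment> \<open>This choice gives \<open>C * \<rho>\<^sup>2 \<le> 1 / 9\<close>, so that \<open>F\<close> and \<open>exp (- \<eta>)\<close> stay close to \<open>1\<close>.\<close>
  define \<rho> where "\<rho> = min \<rho>0 (1 / (3 * (C + 1)))"
  have Cpos: "0 \<le> C" using C0(1) C1(1) by (simp add: C_def)
  have \<rho>: "0 < \<rho>" "\<rho> \<le> \<rho>0" "C * \<rho>\<^sup>2 \<le> 1 / 9"
  proof -
    show "0 < \<rho>" using \<rho>0 Cpos by (simp add: \<rho>_def)
    show "\<rho> \<le> \<rho>0" by (simp add: \<rho>_def)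
    have "\<rho> \<le> 1 / (3 * (C + 1))" by (simp add: \<rho>_def)
    then have "\<rho>\<^sup>2 \<le> (1 / (3 * (C + 1)))\<^sup>2" using \<open>0 < \<rho>\<close> by (intro power_mono) auto
    then have "C * \<rho>\<^sup>2 \<le> C * (1 / (3 * (C + 1)))\<^sup>2" using Cpos by (rule mult_left_mono)
    also have "\<dots> = C / (C + 1)\<^sup>2 / 9"
      by (simp only: power_divide power_mult_distrib) simp
    also have "C / (C + 1)\<^sup>2 \<le> 1"
    proof -
      have "C \<le> (C + 1)\<^sup>2" using Cpos zero_le_power2[of C] unfolding power2_sum by simp
      then show ?thesis using Cpos by (simp add: divide_le_eq)
    qed
    finally show "C * \<rho>\<^sup>2 \<le> 1 / 9" by simp
  qed
  have split: "\<mu> w - 1 - 2 * Re (F (a + w) - 1) = (norm (F (a + w)))\<^sup>2 * (exp (- \<eta> w) - 1) + (norm (F (a + w) - 1))\<^sup>2" for w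
  proof -
    have "(norm y)\<^sup>2 = 1 + 2 * Re (y - 1) + (norm (y - 1))\<^sup>2" for y :: complex
      unfolding cmod_power2 by (simp add: power2_eq_square algebra_simps)
    from this[of "F (a + w)"] show ?thesis by (simp add: \<mu>_def algebra_simps)
  qed
  have bounds: "\<bar>\<mu> w - 1 - 2 * Re (F (a + w) - 1)\<bar> \<le> C * (norm w)\<^sup>2" "\<bar>\<mu> w - 1\<bar> \<le> C * (norm w)\<^sup>2"
    "1 / 2 \<le> \<mu> w" if w: "norm w \<le> \<rho>" for w
  proof -
    define n where "n = (norm w)\<^sup>2"
    have n: "0 \<le> n" "C * n \<le> 1 / 9"
    proof -
      have "n \<le> \<rho>\<^sup>2" unfolding n_def using w by (intro power_mono) auto
      then have "C * n \<le> C * \<rho>\<^sup>2" using Cpos by (rule mult_left_mono)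
      then show "C * n \<le> 1 / 9" using \<rho>(3) by linarith
    qed (simp add: n_def)
    have "C1 * n \<le> C * n / 3" "C0 * n \<le> C * n / 4"
      using C0(1) C1(1) n(1) by (simp_all add: C_def algebra_simps)
    then have small: "C1 * n \<le> 1 / 27" "C0 * n \<le> 1 / 36" using n by linarith+
    define u where "u = norm (F (a + w) - 1)"
    have u: "0 \<le> u" "u \<le> C1 * n" using C1(2)[of w] w \<rho>(2) by (simp_all add: u_def n_def Fa)
    have eta': "\<bar>\<eta> w\<bar> \<le> C0 * n" using eta[of w] w \<rho>(2) by (simp add: n_def)
    have E: "\<bar>exp (- \<eta> w) - 1\<bar> \<le> 2 * (C0 * n)"
    proof -
      have "exp (- \<eta> w) \<le> 1 + 2 * \<bar>\<eta> w\<bar>"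
        using exp_bound_lemma[of "- \<eta> w"] eta' small by simp
      moreover have "1 - \<eta> w \<le> exp (- \<eta> w)" using exp_ge_add_one_self[of "- \<eta> w"] by simp
      ultimately have "\<bar>exp (- \<eta> w) - 1\<bar> \<le> 2 * \<bar>\<eta> w\<bar>" by linarith
      then show ?thesis using eta' by linarith
    qed
    have Fn: "(norm (F (a + w)))\<^sup>2 \<le> 2"
    proof -
      have "norm (F (a + w)) \<le> 1 + u" unfolding u_def using norm_triangle_ineq[of 1 "F (a + w) - 1"] by simp
      also have "\<dots> \<le> 4 / 3" using u small by linarith
      finally have "(norm (F (a + w)))\<^sup>2 \<le> (4 / 3)\<^sup>2" by (intro power_mono) auto
      then show ?thesis by (simp add: power2_eq_square)
    qed
    have "\<bar>\<mu> w - 1 - 2 * Re (F (a + w) - 1)\<bar> \<le> (norm (F (a + w)))\<^sup>2 * \<bar>exp (- \<eta> w) - 1\<bar> + u\<^sup>2"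
      unfolding split u_def by (rule order_trans[OF abs_triangle_ineq]) (simp add: abs_mult)
    also have "\<dots> \<le> 2 * (2 * (C0 * n)) + u * 1"
      unfolding power2_eq_square[of u] using Fn E u small by (intro add_mono mult_mono) auto
    finally have b: "\<bar>\<mu> w - 1 - 2 * Re (F (a + w) - 1)\<bar> \<le> 4 * (C0 * n) + C1 * n" using u by simp
    then show "\<bar>\<mu> w - 1 - 2 * Re (F (a + w) - 1)\<bar> \<le> C * (norm w)\<^sup>2"
    proof -
      have "C * (norm w)\<^sup>2 = 4 * (C0 * n) + 3 * (C1 * n)" by (simp add: C_def n_def algebra_simps)
      then show ?thesis using b mult_nonneg_nonneg[OF C1(1) n(1)] by linarith
    qed
    have "\<bar>Re (F (a + w) - 1)\<bar> \<le> u" unfolding u_def by (rule abs_Re_le_cmod)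
    then have "\<bar>\<mu> w - 1\<bar> \<le> 4 * (C0 * n) + 3 * (C1 * n)" using b u by linarith
    then show b2: "\<bar>\<mu> w - 1\<bar> \<le> C * (norm w)\<^sup>2" by (simp add: C_def n_def algebra_simps)
    then show "1 / 2 \<le> \<mu> w" using n(2) unfolding n_def[symmetric] by linarith
  qed
  show thesis
  proof (rule that[of \<rho> C F \<mu> "\<alpha>1 + \<alpha>2"])
    show "0 < \<rho>" "0 \<le> C" by fact+
    have "cball a \<rho> \<subseteq> cball a \<rho>0" using \<rho>(2) by auto
    then show sub\<rho>: "cball a \<rho> \<subseteq> D" using sub by (rule order_trans)
    show "F \<in> holomorphic_functions D" "F a = 1" by fact+
    have "continuous_on D \<phi>"
      using Ck_on_2D(1)[OF C2] by (meson continuous_at_imp_continuous_on has_derivative_continuous)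
    then have c1: "continuous_on (cball 0 \<rho>) (\<lambda>w. \<phi> (a + w))"
      by (rule continuous_on_compose2) (auto intro!: continuous_intros subsetD[OF sub\<rho>])
    have c2: "continuous_on (cball 0 \<rho>) (\<lambda>w. F (a + w))"
      by (rule continuous_on_compose2[OF holomorphic_functions_continuous[OF F]]) (auto intro!: continuous_intros subsetD[OF sub\<rho>])
    have c3: "continuous_on (cball 0 \<rho>) P"
      using has_derivative_linear[OF P] by (intro linear_continuous_on) (simp add: linear_conv_bounded_linear)
    show "continuous_on (cball 0 \<rho>) \<mu>"
      unfolding \<mu>_def \<eta>_def by (intro continuous_intros c1 c2 c3)
    show "(norm (f z))\<^sup>2 * exp (- \<phi> z - shifted_weight s a (\<alpha>1 + \<alpha>2) z)
       = (norm (f a))\<^sup>2 * exp (- \<phi> a) * (\<mu> (z - a) * exp (- s * (norm (z - a))\<^sup>2))" if "z \<in> D" for z s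
    proof -
      define w where "w = z - a"
      have "dot (\<alpha>1 + \<alpha>2) w = dot \<alpha>1 w + dot \<alpha>2 w" by (simp add: dot_def distrib_right sum.distrib)
      then have e: "- \<phi> z - shifted_weight s a (\<alpha>1 + \<alpha>2) z = 2 * Re (dot \<alpha>1 w) + (- \<phi> a + (- \<eta> w + - s * (norm w)\<^sup>2))"
        using a2[of w] by (simp add: shifted_weight_def \<eta>_def w_def[symmetric]) (simp add: w_def)
      have "(norm (F z))\<^sup>2 * (norm (f a))\<^sup>2 = (norm (f z))\<^sup>2 * exp (2 * Re (dot \<alpha>1 w))"
        using f(2) by (simp add: F_def norm_mult norm_divide power_divide power_mult_distrib w_def exp_double)
      then show ?thesis
        unfolding e exp_add \<mu>_def w_def[symmetric] by (simp add: w_def mult_ac)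
    qed
    fix w :: "complex ^ 'n" assume "norm w \<le> \<rho>"
    from bounds[OF this] show "1 / 2 \<le> \<mu> w" "\<bar>\<mu> w - 1\<bar> \<le> C * (norm w)\<^sup>2"
      "\<bar>\<mu> w - 1 - 2 * Re (F (a + w) - 1)\<bar> \<le> C * (norm w)\<^sup>2" by simp_all
  next
    fix x :: "complex ^ 'n"
    let ?w = "\<lambda>s. (1 / sqrt s) *\<^sub>R x"
    have inv: "((\<lambda>s. inverse (sqrt s)) \<longlongrightarrow> 0) at_top" by (intro tendsto_inverse_0_at_top sqrt_at_top)
    then have "((\<lambda>s. (1 / sqrt s) *\<^sub>R x) \<longlongrightarrow> 0 *\<^sub>R x) at_top"
      by (intro tendsto_scaleR tendsto_const) (simp add: divide_inverse)
    then have "(?w \<longlongrightarrow> 0) at_top" by simp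
    then have "((\<lambda>s. norm (?w s)) \<longlongrightarrow> 0) at_top" by (rule tendsto_norm_zero)
    then have ev: "\<forall>\<^sub>F s in at_top. norm (?w s) < \<rho>0" using \<rho>0(1) by (intro order_tendstoD) auto
    have Fb: "\<forall>\<^sub>F s in at_top. norm (F (a + ?w s) - 1) \<le> C1 * (norm x)\<^sup>2 * inverse s"
      using ev eventually_gt_at_top[of 0]
    proof eventually_elim
      case (elim s)
      then show ?case using C1(2)[of "?w s"] by (simp add: Fa power_divide divide_inverse power_mult_distrib power_inverse mult_ac)
    qed
    have i0: "((\<lambda>s::real. inverse s) \<longlongrightarrow> 0) at_top" by (intro tendsto_inverse_0_at_top filterlim_ident)
    have t1: "((\<lambda>s. norm (F (a + ?w s) - 1)) \<longlongrightarrow> 0) at_top"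
    proof (rule tendsto_sandwich[OF _ Fb tendsto_const])
      show "((\<lambda>s. C1 * (norm x)\<^sup>2 * inverse s) \<longlongrightarrow> 0) at_top" using tendsto_mult[OF tendsto_const i0] by simp
    qed auto
    then have "((\<lambda>s. F (a + ?w s) - 1) \<longlongrightarrow> 0) at_top" by (simp only: tendsto_norm_zero_iff)
    from tendsto_add[OF this tendsto_const[of 1]] have t2: "((\<lambda>s. F (a + ?w s)) \<longlongrightarrow> 1) at_top" by simp
    have t3: "((\<lambda>s. (s * norm (F (a + ?w s) - 1)) * norm (F (a + ?w s) - 1)) \<longlongrightarrow> 0) at_top"
    proof (rule tendsto_sandwich)
      show "\<forall>\<^sub>F s in at_top. (s * norm (F (a + ?w s) - 1)) * norm (F (a + ?w s) - 1) \<le> (C1 * (norm x)\<^sup>2) * norm (F (a + ?w s) - 1)"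
        using Fb eventually_gt_at_top[of 0]
      proof eventually_elim
        case (elim s)
        have "s * norm (F (a + ?w s) - 1) \<le> s * (C1 * (norm x)\<^sup>2 * inverse s)" using elim by (intro mult_left_mono) auto
        also have "\<dots> = C1 * (norm x)\<^sup>2" using elim by simp
        finally show ?case by (intro mult_right_mono) auto
      qed
      show "\<forall>\<^sub>F s in at_top. 0 \<le> (s * norm (F (a + ?w s) - 1)) * norm (F (a + ?w s) - 1)"
        using eventually_gt_at_top[of 0] by eventually_elim auto
      show "((\<lambda>s. C1 * (norm x)\<^sup>2 * norm (F (a + ?w s) - 1)) \<longlongrightarrow> 0) at_top"
        using tendsto_mult[OF tendsto_const t1] by simp
    qed auto
    have t4: "((\<lambda>s. s * (exp (- \<eta> (?w s)) - 1)) \<longlongrightarrow> - (second_derivative \<phi> a x x / 2)) at_top"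
      unfolding \<eta>_def P_def by (intro exp_minus_1_limit taylor_limit[OF C2 D])
    have "((\<lambda>s. (norm (F (a + ?w s)))\<^sup>2 * (s * (exp (- \<eta> (?w s)) - 1)) + (s * norm (F (a + ?w s) - 1)) * norm (F (a + ?w s) - 1))
       \<longlongrightarrow> (norm (1::complex))\<^sup>2 * - (second_derivative \<phi> a x x / 2) + 0) at_top"
      by (intro tendsto_add tendsto_mult[OF _ t4] tendsto_power tendsto_norm t2 t3)
    moreover have "s * (\<mu> (?w s) - 1 - 2 * Re (F (a + ?w s) - 1))
        = (norm (F (a + ?w s)))\<^sup>2 * (s * (exp (- \<eta> (?w s)) - 1)) + (s * norm (F (a + ?w s) - 1)) * norm (F (a + ?w s) - 1)" for s
      unfolding split by (simp only: power2_eq_square) (simp only: algebra_simps)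
    ultimately show "((\<lambda>s. s * (\<mu> (?w s) - 1 - 2 * Re (F (a + ?w s) - 1))) \<longlongrightarrow> - (second_derivative \<phi> a x x / 2)) at_top"
      by (simp del: scaleR_conv_of_real)
  qed
qed

section \<open>The division estimate at a fixed scale\<close>

text \<open>A solution \<open>h = f k\<close> of \<open>g \<cdot> h = f\<close> with last component of \<open>g\<close> equal to \<open>sqrt s\<close> satisfies
\<open>|k|\<^sup>2 = |1 - q|\<^sup>2 / s + N\<close>, where \<open>q\<close> comes from the other components and \<open>N\<close> is their square norm. The
term linear in \<open>q\<close> is kept with weight \<open>1\<close> instead of \<open>\<mu>\<close>, since it will integrate to zero; the error
\<open>2 s Re q (\<mu> - 1)\<close> is compensated by half of \<open>s\<^sup>2 N\<close>.\<close>

lemma solution_lower_bound_pointwise: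
  fixes q :: complex and s t N m \<mu> C :: real
  assumes q: "(norm q)\<^sup>2 \<le> t * N" and nn: "0 \<le> t" "0 \<le> N" and s: "0 < s"
    and \<mu>: "1 / 2 \<le> \<mu>" "\<bar>\<mu> - 1\<bar> \<le> C * m"
  shows "s * \<mu> - 2 * Re (s * q) - 2 * C\<^sup>2 * m\<^sup>2 * t \<le> s\<^sup>2 * (((norm (1 - q))\<^sup>2 / s + N) * \<mu>)"
proof -
  have "norm q \<le> sqrt (t * N)" using q by (simp add: real_le_rsqrt)
  then have "\<bar>Re q\<bar> \<le> sqrt t * sqrt N" using abs_Re_le_cmod[of q] by (simp add: real_sqrt_mult)
  then have "\<bar>Re q\<bar> * \<bar>\<mu> - 1\<bar> \<le> (sqrt t * sqrt N) * (C * m)"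
    using \<mu>(2) nn by (intro mult_mono) auto
  then have "2 * s * (\<bar>Re q\<bar> * \<bar>\<mu> - 1\<bar>) \<le> 2 * s * ((sqrt t * sqrt N) * (C * m))"
    using s by (intro mult_left_mono) auto
  also have "\<dots> = 2 * (s * sqrt N) * (sqrt t * (C * m))" by simp
  also have "\<dots> \<le> (s * sqrt N)\<^sup>2 / 2 + 2 * (sqrt t * (C * m))\<^sup>2"
  proof -
    have "2 * x * y \<le> x\<^sup>2 / 2 + 2 * y\<^sup>2" for x y :: real
      using zero_le_power2[of "x - 2 * y"] by (simp add: power2_diff power_mult_distrib)
    then show ?thesis .
  qed
  also have "\<dots> = s\<^sup>2 * N / 2 + 2 * C\<^sup>2 * m\<^sup>2 * t" using nn by (simp add: power_mult_distrib)
  finally have cross: "2 * s * (\<bar>Re q\<bar> * \<bar>\<mu> - 1\<bar>) \<le> s\<^sup>2 * N / 2 + 2 * C\<^sup>2 * m\<^sup>2 * t" .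
  have "Re q * (\<mu> - 1) \<le> \<bar>Re q\<bar> * \<bar>\<mu> - 1\<bar>" by (simp add: abs_mult[symmetric])
  then have "2 * s * (Re q * (\<mu> - 1)) \<le> 2 * s * (\<bar>Re q\<bar> * \<bar>\<mu> - 1\<bar>)" using s by (intro mult_left_mono) auto
  with cross have 1: "2 * s * (Re q * (\<mu> - 1)) \<le> s\<^sup>2 * N / 2 + 2 * C\<^sup>2 * m\<^sup>2 * t" by linarith
  have "1 - 2 * Re q \<le> (norm (1 - q))\<^sup>2"
    unfolding cmod_power2 by (simp add: power2_eq_square algebra_simps)
  then have 2: "s * \<mu> * (1 - 2 * Re q) \<le> s * \<mu> * (norm (1 - q))\<^sup>2" using s \<mu>(1) by (intro mult_left_mono) auto
  have 3: "s\<^sup>2 * N * (1 / 2) \<le> s\<^sup>2 * N * \<mu>" using \<mu>(1) nn(2) by (intro mult_left_mono) auto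
  have "s\<^sup>2 * (((norm (1 - q))\<^sup>2 / s + N) * \<mu>) = s * \<mu> * (norm (1 - q))\<^sup>2 + s\<^sup>2 * N * \<mu>"
    using s by (simp add: power2_eq_square[of s] field_simps)
  moreover have "s * \<mu> * (1 - 2 * Re q) = s * \<mu> - 2 * (s * Re q) - 2 * s * (Re q * (\<mu> - 1))"
    by (simp add: algebra_simps)
  ultimately show ?thesis using 1 2 3 by simp
qed

lemma norm_sum_mult_Cauchy_Schwarz:
  fixes x :: "'r::finite \<Rightarrow> complex"
  shows "(norm (\<Sum>i\<in>UNIV. x i * y i))\<^sup>2 \<le> (\<Sum>i\<in>UNIV. (norm (x i))\<^sup>2) * (\<Sum>i\<in>UNIV. (norm (y i))\<^sup>2)"
proof -
  have "norm (dot (\<chi> i. x i) (\<chi> i. y i)) \<le> norm (\<chi> i. x i) * norm (\<chi> i. y i)" by (rule norm_dot_le)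
  then have "(norm (dot (\<chi> i. x i) (\<chi> i. y i)))\<^sup>2 \<le> (norm (\<chi> i. x i) * norm (\<chi> i. y i))\<^sup>2"
    by (intro power_mono) auto
  then show ?thesis by (simp add: dot_def power_mult_distrib norm_vec_power2)
qed

lemma nn_integral_compact:
  fixes H :: "'a::euclidean_space \<Rightarrow> real"
  assumes "compact S" "continuous_on S H" "\<And>z. z \<in> S \<Longrightarrow> 0 \<le> H z"
  shows "(\<integral>\<^sup>+z\<in>S. ennreal (H z) \<partial>lborel) = ennreal (\<integral>z. indicator S z * H z \<partial>lborel)"
proof -
  have "(\<integral>\<^sup>+z\<in>S. ennreal (H z) \<partial>lborel) = (\<integral>\<^sup>+z. ennreal (indicator S z * H z) \<partial>lborel)"
    by (intro nn_integral_cong) (auto simp: indicator_def)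
  also have "\<dots> = ennreal (\<integral>z. indicator S z * H z \<partial>lborel)"
    using borel_integrable_compact[OF assms(1,2)] assms(3)
    by (intro nn_integral_eq_integral) (auto simp: indicator_def)
  finally show ?thesis .
qed

lemma integral_cball_translate:
  fixes H :: "complex ^ 'n \<Rightarrow> real"
  assumes "continuous_on (cball a \<rho>) H"
  shows "(\<integral>z. indicator (cball a \<rho>) z * H z \<partial>lborel) = (\<integral>w. indicator (cball 0 \<rho>) w * H (a + w) \<partial>lborel)"
proof -
  have "(\<lambda>z. indicator (cball a \<rho>) z * H z) \<in> borel_measurable borel"
    using borel_measurable_continuous_on_indicator[OF _ assms] by simp
  moreover have "orthogonal_transformation (\<lambda>x::complex ^ 'n. x)"
    by (simp add: orthogonal_transformation_def linear_id[unfolded id_def])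
  ultimately show ?thesis
    using integral_affine_orthogonal[of "\<lambda>x. x" 1 "\<lambda>z. indicator (cball a \<rho>) z * H z" a]
    by (simp add: indicator_def dist_norm)
qed

text \<open>The norm of \<open>h\<close> over the ball, bounded below pointwise, is compared with the right hand side of the division
estimate, where the part outside the ball enters as an error \<open>R\<close>. The term linear in \<open>q\<close> drops out of the
integral by the mean value property. Both sides are multiplied by \<open>s\<^sup>2\<close>; their leading terms are then
\<open>s \<mu>\<close> and cancel.\<close>

lemma inequality_at_scale:
  fixes \<phi> \<psi> :: "complex ^ 'n \<Rightarrow> real" and f :: "complex ^ 'n \<Rightarrow> complex" and b :: "'r::finite \<Rightarrow> complex ^ 'n"
    and h :: "complex ^ 'n \<Rightarrow> complex ^ ('r option)"
  defines "t \<equiv> (\<lambda>w. \<Sum>i\<in>UNIV. (norm (dot (b i) w))\<^sup>2)"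
  assumes D: "open D" and f: "f \<in> holomorphic_functions D"
    and \<phi>: "continuous_on D \<phi>" "continuous_on D \<psi>"
    and \<rho>: "0 < \<rho>" "cball a \<rho> \<subseteq> D" and K: "0 < K"
    and \<mu>: "continuous_on (cball 0 \<rho>) \<mu>"
      "\<And>w. norm w \<le> \<rho> \<Longrightarrow> 1 / 2 \<le> \<mu> w" "\<And>w. norm w \<le> \<rho> \<Longrightarrow> \<bar>\<mu> w - 1\<bar> \<le> C * (norm w)\<^sup>2"
    and W: "\<And>z. z \<in> D \<Longrightarrow> (norm (f z))\<^sup>2 * exp (- \<phi> z - \<psi> z) = K * (\<mu> (z - a) * exp (- s * (norm (z - a))\<^sup>2))"
    and s: "0 < s" "1 \<le> s - k"
    and h: "\<And>\<nu>. (\<lambda>z. h z $ \<nu>) \<in> holomorphic_functions D" "\<And>z. z \<in> D \<Longrightarrow> f z = dot (affine_map a b (sqrt s) z) (h z)"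
    and I: "weighted_norm_sq D (\<lambda>z. \<phi> z + \<psi> z) h
      \<le> (\<integral>\<^sup>+z\<in>D. ennreal (1 / (s + t (z - a) - k) * ((norm (f z))\<^sup>2 * exp (- \<phi> z - \<psi> z))) \<partial>lborel)"
    and R: "(\<integral>\<^sup>+z\<in>D - cball a \<rho>. ennreal ((norm (f z))\<^sup>2 * exp (- \<phi> z - \<psi> z)) \<partial>lborel) \<le> ennreal R" "0 \<le> R"
  shows "(\<integral>w. indicator (cball 0 \<rho>) w * ((s * \<mu> w - 2 * C\<^sup>2 * ((norm w)\<^sup>2)\<^sup>2 * t w - s\<^sup>2 / (s + t w - k) * \<mu> w)
       * exp (- s * (norm w)\<^sup>2)) \<partial>lborel) \<le> s\<^sup>2 * R / K"
proof -
  define B where "B = cball a \<rho>"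
  define w where "w z = (norm (f z))\<^sup>2 * exp (- \<phi> z - \<psi> z)" for z
  define v where "v z = 1 / (s + t (z - a) - k)" for z
  have t0: "0 \<le> t x" for x by (auto simp: t_def intro: sum_nonneg)
  have den: "1 \<le> s + t x - k" for x using t0[of x] s(2) by linarith
  have v: "0 \<le> v z" "v z \<le> 1" for z using den[of "z - a"] by (auto simp: v_def divide_le_eq_1)
  have dn: "s + t x - k \<noteq> 0" for x using den[of x] by linarith
  have w0: "0 \<le> w z" for z by (simp add: w_def)
  have cdot: "continuous_on S (\<lambda>z. dot x (z - a))" for S and x :: "complex ^ 'n"
    by (rule holomorphic_functions_continuous[OF holomorphic_functions_dot])
  have cdot0: "continuous_on S (dot x)" for S and x :: "complex ^ 'n"
    using has_derivative_dot by (meson continuous_at_imp_continuous_on has_derivative_continuous)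
  have ct: "continuous_on S (\<lambda>z. t (z - a))" "continuous_on S t" for S
    unfolding t_def by (intro continuous_intros cdot cdot0)+
  have cf: "continuous_on D f" using holomorphic_functions_continuous[OF f] .
  have ch: "continuous_on D h"
  proof -
    have "continuous_on D (\<lambda>z. \<chi> \<nu>. h z $ \<nu>)"
      by (intro continuous_on_vec_lambda holomorphic_functions_continuous h)
    then show ?thesis by simp
  qed
  have cw: "continuous_on D w" unfolding w_def by (intro continuous_intros cf \<phi>)
  have cH: "continuous_on D (\<lambda>z. (norm (h z))\<^sup>2 * exp (- (\<phi> z + \<psi> z)))" by (intro continuous_intros ch \<phi>)
  have cvw: "continuous_on D (\<lambda>z. v z * w z)"
    unfolding v_def by (intro continuous_intros cw ct) (use dn in auto)
  \<comment> \<open>The sides of the estimate, restricted to the ball.\<close>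
  define A1 where "A1 = (\<integral>z. indicator B z * ((norm (h z))\<^sup>2 * exp (- (\<phi> z + \<psi> z))) \<partial>lborel)"
  define A2 where "A2 = (\<integral>z. indicator B z * (v z * w z) \<partial>lborel)"
  have A20: "0 \<le> A2"
    unfolding A2_def using mult_nonneg_nonneg[OF v(1) w0] by (intro Bochner_Integration.integral_nonneg) simp
  have B: "compact B" "B \<subseteq> D" "B \<in> sets lborel" using \<rho> by (auto simp: B_def)
  have Dm: "D \<in> sets lborel" using D by simp
  have "ennreal A1 = (\<integral>\<^sup>+z\<in>B. ennreal ((norm (h z))\<^sup>2 * exp (- (\<phi> z + \<psi> z))) \<partial>lborel)"
    unfolding A1_def using B cH by (intro nn_integral_compact[symmetric]) (auto intro: continuous_on_subset)
  also have "\<dots> \<le> weighted_norm_sq D (\<lambda>z. \<phi> z + \<psi> z) h"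
    unfolding weighted_norm_sq_def using B by (intro nn_integral_mono) (auto simp: indicator_def)
  also have "\<dots> \<le> (\<integral>\<^sup>+z\<in>D. ennreal (v z * w z) \<partial>lborel)" using I by (simp add: v_def w_def)
  also have "\<dots> = (\<integral>\<^sup>+z. ennreal (v z * w z) * indicator B z + ennreal (v z * w z) * indicator (D - B) z \<partial>lborel)"
    using B by (intro nn_integral_cong) (auto simp: indicator_def)
  also have "\<dots> = (\<integral>\<^sup>+z\<in>B. ennreal (v z * w z) \<partial>lborel) + (\<integral>\<^sup>+z\<in>D - B. ennreal (v z * w z) \<partial>lborel)"
  proof (rule nn_integral_add)
    have m: "(\<lambda>z. ennreal (v z * w z) * indicator S z) \<in> borel_measurable lborel" if "S \<subseteq> D" "S \<in> sets lborel" for S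
    proof -
      have "(\<lambda>z. indicator S z *\<^sub>R (v z * w z)) \<in> borel_measurable borel"
        using that continuous_on_subset[OF cvw] by (intro borel_measurable_continuous_on_indicator) auto
      then have "(\<lambda>z. ennreal (indicator S z *\<^sub>R (v z * w z))) \<in> borel_measurable lborel" by simp
      moreover have "ennreal (indicator S z *\<^sub>R (v z * w z)) = ennreal (v z * w z) * indicator S z" for z
        by (auto simp: indicator_def)
      ultimately show ?thesis by simp
    qed
    show "(\<lambda>z. ennreal (v z * w z) * indicator B z) \<in> borel_measurable lborel" using B by (intro m)
    show "(\<lambda>z. ennreal (v z * w z) * indicator (D - B) z) \<in> borel_measurable lborel"
      using B Dm by (intro m) auto
  qed
  also have "\<dots> \<le> ennreal A2 + ennreal R"
  proof (rule add_mono)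
    have "(\<integral>\<^sup>+z\<in>B. ennreal (v z * w z) \<partial>lborel) = ennreal A2"
      unfolding A2_def using B cvw mult_nonneg_nonneg[OF v(1) w0]
      by (intro nn_integral_compact) (auto intro: continuous_on_subset)
    then show "(\<integral>\<^sup>+z\<in>B. ennreal (v z * w z) \<partial>lborel) \<le> ennreal A2" by simp
    have "(\<integral>\<^sup>+z\<in>D - B. ennreal (v z * w z) \<partial>lborel) \<le> (\<integral>\<^sup>+z\<in>D - B. ennreal (w z) \<partial>lborel)"
      using v w0 by (intro nn_integral_mono mult_right_mono ennreal_leI mult_left_le_one_le) auto
    also have "\<dots> \<le> ennreal R" using R(1) by (simp add: w_def B_def)
    finally show "(\<integral>\<^sup>+z\<in>D - B. ennreal (v z * w z) \<partial>lborel) \<le> ennreal R" .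
  qed
  also have "\<dots> = ennreal (A2 + R)" using A20 R(2) by simp
  finally have A: "A1 \<le> A2 + R"
    using A20 R(2) ennreal_le_iff[of "A2 + R" A1] by linarith
  let ?\<Gamma> = "\<lambda>x::complex ^ 'n. exp (- s * (norm x)\<^sup>2)"
  have inD: "a + x \<in> D" if "x \<in> cball 0 \<rho>" for x using \<rho>(2) that by (auto simp: subset_iff dist_norm)
  have Wx: "w (a + x) = K * (\<mu> x * ?\<Gamma> x)" if "x \<in> cball 0 \<rho>" for x
    using W[OF inD[OF that]] by (simp add: w_def)
  have fnz: "f (a + x) \<noteq> 0" if "x \<in> cball 0 \<rho>" for x
  proof
    assume "f (a + x) = 0"
    then have "w (a + x) = 0" by (simp add: w_def)
    moreover have "0 < \<mu> x" using \<mu>(2)[of x] that by simp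
    ultimately show False using Wx[OF that] K by simp
  qed
  define N where "N x = (\<Sum>i\<in>UNIV. (norm (h (a + x) $ Some i / f (a + x)))\<^sup>2)" for x
  define q where "q x = (\<Sum>i\<in>UNIV. dot (b i) x * (h (a + x) $ Some i / f (a + x)))" for x
  have split: "(norm (h (a + x)))\<^sup>2 = (norm (f (a + x)))\<^sup>2 * ((norm (1 - q x))\<^sup>2 / s + N x)" if x: "x \<in> cball 0 \<rho>" for x
  proof -
    have "f (a + x) = of_real (sqrt s) * h (a + x) $ None + (\<Sum>i\<in>UNIV. dot (b i) x * h (a + x) $ Some i)"
      using h(2)[OF inD[OF x]] by (simp add: dot_def sum_option affine_map_nth)
    also have "(\<Sum>i\<in>UNIV. dot (b i) x * h (a + x) $ Some i) = f (a + x) * q x"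
      using fnz[OF x] by (simp add: q_def sum_distrib_left)
    finally have "of_real (sqrt s) * h (a + x) $ None = f (a + x) * (1 - q x)" by (simp add: algebra_simps)
    then have "(norm (of_real (sqrt s) * h (a + x) $ None))\<^sup>2 = (norm (f (a + x) * (1 - q x)))\<^sup>2" by (rule arg_cong)
    then have "s * (norm (h (a + x) $ None))\<^sup>2 = (norm (f (a + x)))\<^sup>2 * (norm (1 - q x))\<^sup>2"
      using s(1) by (simp add: norm_mult power_mult_distrib)
    moreover have "(\<Sum>i\<in>UNIV. (norm (h (a + x) $ Some i))\<^sup>2) = (norm (f (a + x)))\<^sup>2 * N x"
      using fnz[OF x] by (simp add: N_def sum_distrib_left norm_divide power_divide)
    ultimately show ?thesis using s(1) unfolding norm_vec_power2[of "h (a + x)"] sum_option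
      by (simp add: field_simps)
  qed
  have lower: "(s * \<mu> x - 2 * C\<^sup>2 * ((norm x)\<^sup>2)\<^sup>2 * t x) * ?\<Gamma> x - 2 * (s * ?\<Gamma> x * Re (q x))
      \<le> s\<^sup>2 / K * ((norm (h (a + x)))\<^sup>2 * exp (- (\<phi> (a + x) + \<psi> (a + x))))" if x: "x \<in> cball 0 \<rho>" for x
  proof -
    have "(norm (q x))\<^sup>2 \<le> t x * N x" unfolding q_def t_def N_def by (rule norm_sum_mult_Cauchy_Schwarz)
    then have "s * \<mu> x - 2 * Re (s * q x) - 2 * C\<^sup>2 * ((norm x)\<^sup>2)\<^sup>2 * t x \<le> s\<^sup>2 * (((norm (1 - q x))\<^sup>2 / s + N x) * \<mu> x)"
      using x \<mu> t0 s(1) by (intro solution_lower_bound_pointwise) (auto simp: N_def intro: sum_nonneg)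
    then have "(s * \<mu> x - 2 * Re (s * q x) - 2 * C\<^sup>2 * ((norm x)\<^sup>2)\<^sup>2 * t x) * ?\<Gamma> x
        \<le> s\<^sup>2 * (((norm (1 - q x))\<^sup>2 / s + N x) * \<mu> x) * ?\<Gamma> x" by (intro mult_right_mono) auto
    also have "\<dots> = s\<^sup>2 / K * (((norm (1 - q x))\<^sup>2 / s + N x) * w (a + x))"
      unfolding Wx[OF x] using K by simp
    also have "\<dots> = s\<^sup>2 / K * ((norm (h (a + x)))\<^sup>2 * exp (- (\<phi> (a + x) + \<psi> (a + x))))"
      unfolding split[OF x] by (simp add: w_def)
    finally show ?thesis by (simp add: algebra_simps)
  qed
  have cshift: "continuous_on (cball 0 \<rho>) (\<lambda>x. H (a + x))" if "continuous_on D H" for H :: "complex ^ 'n \<Rightarrow> 'z::topological_space"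
    using that by (rule continuous_on_compose2) (auto intro!: continuous_intros subsetD[OF \<rho>(2)])
  have cq: "continuous_on (cball 0 \<rho>) q"
    unfolding q_def using fnz by (intro continuous_intros cdot0 cshift cf holomorphic_functions_continuous h) auto
  have c\<Gamma>: "continuous_on S ?\<Gamma>" for S by (intro continuous_intros)
  have mean: "(\<integral>x. indicator (cball 0 \<rho>) x * (s * ?\<Gamma> x * Re (q x)) \<partial>lborel) = 0"
  proof -
    \<comment> \<open>The quotients \<open>h\<^sub>i / f\<close> are holomorphic off the zeros of \<open>f\<close>.\<close>
    define D' where "D' = D \<inter> f -` (- {0})"
    have "open D'" unfolding D'_def using cf D by (intro continuous_open_preimage) auto
    moreover have "cball a \<rho> \<subseteq> D'"
    proof
      fix z assume z: "z \<in> cball a \<rho>"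
      then have "f z \<noteq> 0" using fnz[of "z - a"] by (simp add: dist_norm norm_minus_commute)
      then show "z \<in> D'" using z \<rho>(2) by (auto simp: D'_def)
    qed
    moreover have "(\<lambda>z. \<Sum>i\<in>UNIV. dot (b i) (z - a) * (h z $ Some i / f z)) \<in> holomorphic_functions D'"
      by (intro holomorphic_functions_sum holomorphic_functions_mult holomorphic_functions_divide holomorphic_functions_dot
          holomorphic_functions_subset[OF f] holomorphic_functions_subset[OF h(1)]) (auto simp: D'_def)
    ultimately have "(\<integral>x. indicator (cball 0 \<rho>) x *
        (s * ?\<Gamma> x * Re (\<Sum>i\<in>UNIV. dot (b i) (a + x - a) * (h (a + x) $ Some i / f (a + x)))) \<partial>lborel) = 0"
      using \<rho>(1) by (intro integral_holomorphic_circle_invariant[where D = D'] continuous_intros)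
        (auto simp: norm_smult dot_def)
    then show ?thesis by (simp add: q_def)
  qed
  have int: "integrable lborel (\<lambda>x. indicator (cball 0 \<rho>) x * H x)" if "continuous_on (cball 0 \<rho>) H" for H :: "complex ^ 'n \<Rightarrow> real"
    using borel_integrable_compact[OF compact_cball that] by simp
  let ?L = "\<lambda>x. (s * \<mu> x - 2 * C\<^sup>2 * ((norm x)\<^sup>2)\<^sup>2 * t x) * ?\<Gamma> x"
  let ?V = "\<lambda>x. (s\<^sup>2 / (s + t x - k) * \<mu> x) * ?\<Gamma> x"
  have iL: "integrable lborel (\<lambda>x. indicator (cball 0 \<rho>) x * ?L x)"
    by (intro int continuous_intros \<mu> ct)
  have iq: "integrable lborel (\<lambda>x. indicator (cball 0 \<rho>) x * (s * ?\<Gamma> x * Re (q x)))"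
    by (intro int continuous_intros cq)
  have iV: "integrable lborel (\<lambda>x. indicator (cball 0 \<rho>) x * ?V x)"
    by (intro int continuous_intros \<mu> ct) (use dn in auto)
  have "(\<integral>x. indicator (cball 0 \<rho>) x * ?L x \<partial>lborel)
      = (\<integral>x. indicator (cball 0 \<rho>) x * ?L x - 2 * (indicator (cball 0 \<rho>) x * (s * ?\<Gamma> x * Re (q x))) \<partial>lborel)"
    using iL iq mean by (subst Bochner_Integration.integral_diff) auto
  also have "\<dots> \<le> (\<integral>x. s\<^sup>2 / K * (indicator (cball 0 \<rho>) x * ((norm (h (a + x)))\<^sup>2 * exp (- (\<phi> (a + x) + \<psi> (a + x))))) \<partial>lborel)"
  proof (rule integral_mono)
    show "integrable lborel (\<lambda>x. indicator (cball 0 \<rho>) x * ?L x - 2 * (indicator (cball 0 \<rho>) x * (s * ?\<Gamma> x * Re (q x))))"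
      using iL iq by (intro Bochner_Integration.integrable_diff integrable_mult_right) auto
    show "integrable lborel (\<lambda>x. s\<^sup>2 / K * (indicator (cball 0 \<rho>) x * ((norm (h (a + x)))\<^sup>2 * exp (- (\<phi> (a + x) + \<psi> (a + x))))))"
      by (intro integrable_mult_right int cshift[OF cH])
    fix x :: "complex ^ 'n"
    show "indicator (cball 0 \<rho>) x * ?L x - 2 * (indicator (cball 0 \<rho>) x * (s * ?\<Gamma> x * Re (q x)))
        \<le> s\<^sup>2 / K * (indicator (cball 0 \<rho>) x * ((norm (h (a + x)))\<^sup>2 * exp (- (\<phi> (a + x) + \<psi> (a + x)))))"
      using lower[of x] by (cases "x \<in> cball 0 \<rho>") auto
  qed
  also have "\<dots> = s\<^sup>2 / K * A1"
    unfolding A1_def B_def using continuous_on_subset[OF cH \<rho>(2)] by (subst integral_cball_translate) auto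
  also have "\<dots> \<le> s\<^sup>2 / K * (A2 + R)" using A K by (intro mult_left_mono) auto
  also have "\<dots> = s\<^sup>2 / K * A2 + s\<^sup>2 * R / K" by (simp add: algebra_simps add_divide_distrib)
  also have "s\<^sup>2 / K * A2 = (\<integral>x. indicator (cball 0 \<rho>) x * ?V x \<partial>lborel)"
  proof -
    have "s\<^sup>2 / K * A2 = (\<integral>x. s\<^sup>2 / K * (indicator (cball 0 \<rho>) x * (v (a + x) * w (a + x))) \<partial>lborel)"
      unfolding A2_def B_def using continuous_on_subset[OF cvw \<rho>(2)] by (subst integral_cball_translate) auto
    also have "\<dots> = (\<integral>x. indicator (cball 0 \<rho>) x * ?V x \<partial>lborel)"
      using K by (intro Bochner_Integration.integral_cong) (auto simp: Wx v_def indicator_def)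
    finally show ?thesis .
  qed
  finally have "(\<integral>x. indicator (cball 0 \<rho>) x * ?L x \<partial>lborel) - (\<integral>x. indicator (cball 0 \<rho>) x * ?V x \<partial>lborel) \<le> s\<^sup>2 * R / K"
    by simp
  then have "(\<integral>x. indicator (cball 0 \<rho>) x * ?L x - indicator (cball 0 \<rho>) x * ?V x \<partial>lborel) \<le> s\<^sup>2 * R / K"
    using iL iV by (subst Bochner_Integration.integral_diff) auto
  then show ?thesis by (simp add: algebra_simps)
qed

section \<open>The limit of large scales\<close>

text \<open>Put \<open>w = U x / sqrt s\<close> and \<open>Y x = \<Sum>\<^sub>d (x \<bullet> d)\<^sup>2 - r\<close>, so that \<open>t w - r / s = Y x / s\<close>. After
multiplication by \<open>s\<^sup>2\<close> the integrand is \<open>s Y + s m Y\<close> up to terms of order \<open>1/s\<close>. Here \<open>s Y\<close> is unbounded in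
\<open>s\<close>, but its integral over the whole space vanishes; subtracting it turns the
integral over the growing ball into one with an integrable majorant, since outside the ball
\<open>s \<le> |x|\<^sup>2 / \<rho>\<^sup>2\<close>. What survives in the limit is \<open>l (U x) Y x\<close>. The
remaining power \<open>s ^ CARD('n)\<close> is the Jacobian of the substitution.\<close>

lemma limit_inequality:
  fixes U :: "complex ^ 'n \<Rightarrow> complex ^ 'n" and J :: "(complex ^ 'n) set" and \<mu> m t l :: "complex ^ 'n \<Rightarrow> real"
  assumes U: "orthogonal_transformation U" and J: "J \<subseteq> Basis" "real (card J) / 2 = r"
    and \<rho>: "0 < \<rho>" and C: "0 \<le> C"
    and cont: "continuous_on (cball 0 \<rho>) \<mu>" "continuous_on (cball 0 \<rho>) m" "continuous_on UNIV t"
    and bnd: "\<And>w. norm w \<le> \<rho> \<Longrightarrow> \<bar>m w\<bar> \<le> C * (norm w)\<^sup>2" "\<And>w. norm w \<le> \<rho> \<Longrightarrow> \<bar>\<mu> w - 1\<bar> \<le> C * (norm w)\<^sup>2"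
    and lim: "\<And>x. ((\<lambda>s. s * m ((1 / sqrt s) *\<^sub>R x)) \<longlongrightarrow> l x) at_top" and l: "l \<in> borel_measurable borel"
    and t: "\<And>x. t (U x) = (\<Sum>d\<in>J. (x \<bullet> d)\<^sup>2)" "\<And>c x. t (c *\<^sub>R x) = c\<^sup>2 * t x"
    and ineq: "\<forall>\<^sub>F s in at_top. (\<integral>w. indicator (cball 0 \<rho>) w *
       (((m w + 1) * (t w - r / s) - \<mu> w * (t w - r / s)\<^sup>2 / (s + (t w - r / s)) - 2 * C\<^sup>2 * ((norm w)\<^sup>2)\<^sup>2 * t w)
         * exp (- s * (norm w)\<^sup>2)) \<partial>lborel) \<le> R s"
    and R: "((\<lambda>s. s ^ (CARD('n) + 2) * R s) \<longlongrightarrow> 0) at_top"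
  shows "(\<integral>x. l (U x) * ((\<Sum>d\<in>J. (x \<bullet> d)\<^sup>2) - r) * exp (- (norm x)\<^sup>2) \<partial>lborel) \<le> 0"
proof -
  define Y where "Y x = (\<Sum>d\<in>J. (x \<bullet> d)\<^sup>2) - r" for x :: "complex ^ 'n"
  have r0: "0 \<le> r" unfolding J(2)[symmetric] by simp
  have finJ: "finite J" by (rule finite_subset[OF J(1) finite_Basis])
  have \<tau>: "0 \<le> (\<Sum>d\<in>J. (x \<bullet> d)\<^sup>2)" "(\<Sum>d\<in>J. (x \<bullet> d)\<^sup>2) \<le> (norm x)\<^sup>2" for x
  proof -
    have "(norm x)\<^sup>2 = (\<Sum>b\<in>Basis. (x \<bullet> b)\<^sup>2)"
      unfolding power2_norm_eq_inner by (subst euclidean_inner) (simp add: power2_eq_square)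
    then show "(\<Sum>d\<in>J. (x \<bullet> d)\<^sup>2) \<le> (norm x)\<^sup>2" using J(1) by (simp add: sum_mono2)
  qed (simp add: sum_nonneg)
  have nU: "norm (U x) = norm x" for x using U by (rule orthogonal_transformation_norm)
  have linU: "linear U" using U by (rule orthogonal_transformation_linear)
  have cU: "continuous_on S U" for S
    using linU by (intro linear_continuous_on) (simp add: linear_conv_bounded_linear)
  have [measurable]: "U \<in> borel_measurable borel" using cU by (rule borel_measurable_continuous_onI)
  have [measurable]: "Y \<in> borel_measurable borel" unfolding Y_def by measurable
  note l[measurable]
  define \<Psi> where "\<Psi> s w = ((m w + 1) * (t w - r / s) - \<mu> w * (t w - r / s)\<^sup>2 / (s + (t w - r / s)) - 2 * C\<^sup>2 * ((norm w)\<^sup>2)\<^sup>2 * t w)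
         * exp (- s * (norm w)\<^sup>2)" for s w
  define p where "p s x = (1 / sqrt s) *\<^sub>R U x" for s x
  define Q where "Q s x = s * m (p s x) * Y x - \<mu> (p s x) * (Y x)\<^sup>2 / (s + Y x / s)
      - 2 * C\<^sup>2 * ((norm x)\<^sup>2)\<^sup>2 * (Y x + r) / s" for s x
  \<comment> \<open>The rescaled integrand minus \<open>s Y\<close>, which has integral zero.\<close>
  define \<Phi> where "\<Phi> s x = (if norm x \<le> \<rho> * sqrt s then Q s x else - s * Y x) * exp (- (norm x)\<^sup>2)" for s x
  have np: "norm (p s x) = norm x / sqrt s" if "0 < s" for s x using that by (simp add: p_def nU)
  have tw: "t (p s x) = (Y x + r) / s" if "0 < s" for s x
    using that by (simp add: p_def t Y_def power_divide)
  have in_ball: "norm (p s x) \<le> \<rho> \<longleftrightarrow> norm x \<le> \<rho> * sqrt s" if "0 < s" for s x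
    using that by (simp add: np divide_le_eq)
  define s0 where "s0 = r + 1"
  have s0: "1 \<le> s0" using r0 by (simp add: s0_def)
  have den: "1 \<le> s + (t w - r / s)" "1 \<le> s + Y x / s" if "s0 \<le> s" "0 \<le> t w" for s w x
  proof -
    have s: "1 \<le> s" using that s0 by linarith
    have "r / s \<le> r" using s r0 mult_left_mono[OF s r0] by (simp add: divide_le_eq)
    then show "1 \<le> s + (t w - r / s)" using that by (simp add: s0_def)
    have "- r / s \<le> Y x / s" using \<tau>(1)[of x] s by (intro divide_right_mono) (auto simp: Y_def)
    then show "1 \<le> s + Y x / s" using that \<open>r / s \<le> r\<close> by (simp add: s0_def)
  qed
  have t0: "0 \<le> t w" for w
  proof -
    have "w = U (inv U w)" using orthogonal_transformation_surj[OF U] by (simp add: surj_f_inv_f)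
    then show ?thesis using t(1)[of "inv U w"] \<tau>(1)[of "inv U w"] by simp
  qed
  have meas\<Psi>: "(\<lambda>w. indicator (cball 0 \<rho>) w * \<Psi> s w) \<in> borel_measurable borel" if "s0 \<le> s" for s
  proof -
    have nz: "s + (t w - r / s) \<noteq> 0" for w using den(1)[OF that t0, of w] by linarith
    have "continuous_on (cball 0 \<rho>) (\<Psi> s)"
      unfolding \<Psi>_def by (intro continuous_intros cont continuous_on_subset[OF cont(3)]) (use nz in auto)
    from borel_measurable_continuous_on_indicator[OF _ this] show ?thesis by simp
  qed
  have scale: "s ^ (CARD('n) + 2) * (\<integral>w. indicator (cball 0 \<rho>) w * \<Psi> s w \<partial>lborel)
      = (\<integral>x. indicator (cball 0 (\<rho> * sqrt s)) x * ((s * Y x + Q s x) * exp (- (norm x)\<^sup>2)) \<partial>lborel)"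
    and measQ: "(\<lambda>x. indicator (cball 0 (\<rho> * sqrt s)) x * ((s * Y x + Q s x) * exp (- (norm x)\<^sup>2))) \<in> borel_measurable borel"
    if "s0 \<le> s" for s
  proof -
    have s: "0 < s" using that s0 by linarith
    have pt: "s\<^sup>2 * (indicator (cball 0 \<rho>) (p s x) * \<Psi> s (p s x))
        = indicator (cball 0 (\<rho> * sqrt s)) x * ((s * Y x + Q s x) * exp (- (norm x)\<^sup>2))" for x
    proof -
      have y: "t (p s x) - r / s = Y x / s" using s by (simp add: tw field_simps)
      have n2: "(norm (p s x))\<^sup>2 = (norm x)\<^sup>2 / s" using s by (simp add: np power_divide)
      have "s\<^sup>2 * ((m (p s x) + 1) * (Y x / s) - \<mu> (p s x) * (Y x / s)\<^sup>2 / (s + Y x / s)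
          - 2 * C\<^sup>2 * ((norm x)\<^sup>2 / s)\<^sup>2 * ((Y x + r) / s)) = s * Y x + Q s x"
      proof -
        have 1: "s\<^sup>2 * ((m (p s x) + 1) * (Y x / s)) = s * m (p s x) * Y x + s * Y x"
          using s by (simp add: power2_eq_square algebra_simps)
        have 2: "s\<^sup>2 * (\<mu> (p s x) * (Y x / s)\<^sup>2 / (s + Y x / s)) = \<mu> (p s x) * (Y x)\<^sup>2 / (s + Y x / s)"
          using s by (simp add: power_divide)
        have 3: "s\<^sup>2 * (2 * C\<^sup>2 * ((norm x)\<^sup>2 / s)\<^sup>2 * ((Y x + r) / s)) = 2 * C\<^sup>2 * ((norm x)\<^sup>2)\<^sup>2 * (Y x + r) / s"
          using s by (simp add: power_divide)
        show ?thesis unfolding right_diff_distrib 1 2 3 Q_def by simp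
      qed
      moreover have "exp (- s * (norm (p s x))\<^sup>2) = exp (- (norm x)\<^sup>2)" using s by (simp add: n2)
      moreover have "indicator (cball 0 \<rho>) (p s x) = (indicator (cball 0 (\<rho> * sqrt s)) x :: real)"
        using in_ball[OF s, of x] by (simp add: indicator_def)
      ultimately show ?thesis
        unfolding \<Psi>_def unfolding y unfolding n2 tw[OF s] by (simp add: mult.assoc[symmetric] mult.commute[of "s\<^sup>2"])
    qed
    have "(\<integral>w. indicator (cball 0 \<rho>) w * \<Psi> s w \<partial>lborel)
        = (1 / sqrt s) ^ DIM(complex ^ 'n) * (\<integral>x. indicator (cball 0 \<rho>) (p s x) * \<Psi> s (p s x) \<partial>lborel)"
      using integral_affine_orthogonal[OF U _ meas\<Psi>[OF that], of "1 / sqrt s" 0] s by (simp add: p_def)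
    also have "(1 / sqrt s) ^ DIM(complex ^ 'n) = 1 / s ^ CARD('n)"
    proof -
      have "(1 / sqrt s) ^ DIM(complex ^ 'n) = ((1 / sqrt s)\<^sup>2) ^ CARD('n)"
        by (simp add: power_mult[symmetric] mult.commute)
      then show ?thesis using s by (simp add: power_divide)
    qed
    finally have "s ^ (CARD('n) + 2) * (\<integral>w. indicator (cball 0 \<rho>) w * \<Psi> s w \<partial>lborel)
       = s\<^sup>2 * (\<integral>x. indicator (cball 0 \<rho>) (p s x) * \<Psi> s (p s x) \<partial>lborel)"
      using s by (simp add: power_add power2_eq_square)
    also have "\<dots> = (\<integral>x. s\<^sup>2 * (indicator (cball 0 \<rho>) (p s x) * \<Psi> s (p s x)) \<partial>lborel)" by simp
    finally show "s ^ (CARD('n) + 2) * (\<integral>w. indicator (cball 0 \<rho>) w * \<Psi> s w \<partial>lborel)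
      = (\<integral>x. indicator (cball 0 (\<rho> * sqrt s)) x * ((s * Y x + Q s x) * exp (- (norm x)\<^sup>2)) \<partial>lborel)"
      unfolding pt .
    have "(\<lambda>x. s\<^sup>2 * (indicator (cball 0 \<rho>) (p s x) * \<Psi> s (p s x))) \<in> borel_measurable borel"
      using meas\<Psi>[OF that] unfolding p_def by measurable
    then show "(\<lambda>x. indicator (cball 0 (\<rho> * sqrt s)) x * ((s * Y x + Q s x) * exp (- (norm x)\<^sup>2))) \<in> borel_measurable borel"
      unfolding pt .
  qed
  have \<Phi>_eq: "\<Phi> s x = indicator (cball 0 (\<rho> * sqrt s)) x * ((s * Y x + Q s x) * exp (- (norm x)\<^sup>2)) - s * (Y x * exp (- (norm x)\<^sup>2))" for s x
    by (simp add: \<Phi>_def indicator_def algebra_simps)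
  have meas\<Phi>: "\<Phi> s \<in> borel_measurable borel" if "s0 \<le> s" for s
    unfolding \<Phi>_eq[abs_def] using measQ[OF that] by measurable
  define c where "c = C + 1 / \<rho>\<^sup>2 + (1 + C * \<rho>\<^sup>2) + 2 * C\<^sup>2"
  \<comment> \<open>A majorant of \<open>\<Phi> s\<close> that does not depend on \<open>s\<close>; it is cubic in \<open>|x|\<^sup>2\<close>.\<close>
  define H where "H x = c * (((norm x)\<^sup>2 + 1) * ((norm x)\<^sup>2 + r + 1)\<^sup>2 + ((norm x)\<^sup>2)\<^sup>2 * (norm x)\<^sup>2)" for x :: "complex ^ 'n"
  have c0: "0 \<le> C" "0 \<le> 1 / \<rho>\<^sup>2" "0 \<le> 1 + C * \<rho>\<^sup>2" "0 \<le> 2 * C\<^sup>2" "0 \<le> c"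
    using C by (auto simp: c_def)
  have absY: "\<bar>Y x\<bar> \<le> (norm x)\<^sup>2 + r" for x using \<tau>[of x] r0 by (simp add: Y_def abs_le_iff)
  have bound: "\<bar>\<Phi> s x\<bar> \<le> H x * exp (- (norm x)\<^sup>2)" if s: "s0 \<le> s" for s x
  proof -
    have sp: "1 \<le> s" "0 < s" using s s0 by linarith+
    define n where "n = (norm x)\<^sup>2"
    have n0: "0 \<le> n" by (simp add: n_def)
    define A where "A = n + r + 1"
    have A: "1 \<le> A" "\<bar>Y x\<bar> \<le> A" "(Y x)\<^sup>2 \<le> A\<^sup>2"
      using n0 r0 absY[of x] by (auto simp: A_def n_def intro: abs_le_square_iff[THEN iffD1])
    then have AA: "\<bar>Y x\<bar> \<le> A\<^sup>2" using power_increasing[of 1 2 A] by simp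
    have X1: "n * \<bar>Y x\<bar> \<le> (n + 1) * A\<^sup>2" using n0 AA by (intro mult_mono) auto
    have X2: "(Y x)\<^sup>2 \<le> (n + 1) * A\<^sup>2" 
      unfolding distrib_right using A(3) mult_nonneg_nonneg[OF n0 zero_le_power2[of A]] by linarith
    have "\<bar>if norm x \<le> \<rho> * sqrt s then Q s x else - s * Y x\<bar> \<le> H x"
    proof (cases "norm x \<le> \<rho> * sqrt s")
      case True
      then have pb: "norm (p s x) \<le> \<rho>" using in_ball[OF sp(2)] by simp
      have np2: "(norm (p s x))\<^sup>2 = n / s" using sp by (simp add: np power_divide n_def)
      have "\<bar>s * m (p s x)\<bar> = s * \<bar>m (p s x)\<bar>" using sp by (simp add: abs_mult)
      also have "\<dots> \<le> s * (C * (n / s))" using bnd(1)[OF pb] sp np2 by (intro mult_left_mono) auto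
      also have "\<dots> = C * n" using sp by simp
      finally have "\<bar>s * m (p s x)\<bar> \<le> C * n" .
      then have "\<bar>s * m (p s x)\<bar> * \<bar>Y x\<bar> \<le> C * n * \<bar>Y x\<bar>" by (intro mult_right_mono) auto
      also have "\<dots> \<le> C * ((n + 1) * A\<^sup>2)" using X1 C by (simp add: mult.assoc mult_left_mono)
      finally have q1: "\<bar>s * m (p s x) * Y x\<bar> \<le> C * ((n + 1) * A\<^sup>2)" by (simp add: abs_mult)
      have pr: "(norm (p s x))\<^sup>2 \<le> \<rho>\<^sup>2" using pb by (intro power_mono) auto
      then have "\<bar>\<mu> (p s x)\<bar> \<le> 1 + C * \<rho>\<^sup>2" using bnd(2)[OF pb] mult_left_mono[OF pr C] by linarith
      then have "\<bar>\<mu> (p s x)\<bar> * (Y x)\<^sup>2 \<le> (1 + C * \<rho>\<^sup>2) * ((n + 1) * A\<^sup>2)" using X2 by (intro mult_mono) auto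
      moreover have "\<bar>\<mu> (p s x) * (Y x)\<^sup>2 / (s + Y x / s)\<bar> \<le> \<bar>\<mu> (p s x)\<bar> * (Y x)\<^sup>2"
      proof -
        have "\<bar>y / d\<bar> \<le> \<bar>y\<bar>" if "1 \<le> d" for y d :: real
          using that mult_left_mono[OF that, of "\<bar>y\<bar>"] by (simp add: abs_divide divide_le_eq)
        from this[OF den(2)[OF s t0, of x], of "\<mu> (p s x) * (Y x)\<^sup>2"] show ?thesis by (simp add: abs_mult)
      qed
      ultimately have q2: "\<bar>\<mu> (p s x) * (Y x)\<^sup>2 / (s + Y x / s)\<bar> \<le> (1 + C * \<rho>\<^sup>2) * ((n + 1) * A\<^sup>2)" by linarith
      have \<tau>n: "0 \<le> Y x + r" "Y x + r \<le> n" using \<tau>[of x] by (auto simp: Y_def n_def)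
      have "2 * C\<^sup>2 * n\<^sup>2 * (Y x + r) / s \<le> 2 * C\<^sup>2 * n\<^sup>2 * (Y x + r)"
      proof -
        have "0 \<le> 2 * C\<^sup>2 * n\<^sup>2 * (Y x + r)" using \<tau>n by simp
        from mult_left_mono[OF sp(1) this] show ?thesis using sp by (simp add: divide_le_eq)
      qed
      also have "\<dots> \<le> 2 * C\<^sup>2 * n\<^sup>2 * n" using \<tau>n by (intro mult_left_mono) auto
      finally have q3: "\<bar>2 * C\<^sup>2 * n\<^sup>2 * (Y x + r) / s\<bar> \<le> 2 * C\<^sup>2 * (n\<^sup>2 * n)"
        using sp \<tau>n by (simp add: mult.assoc)
      have "\<bar>Q s x\<bar> \<le> C * ((n + 1) * A\<^sup>2) + (1 + C * \<rho>\<^sup>2) * ((n + 1) * A\<^sup>2) + 2 * C\<^sup>2 * (n\<^sup>2 * n)"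
        using q1 q2 q3 unfolding Q_def n_def[symmetric] by linarith
      also have "\<dots> \<le> c * ((n + 1) * A\<^sup>2) + c * (n\<^sup>2 * n)"
      proof -
        have "(C + (1 + C * \<rho>\<^sup>2)) * ((n + 1) * A\<^sup>2) \<le> c * ((n + 1) * A\<^sup>2)"
          using c0 n0 by (intro mult_right_mono) (auto simp: c_def)
        moreover have "2 * C\<^sup>2 * (n\<^sup>2 * n) \<le> c * (n\<^sup>2 * n)" using c0 n0 by (intro mult_right_mono) (auto simp: c_def)
        ultimately show ?thesis unfolding distrib_right by linarith
      qed
      finally show ?thesis using True by (simp add: H_def n_def A_def distrib_left add.assoc)
    next
      case False
      then have "(\<rho> * sqrt s)\<^sup>2 \<le> n" unfolding n_def using \<rho> sp by (intro power_mono) auto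
      then have "s \<le> 1 / \<rho>\<^sup>2 * n" using \<rho> sp by (simp add: power_mult_distrib field_simps)
      then have "s * \<bar>Y x\<bar> \<le> 1 / \<rho>\<^sup>2 * n * \<bar>Y x\<bar>" by (intro mult_right_mono) auto
      also have "\<dots> \<le> 1 / \<rho>\<^sup>2 * ((n + 1) * A\<^sup>2)" using X1 by (simp only: mult.assoc) (intro mult_left_mono, auto)
      also have "\<dots> \<le> c * ((n + 1) * A\<^sup>2)" using c0 n0 by (intro mult_right_mono) (auto simp: c_def)
      also have "\<dots> \<le> c * ((n + 1) * A\<^sup>2 + n\<^sup>2 * n)" using c0 n0 by (intro mult_left_mono) auto
      finally show ?thesis using False sp by (simp add: H_def n_def A_def abs_mult add.assoc)
    qed
    then show ?thesis unfolding \<Phi>_def abs_mult by (intro mult_mono) auto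
  qed
  have intH: "integrable lborel (\<lambda>x. H x * exp (- (norm x)\<^sup>2))"
  proof (rule gaussian_integrable_bound)
    show "\<bar>H x\<bar> \<le> (c * (2 * (2 + r)\<^sup>2 + 1) * 4) * (1 + norm x ^ (2 * 3))" for x
    proof -
      define n where "n = (norm x)\<^sup>2"
      have n0: "0 \<le> n" by (simp add: n_def)
      define e where "e = max 1 n"
      have e: "1 \<le> e" "n \<le> e" by (auto simp: e_def)
      have "n + r + 1 \<le> (2 + r) * e"
        using e r0 mult_left_mono[of 1 e r] by (simp add: algebra_simps)
      then have "(n + r + 1)\<^sup>2 \<le> ((2 + r) * e)\<^sup>2" using n0 r0 by (intro power_mono) auto
      moreover have "n + 1 \<le> 2 * e" using e by simp
      ultimately have "(n + 1) * (n + r + 1)\<^sup>2 \<le> (2 * e) * ((2 + r) * e)\<^sup>2" using n0 e by (intro mult_mono) auto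
      also have "\<dots> = 2 * (2 + r)\<^sup>2 * e ^ 3" by (simp only: power_mult_distrib power3_eq_cube power2_eq_square mult_ac)
      finally have 1: "(n + 1) * (n + r + 1)\<^sup>2 \<le> 2 * (2 + r)\<^sup>2 * e ^ 3" .
      have 2: "n\<^sup>2 * n \<le> e ^ 3" using n0 e unfolding power3_eq_cube power2_eq_square by (intro mult_mono) auto
      have 3: "e ^ 3 \<le> 1 + n ^ 3" using n0 by (cases "n \<le> 1") (auto simp: e_def max_def)
      have "H x = c * ((n + 1) * (n + r + 1)\<^sup>2 + n\<^sup>2 * n)" by (simp add: H_def n_def)
      also have "\<dots> \<le> c * (2 * (2 + r)\<^sup>2 * e ^ 3 + e ^ 3)" using 1 2 c0 by (intro mult_left_mono add_mono) auto
      also have "\<dots> = c * (2 * (2 + r)\<^sup>2 + 1) * e ^ 3" by (simp add: algebra_simps)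
      also have "\<dots> \<le> c * (2 * (2 + r)\<^sup>2 + 1) * (1 + n ^ 3)" using 3 c0 by (intro mult_left_mono) auto
      also have "\<dots> \<le> (c * (2 * (2 + r)\<^sup>2 + 1) * 4) * (1 + n ^ 3)" using c0 n0 by (intro mult_right_mono) auto
      finally have "H x \<le> (c * (2 * (2 + r)\<^sup>2 + 1) * 4) * (1 + norm x ^ (2 * 3))" by (simp add: n_def power_mult)
      moreover have "0 \<le> H x" using c0 n0 by (simp add: H_def)
      ultimately show ?thesis by simp
    qed
    show "H \<in> borel_measurable borel" unfolding H_def by measurable
  qed
  have pointwise: "((\<lambda>s. \<Phi> s x) \<longlongrightarrow> l (U x) * Y x * exp (- (norm x)\<^sup>2)) at_top" for x
  proof -
    have inv: "((\<lambda>s. inverse s) \<longlongrightarrow> (0::real)) at_top" by (intro tendsto_inverse_0_at_top filterlim_ident)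
    have isq: "((\<lambda>s. inverse (sqrt s)) \<longlongrightarrow> 0) at_top" by (intro tendsto_inverse_0_at_top sqrt_at_top)
    have ev1: "\<forall>\<^sub>F s in at_top. norm x \<le> \<rho> * sqrt s"
    proof -
      have "\<forall>\<^sub>F s in at_top. norm x / \<rho> \<le> sqrt s" using sqrt_at_top by (simp add: filterlim_at_top)
      then show ?thesis by eventually_elim (use \<rho> in \<open>simp add: divide_le_eq mult.commute\<close>)
    qed
    have a: "((\<lambda>s. s * m (p s x) * Y x) \<longlongrightarrow> l (U x) * Y x) at_top"
      unfolding p_def by (intro tendsto_mult lim tendsto_const)
    have b: "((\<lambda>s. \<mu> (p s x) * (Y x)\<^sup>2 / (s + Y x / s)) \<longlongrightarrow> 0) at_top"
    proof -
      have "((\<lambda>s. inverse (s + Y x / s)) \<longlongrightarrow> 0) at_top"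
      proof (rule tendsto_inverse_0_at_top)
        have "((\<lambda>s. Y x / s) \<longlongrightarrow> 0) at_top" using tendsto_mult[OF tendsto_const inv, of "Y x"] by (simp add: divide_inverse)
        then show "LIM s at_top. s + Y x / s :> at_top"
          by (subst add.commute) (rule filterlim_tendsto_add_at_top[OF _ filterlim_ident])
      qed
      from tendsto_mult[OF tendsto_const this, of "(1 + C * \<rho>\<^sup>2) * (Y x)\<^sup>2"]
      have z: "((\<lambda>s. (1 + C * \<rho>\<^sup>2) * (Y x)\<^sup>2 * inverse (s + Y x / s)) \<longlongrightarrow> 0) at_top" by simp
      have "\<forall>\<^sub>F s in at_top. norm (\<mu> (p s x) * (Y x)\<^sup>2 / (s + Y x / s)) \<le> (1 + C * \<rho>\<^sup>2) * (Y x)\<^sup>2 * inverse (s + Y x / s)"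
        using ev1 eventually_ge_at_top[of s0]
      proof eventually_elim
        case (elim s)
        have sp: "0 < s" using elim s0 by linarith
        then have pb: "norm (p s x) \<le> \<rho>" using in_ball[OF sp] elim by simp
        have pr: "(norm (p s x))\<^sup>2 \<le> \<rho>\<^sup>2" using pb by (intro power_mono) auto
        then have "\<bar>\<mu> (p s x)\<bar> \<le> 1 + C * \<rho>\<^sup>2" using bnd(2)[OF pb] mult_left_mono[OF pr C] by linarith
        then have "\<bar>\<mu> (p s x)\<bar> * ((Y x)\<^sup>2 * inverse (s + Y x / s)) \<le> (1 + C * \<rho>\<^sup>2) * ((Y x)\<^sup>2 * inverse (s + Y x / s))"
          using den(2)[OF elim(2) t0, of x] by (intro mult_right_mono) auto
        then show ?case using den(2)[OF elim(2) t0, of x]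
          by (simp add: abs_mult divide_inverse mult.assoc)
      qed
      then show ?thesis using z by (rule Lim_null_comparison)
    qed
    have d: "((\<lambda>s. 2 * C\<^sup>2 * ((norm x)\<^sup>2)\<^sup>2 * (Y x + r) / s) \<longlongrightarrow> 0) at_top"
      using tendsto_mult[OF tendsto_const inv, of "2 * C\<^sup>2 * ((norm x)\<^sup>2)\<^sup>2 * (Y x + r)"] by (simp add: divide_inverse)
    have "((\<lambda>s. Q s x * exp (- (norm x)\<^sup>2)) \<longlongrightarrow> (l (U x) * Y x - 0 - 0) * exp (- (norm x)\<^sup>2)) at_top"
      unfolding Q_def by (intro tendsto_mult tendsto_diff a b d tendsto_const)
    then have "((\<lambda>s. Q s x * exp (- (norm x)\<^sup>2)) \<longlongrightarrow> l (U x) * Y x * exp (- (norm x)\<^sup>2)) at_top" by simp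
    then show ?thesis
      by (rule Lim_transform_eventually) (use ev1 in \<open>eventually_elim, simp add: \<Phi>_def\<close>)
  qed
  \<comment> \<open>Measurability of \<open>\<Phi> s\<close> is required for every \<open>s\<close>, hence the truncation below \<open>s0\<close>.\<close>
  have "((\<lambda>s. \<integral>x. \<Phi> (max s0 s) x \<partial>lborel) \<longlongrightarrow> (\<integral>x. l (U x) * Y x * exp (- (norm x)\<^sup>2) \<partial>lborel)) at_top"
  proof (rule integral_dominated_convergence_at_top[OF _ _ intH])
    show "\<forall>\<^sub>F s in at_top. AE x in lborel. norm (\<Phi> (max s0 s) x) \<le> H x * exp (- (norm x)\<^sup>2)"
      by (intro always_eventually allI AE_I2) (simp add: bound)
    show "AE x in lborel. ((\<lambda>s. \<Phi> (max s0 s) x) \<longlongrightarrow> l (U x) * Y x * exp (- (norm x)\<^sup>2)) at_top"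
    proof (intro AE_I2)
      fix x
      show "((\<lambda>s. \<Phi> (max s0 s) x) \<longlongrightarrow> l (U x) * Y x * exp (- (norm x)\<^sup>2)) at_top"
        by (rule Lim_transform_eventually[OF pointwise[of x]])
          (use eventually_ge_at_top[of s0] in \<open>eventually_elim, simp add: max_def\<close>)
    qed
    show "\<Phi> (max s0 s) \<in> borel_measurable lborel" for s using meas\<Phi>[of "max s0 s"] by simp
    show "(\<lambda>x. l (U x) * Y x * exp (- (norm x)\<^sup>2)) \<in> borel_measurable lborel" by measurable
  qed
  moreover have "\<forall>\<^sub>F s in at_top. (\<integral>x. \<Phi> (max s0 s) x \<partial>lborel) \<le> s ^ (CARD('n) + 2) * R s"
    using ineq eventually_ge_at_top[of s0]
  proof eventually_elim
    case (elim s)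
    have sp: "0 < s" using elim s0 by linarith
    have int0: "has_bochner_integral lborel (\<lambda>x. Y x * exp (- (norm x)\<^sup>2)) 0"
      using gaussian_centered_sum_squares[OF J(1)] by (simp add: Y_def J(2))
    have int1: "integrable lborel (\<Phi> s)"
      by (rule Bochner_Integration.integrable_bound[OF intH])
        (use meas\<Phi>[OF elim(2)] bound[OF elim(2)] in \<open>auto intro: order_trans[OF _ abs_ge_self]\<close>)
    have int2: "integrable lborel (\<lambda>x. indicator (cball 0 (\<rho> * sqrt s)) x * ((s * Y x + Q s x) * exp (- (norm x)\<^sup>2)))"
    proof -
      have "integrable lborel (\<lambda>x. \<Phi> s x + s * (Y x * exp (- (norm x)\<^sup>2)))"
        using int0 by (intro Bochner_Integration.integrable_add int1 integrable_mult_right) (auto simp: has_bochner_integral_iff)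
      then show ?thesis by (simp add: \<Phi>_eq)
    qed
    have "(\<integral>x. \<Phi> s x \<partial>lborel) = (\<integral>x. indicator (cball 0 (\<rho> * sqrt s)) x * ((s * Y x + Q s x) * exp (- (norm x)\<^sup>2)) \<partial>lborel)
        - (\<integral>x. s * (Y x * exp (- (norm x)\<^sup>2)) \<partial>lborel)"
      unfolding \<Phi>_eq using int0
      by (intro Bochner_Integration.integral_diff int2 integrable_mult_right) (auto simp: has_bochner_integral_iff)
    also have "\<dots> = s ^ (CARD('n) + 2) * (\<integral>w. indicator (cball 0 \<rho>) w * \<Psi> s w \<partial>lborel)"
      unfolding scale[OF elim(2)] using int0 by (simp add: has_bochner_integral_iff)
    also have "\<dots> \<le> s ^ (CARD('n) + 2) * R s"
      using elim(1) sp by (intro mult_left_mono) (auto simp: \<Psi>_def)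
    finally show ?case using elim(2) by (simp add: max_def)
  qed
  ultimately have "(\<integral>x. l (U x) * Y x * exp (- (norm x)\<^sup>2) \<partial>lborel) \<le> 0"
    using R by (intro tendsto_le[OF _ R]) auto
  then show ?thesis by (simp add: Y_def)
qed

section \<open>The converse theorem\<close>

lemma holomorphic_functions_add_const:
  assumes "f \<in> holomorphic_functions D"
  shows "(\<lambda>z. f z + c) \<in> holomorphic_functions D"
  by (rule holomorphic_functionsI[OF has_derivative_add_const[OF holomorphic_functionsD(1)[OF assms]]])
    (simp_all add: holomorphic_functionsD(2)[OF assms])

lemma herm_sum_left: "herm (\<Sum>i\<in>I. x i) z = (\<Sum>i\<in>I. herm (x i) z)"
  unfolding herm_def by (subst sum.swap) (simp add: sum_distrib_right)

lemma unitary_frame_isometry: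
  fixes v :: "'n \<Rightarrow> complex ^ 'n"
  assumes v: "\<And>i j. herm (v i) (v j) = (if i = j then 1 else 0)"
  defines "U \<equiv> (\<lambda>x. \<Sum>j\<in>UNIV. (x $ j) *s v j)"
  shows "orthogonal_transformation U" "herm (U x) (v k) = x $ k" "U (axis j 1) = v j" "U (axis j \<i>) = \<i> *s v j"
proof -
  have hv: "herm (U x) (v k) = x $ k" for x k
    by (simp add: U_def herm_sum_left herm_smult_left v if_distrib[of "(*) _"] cong: if_cong)
  then show "herm (U x) (v k) = x $ k" .
  have "herm (U x) (U x) = (\<Sum>j\<in>UNIV. x $ j * cnj (x $ j))" for x
  proof -
    have "herm (U x) (U x) = (\<Sum>j\<in>UNIV. x $ j * herm (v j) (U x))"
      by (subst (1) U_def) (simp add: herm_sum_left herm_smult_left)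
    moreover have "herm (v j) (U x) = cnj (x $ j)" for j by (subst herm_commute) (simp add: hv)
    ultimately show ?thesis by simp
  qed
  then have "herm (U x) (U x) = herm x x" for x by (simp add: herm_def)
  then have "(norm (U x))\<^sup>2 = (norm x)\<^sup>2" for x by (simp only: herm_self of_real_eq_iff)
  then have n: "norm (U x) = norm x" for x by simp
  have "linear U"
    unfolding U_def
    by (intro linearI) (auto simp: vec_eq_iff sum.distrib[symmetric] distrib_right scaleR_sum_right)
  then show "orthogonal_transformation U" using n by (simp add: orthogonal_transformation)
  have "U (axis j c) = c *s v j" for c
  proof -
    have "U (axis j c) = (\<Sum>i\<in>UNIV. if i = j then c *s v j else 0)"
      unfolding U_def by (intro sum.cong) (auto simp: axis_def)
    then show ?thesis by simp
  qed
  then show "U (axis j 1) = v j" "U (axis j \<i>) = \<i> *s v j" by simp_all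
qed

lemma exp_decay:
  fixes \<kappa> c :: real
  assumes "0 < \<kappa>"
  shows "((\<lambda>s. c * (s ^ k * exp (- (\<kappa> * s)))) \<longlongrightarrow> 0) at_top"
proof -
  have "LIM s at_top. \<kappa> * s :> at_top"
    using assms by (intro filterlim_tendsto_pos_mult_at_top[OF tendsto_const] filterlim_ident)
  from filterlim_compose[OF tendsto_power_div_exp_0[of k] this]
  have "((\<lambda>s. (\<kappa> * s) ^ k / exp (\<kappa> * s)) \<longlongrightarrow> 0) at_top" .
  from tendsto_mult[OF tendsto_const this, of "c / \<kappa> ^ k"]
  have "((\<lambda>s. c / \<kappa> ^ k * ((\<kappa> * s) ^ k / exp (\<kappa> * s))) \<longlongrightarrow> 0) at_top" by simp
  moreover have "c / \<kappa> ^ k * ((\<kappa> * s) ^ k / exp (\<kappa> * s)) = c * (s ^ k * exp (- (\<kappa> * s)))" for s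
    using assms by (simp add: power_mult_distrib exp_minus divide_inverse)
  ultimately show ?thesis by simp
qed

text \<open>The division estimate for the affine morphisms and the shifted weights, in the limit of large \<open>s\<close>. Away from
\<open>a\<close>, boundedness of \<open>D\<close> and \<open>f \<in> A2 D \<phi>\<close> bound the functional by a constant times
\<open>exp (- s \<rho>\<^sup>2)\<close>, which decays faster than every power of \<open>s\<close>.\<close>

lemma frame_trace_nonneg:
  fixes D :: "(complex ^ 'n) set" and \<phi> :: "complex ^ 'n \<Rightarrow> real" and v :: "'n \<Rightarrow> complex ^ 'n" and \<sigma> :: "'r::finite \<Rightarrow> 'n"
  assumes D: "open D" "bounded D" and C2: "Ck_on 2 \<phi> D" and f: "f \<in> A2 D \<phi>" and a: "a \<in> D" "f a \<noteq> 0"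
    and v: "\<And>i j. herm (v i) (v j) = (if i = j then 1 else 0)" and \<sigma>: "inj \<sigma>"
    and division: "\<And>(g :: complex ^ 'n \<Rightarrow> complex ^ ('r option)) \<psi>.
         (\<forall>\<nu>. (\<lambda>z. g z $ \<nu>) \<in> holomorphic_functions D) \<and>
         (\<forall>z\<in>D. g z \<noteq> 0) \<and>
         (\<forall>z\<in>D. \<exists>v. wedge_dg g z v \<noteq> 0) \<and>
         smooth_on \<psi> D \<and> plurisubharmonic_on \<psi> D \<and>
         nakano_positive D \<psi> g \<and>
         I_functional D \<phi> \<psi> g f < \<infinity>
         \<Longrightarrow> (\<exists>h :: complex ^ 'n \<Rightarrow> complex ^ ('r option).
               (\<forall>\<nu>. (\<lambda>z. h z $ \<nu>) \<in> holomorphic_functions D) \<and>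
               (\<forall>z\<in>D. f z = dot (g z) (h z)) \<and>
               weighted_norm_sq D (\<lambda>z. \<phi> z + \<psi> z) h \<le> I_functional D \<phi> \<psi> g f)"
  shows "0 \<le> (\<Sum>i\<in>UNIV. second_derivative \<phi> a (v (\<sigma> i)) (v (\<sigma> i)) + second_derivative \<phi> a (\<i> *s v (\<sigma> i)) (\<i> *s v (\<sigma> i)))"
proof -
  have fh: "f \<in> holomorphic_functions D" using f by (simp add: A2_def)
  define r where "r = real CARD('r)"
  have r: "1 \<le> r" by (simp add: r_def Suc_le_eq)
  define b where "b i = (\<chi> k. cnj (v (\<sigma> i) $ k))" for i
  have dotb: "dot (b i) w = herm w (v (\<sigma> i))" for i w by (simp add: b_def dot_def herm_def mult.commute)
  define t where "t w = (\<Sum>i\<in>UNIV. (norm (dot (b i) w))\<^sup>2)" for w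
  have t0: "0 \<le> t w" for w by (simp add: t_def sum_nonneg)
  have nb: "(\<Sum>i\<in>UNIV. (norm (b i))\<^sup>2) = r"
  proof -
    have "complex_of_real ((norm (b i))\<^sup>2) = of_real 1" for i
      using v[of "\<sigma> i" "\<sigma> i"] unfolding herm_self[symmetric] by (simp add: herm_def b_def mult.commute)
    then have "(norm (b i))\<^sup>2 = 1" for i by (simp only: of_real_eq_iff)
    then show ?thesis by (simp add: r_def)
  qed
  obtain \<alpha> \<rho> C \<mu> F where model: "0 < \<rho>" "0 \<le> C" "cball a \<rho> \<subseteq> D" "F \<in> holomorphic_functions D" "F a = 1"
    "continuous_on (cball 0 \<rho>) \<mu>"
    and W: "\<And>z s. z \<in> D \<Longrightarrow> (norm (f z))\<^sup>2 * exp (- \<phi> z - shifted_weight s a \<alpha> z)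
       = (norm (f a))\<^sup>2 * exp (- \<phi> a) * (\<mu> (z - a) * exp (- s * (norm (z - a))\<^sup>2))"
    and \<mu>: "\<And>w. norm w \<le> \<rho> \<Longrightarrow> 1 / 2 \<le> \<mu> w" "\<And>w. norm w \<le> \<rho> \<Longrightarrow> \<bar>\<mu> w - 1\<bar> \<le> C * (norm w)\<^sup>2"
    and m: "\<And>w. norm w \<le> \<rho> \<Longrightarrow> \<bar>\<mu> w - 1 - 2 * Re (F (a + w) - 1)\<bar> \<le> C * (norm w)\<^sup>2"
    and lim: "\<And>x. ((\<lambda>s. s * (\<mu> ((1 / sqrt s) *\<^sub>R x) - 1 - 2 * Re (F (a + (1 / sqrt s) *\<^sub>R x) - 1)))
        \<longlongrightarrow> - (second_derivative \<phi> a x x / 2)) at_top"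
    by (rule local_model[OF D(1) a(1) C2 fh a(2)]) blast
  define K where "K = (norm (f a))\<^sup>2 * exp (- \<phi> a)"
  have K: "0 < K" using a by (simp add: K_def)
  obtain M where M: "\<And>z. z \<in> D \<Longrightarrow> Re (dot \<alpha> (z - a)) \<le> M"
  proof -
    obtain e where e: "\<And>z. z \<in> D \<Longrightarrow> norm z \<le> e" using D(2) by (auto simp: bounded_iff)
    have "Re (dot \<alpha> (z - a)) \<le> norm \<alpha> * (e + norm a)" if "z \<in> D" for z
    proof -
      have "Re (dot \<alpha> (z - a)) \<le> norm (dot \<alpha> (z - a))" by (rule complex_Re_le_cmod)
      also have "\<dots> \<le> norm \<alpha> * norm (z - a)" by (rule norm_dot_le)
      also have "\<dots> \<le> norm \<alpha> * (e + norm a)"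
        using norm_triangle_ineq4[of z a] e[OF that] by (intro mult_left_mono) auto
      finally show ?thesis .
    qed
    then show thesis using that by blast
  qed
  define A where "A = enn2real (weighted_norm_sq D \<phi> f)"
  have A: "weighted_norm_sq D \<phi> f = ennreal A" "0 \<le> A"
    using f by (auto simp: A_def A2_def ennreal_enn2real less_top)
  define R where "R s = exp (2 * M - s * \<rho>\<^sup>2) * A" for s
  define m where "m w = \<mu> w - 1 - 2 * Re (F (a + w) - 1)" for w
  define U where "U = (\<lambda>x. \<Sum>j\<in>UNIV. (x $ j) *s v j)"
  have Uf: "orthogonal_transformation U" "\<And>x k. herm (U x) (v k) = x $ k"
    "\<And>j. U (axis j 1) = v j" "\<And>j. U (axis j \<i>) = \<i> *s v j"
    unfolding U_def by (fact unitary_frame_isometry[OF v])+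
  define J where "J = range (\<lambda>i. axis (\<sigma> i) (1::complex)) \<union> range (\<lambda>i. axis (\<sigma> i) \<i>)"
  have sumJ: "(\<Sum>d\<in>J. G d) = (\<Sum>i\<in>UNIV. G (axis (\<sigma> i) 1) + G (axis (\<sigma> i) \<i>))" for G :: "complex ^ 'n \<Rightarrow> 'x::comm_monoid_add"
  proof -
    have inj: "inj (\<lambda>i. axis (\<sigma> i) c :: complex ^ 'n)" if "c \<noteq> 0" for c
      using that \<sigma> by (auto simp: inj_def axis_eq_axis)
    have "range (\<lambda>i. axis (\<sigma> i) 1 :: complex ^ 'n) \<inter> range (\<lambda>i. axis (\<sigma> i) \<i>) = {}"
      by (auto simp: axis_eq_axis)
    then show ?thesis
      unfolding J_def by (simp add: sum.union_disjoint sum.reindex inj sum.distrib)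
  qed
  have J: "J \<subseteq> Basis" by (auto simp: J_def complex_vec_Basis)
  have cardJ: "real (card J) / 2 = r"
  proof -
    have "card J = (\<Sum>d\<in>J. 1)" by simp
    also have "\<dots> = 2 * CARD('r)" unfolding sumJ by simp
    finally show ?thesis by (simp add: r_def)
  qed
  have tU: "t (U x) = (\<Sum>d\<in>J. (x \<bullet> d)\<^sup>2)" for x
    unfolding sumJ by (simp add: t_def dotb Uf(2) inner_axis inner_complex_def cmod_power2)
  have cdot: "continuous_on S (dot x)" for S and x :: "complex ^ 'n"
    using has_derivative_dot by (meson continuous_at_imp_continuous_on has_derivative_continuous)
  have ct: "continuous_on S t" for S unfolding t_def by (intro continuous_intros cdot)
  have cF: "continuous_on (cball 0 \<rho>) (\<lambda>w. F (a + w))"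
    by (rule continuous_on_compose2[OF holomorphic_functions_continuous[OF model(4)]])
      (auto intro!: continuous_intros subsetD[OF model(3)])
  have cm: "continuous_on (cball 0 \<rho>) m" unfolding m_def by (intro continuous_intros model cF)
  have c\<phi>: "continuous_on D \<phi>"
    using Ck_on_2D(1)[OF C2] by (meson continuous_at_imp_continuous_on has_derivative_continuous)
  have c\<psi>: "continuous_on D (shifted_weight s a \<alpha>)" for s
    using shifted_weight_derivative by (meson continuous_at_imp_continuous_on has_derivative_continuous)
  have cmult: "(\<integral>\<^sup>+z. ennreal c * (ennreal ((norm (f z))\<^sup>2 * exp (- \<phi> z)) * indicator D z) \<partial>lborel)
      = ennreal c * weighted_norm_sq D \<phi> f" for c
    unfolding weighted_norm_sq_def
  proof (rule nn_integral_cmult)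
    have eq: "(\<lambda>z. ennreal ((norm (f z))\<^sup>2 * exp (- \<phi> z)) * indicator D z)
        = (\<lambda>z. ennreal (indicator D z *\<^sub>R ((norm (f z))\<^sup>2 * exp (- \<phi> z))))"
      by (auto simp: fun_eq_iff indicator_def)
    have "continuous_on D (\<lambda>z. (norm (f z))\<^sup>2 * exp (- \<phi> z))"
      by (intro continuous_intros c\<phi> holomorphic_functions_continuous[OF fh])
    then have "(\<lambda>z. indicator D z *\<^sub>R ((norm (f z))\<^sup>2 * exp (- \<phi> z))) \<in> borel_measurable borel"
      using D(1) by (intro borel_measurable_continuous_on_indicator) auto
    then show "(\<lambda>z. ennreal ((norm (f z))\<^sup>2 * exp (- \<phi> z)) * indicator D z) \<in> borel_measurable lborel"
      unfolding eq by simp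
  qed
  \<comment> \<open>From \<open>s \<ge> r + 2\<close> on, \<open>s + t - r / s \<ge> 1\<close> and the Nakano form is positive.\<close>
  define s0 where "s0 = r + 2"
  have ineq: "(\<integral>w. indicator (cball 0 \<rho>) w *
       (((m w + 1) * (t w - r / s) - \<mu> w * (t w - r / s)\<^sup>2 / (s + (t w - r / s)) - 2 * C\<^sup>2 * ((norm w)\<^sup>2)\<^sup>2 * t w)
         * exp (- s * (norm w)\<^sup>2)) \<partial>lborel) \<le> s\<^sup>2 * R s / K" if s: "s0 \<le> s" for s
  proof -
    have sp: "0 < s" "1 \<le> s" "r + 2 \<le> s" using s r by (auto simp: s0_def)
    have rs: "r / s \<le> 1" using sp by (simp add: divide_le_eq)
    have den: "1 \<le> s + t w - r / s" for w using sp rs r t0[of w] by linarith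
    define \<psi> where "\<psi> = shifted_weight s a \<alpha>"
    define g where "g = affine_map a b (sqrt s)"
    have gh: "(\<lambda>z. g z $ \<nu>) \<in> holomorphic_functions D" for \<nu> unfolding g_def by (rule affine_map_holomorphic)
    have gnz: "g z \<noteq> 0" for z unfolding g_def using sp by (intro affine_map_nonzero) simp
    have ng: "(norm (g z))\<^sup>2 = s + t (z - a)" for z using sp by (simp add: g_def norm_affine_map t_def)
    have beta: "(norm (beta g z))\<^sup>2 \<le> r" for z
      unfolding g_def nb[symmetric] using sp by (intro norm_beta_affine_map) simp
    have big: "r < s * (norm (g z))\<^sup>2" for z
    proof -
      have "s * 1 \<le> s * (norm (g z))\<^sup>2" unfolding ng using sp t0[of "z - a"] by (intro mult_left_mono) auto
      then show ?thesis using sp by linarith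
    qed
    have beta': "(norm (beta g z))\<^sup>2 < s * (norm (g z))\<^sup>2" for z using beta[of z] big[of z] by linarith
    have levi: "levi \<psi> z $ j $ l = (if j = l then of_real s else 0)" for z j l
      unfolding \<psi>_def by (rule levi_shifted_weight)
    have nak: "nakano_positive D \<psi> g"
      unfolding nakano_positive_def using nakano_form_scalar_levi[OF levi gnz beta'] by blast
    have "dot (b i) (v (\<sigma> j)) = (if i = j then 1 else 0)" for i j
      unfolding dotb using v[of "\<sigma> j" "\<sigma> i"] \<sigma> by (auto simp: inj_eq)
    then have "wedge_dg g z (\<lambda>j. v (\<sigma> j)) = 1" for z unfolding g_def by (rule wedge_affine_map)
    then have wedge: "\<exists>v. wedge_dg g z v \<noteq> 0" for z by (metis zero_neq_one)
    define I' where "I' = (\<integral>\<^sup>+z\<in>D. ennreal (1 / (s + t (z - a) - r / s) * ((norm (f z))\<^sup>2 * exp (- \<phi> z - \<psi> z))) \<partial>lborel)"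
    have I: "I_functional D \<phi> \<psi> g f \<le> I'"
      unfolding I_functional_def I'_def
    proof (intro nn_integral_mono)
      fix z
      have "ennreal ((1 / (norm (g z))\<^sup>2 +
         Re (herm_form (inv (curv_op \<psi> g z) (beta_star_wedge_dz g z)) (beta_star_wedge_dz g z)))
          * (norm (f z))\<^sup>2 * exp (- \<phi> z - \<psi> z)) \<le> ennreal (1 / (s + t (z - a) - r / s) * ((norm (f z))\<^sup>2 * exp (- \<phi> z - \<psi> z)))"
        if z: "z \<in> D"
      proof -
        have "s / (s * (norm (g z))\<^sup>2 - (norm (beta g z))\<^sup>2) \<le> s / (s * (norm (g z))\<^sup>2 - r)"
          using sp beta[of z] big[of z] by (intro divide_left_mono) auto
        also have "s * (norm (g z))\<^sup>2 - r = s * (s + t (z - a) - r / s)" using sp by (simp add: ng algebra_simps)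
        also have "s / (s * (s + t (z - a) - r / s)) = 1 / (s + t (z - a) - r / s)" using sp by simp
        finally have "s / (s * (norm (g z))\<^sup>2 - (norm (beta g z))\<^sup>2) \<le> 1 / (s + t (z - a) - r / s)" .
        then have "s / (s * (norm (g z))\<^sup>2 - (norm (beta g z))\<^sup>2) * ((norm (f z))\<^sup>2 * exp (- \<phi> z - \<psi> z))
            \<le> 1 / (s + t (z - a) - r / s) * ((norm (f z))\<^sup>2 * exp (- \<phi> z - \<psi> z))" by (intro mult_right_mono) auto
        then show ?thesis
          unfolding I_integrand_scalar_levi[OF gh z gnz levi beta'] by (intro ennreal_leI) (simp only: mult.assoc)
      qed
      then show "ennreal ((1 / (norm (g z))\<^sup>2 +
         Re (herm_form (inv (curv_op \<psi> g z) (beta_star_wedge_dz g z)) (beta_star_wedge_dz g z)))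
          * (norm (f z))\<^sup>2 * exp (- \<phi> z - \<psi> z)) * indicator D z
          \<le> ennreal (1 / (s + t (z - a) - r / s) * ((norm (f z))\<^sup>2 * exp (- \<phi> z - \<psi> z))) * indicator D z"
        by (cases "z \<in> D") auto
    qed
    have tail: "(\<integral>\<^sup>+z\<in>S. ennreal ((norm (f z))\<^sup>2 * exp (- \<phi> z - \<psi> z)) \<partial>lborel) \<le> ennreal (exp (2 * M - s * d) * A)"
      if S: "S \<subseteq> D" "\<And>z. z \<in> S \<Longrightarrow> d \<le> (norm (z - a))\<^sup>2" for S d
    proof -
      have "(norm (f z))\<^sup>2 * exp (- \<phi> z - \<psi> z) \<le> exp (2 * M - s * d) * ((norm (f z))\<^sup>2 * exp (- \<phi> z))"
        if z: "z \<in> S" for z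
      proof -
        have "s * d \<le> s * (norm (z - a))\<^sup>2" using sp S(2)[OF z] by (intro mult_left_mono) auto
        then have "- \<psi> z \<le> 2 * M - s * d" using M[of z] S(1) z by (auto simp: \<psi>_def shifted_weight_def)
        then have "exp (- \<phi> z - \<psi> z) \<le> exp (2 * M - s * d) * exp (- \<phi> z)" unfolding exp_add[symmetric] by simp
        then have "(norm (f z))\<^sup>2 * exp (- \<phi> z - \<psi> z) \<le> (norm (f z))\<^sup>2 * (exp (2 * M - s * d) * exp (- \<phi> z))"
          by (intro mult_left_mono) auto
        then show ?thesis by (simp add: mult_ac)
      qed
      then have "(\<integral>\<^sup>+z\<in>S. ennreal ((norm (f z))\<^sup>2 * exp (- \<phi> z - \<psi> z)) \<partial>lborel)
          \<le> (\<integral>\<^sup>+z. ennreal (exp (2 * M - s * d)) * (ennreal ((norm (f z))\<^sup>2 * exp (- \<phi> z)) * indicator D z) \<partial>lborel)"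
        using S(1) by (intro nn_integral_mono)
          (auto simp: indicator_def ennreal_mult[symmetric] subset_iff intro!: ennreal_leI)
      also have "\<dots> = ennreal (exp (2 * M - s * d) * A)" unfolding cmult by (simp add: A ennreal_mult)
      finally show ?thesis .
    qed
    have v: "0 \<le> 1 / (s + t (z - a) - r / s)" "1 / (s + t (z - a) - r / s) \<le> 1" for z
      using den[of "z - a"] by (auto simp: divide_le_eq_1)
    have "I' \<le> (\<integral>\<^sup>+z\<in>D. ennreal ((norm (f z))\<^sup>2 * exp (- \<phi> z - \<psi> z)) \<partial>lborel)"
      unfolding I'_def
      by (intro nn_integral_mono mult_right_mono ennreal_leI mult_left_le_one_le v) auto
    also have "\<dots> \<le> ennreal (exp (2 * M - s * 0) * A)" by (rule tail) auto
    also have "\<dots> < \<infinity>" by simp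
    finally have "I' < \<infinity>" .
    then have Ifin: "I_functional D \<phi> \<psi> g f < \<infinity>" using I by (rule le_less_trans[rotated])
    have "smooth_on \<psi> D" "plurisubharmonic_on \<psi> D"
      unfolding \<psi>_def using sp by (auto intro: smooth_on_shifted_weight plurisubharmonic_shifted_weight)
    then obtain h where h: "\<And>\<nu>. (\<lambda>z. h z $ \<nu>) \<in> holomorphic_functions D" "\<And>z. z \<in> D \<Longrightarrow> f z = dot (g z) (h z)"
      "weighted_norm_sq D (\<lambda>z. \<phi> z + \<psi> z) h \<le> I_functional D \<phi> \<psi> g f"
      using division[of g \<psi>] gh gnz wedge nak Ifin by blast
    have hI: "weighted_norm_sq D (\<lambda>z. \<phi> z + \<psi> z) h \<le> I'" using h(3) I by (rule order_trans)
    have outer: "(\<integral>\<^sup>+z\<in>D - cball a \<rho>. ennreal ((norm (f z))\<^sup>2 * exp (- \<phi> z - \<psi> z)) \<partial>lborel) \<le> ennreal (R s)"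
      unfolding R_def
    proof (rule tail)
      show "\<rho>\<^sup>2 \<le> (norm (z - a))\<^sup>2" if "z \<in> D - cball a \<rho>" for z
        using that model(1) by (intro power_mono) (auto simp: dist_norm norm_minus_commute)
    qed auto
    have R0: "0 \<le> R s" using A by (simp add: R_def)
    have sk: "1 \<le> s - r / s" using sp rs r by linarith
    let ?\<Gamma> = "\<lambda>w::complex ^ 'n. exp (- s * (norm w)\<^sup>2)"
    let ?L = "\<lambda>w. (s * \<mu> w - 2 * C\<^sup>2 * ((norm w)\<^sup>2)\<^sup>2 * t w - s\<^sup>2 / (s + t w - r / s) * \<mu> w) * ?\<Gamma> w"
    have L: "(\<integral>w. indicator (cball 0 \<rho>) w * ?L w \<partial>lborel) \<le> s\<^sup>2 * R s / K"
      unfolding t_def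
      by (rule inequality_at_scale[OF D(1) fh c\<phi> c\<psi> model(1,3) K model(6) \<mu> W[of _ s, folded K_def] sp(1) sk h(1)
            h(2)[unfolded g_def] hI[unfolded I'_def t_def \<psi>_def] outer[unfolded \<psi>_def] R0])
    \<comment> \<open>Replacing \<open>\<mu>\<close> by \<open>m + 1\<close> in the term linear in \<open>t - r / s\<close> does not change the integral.\<close>
    define k where "k w = 2 * (t w - r / s) * ?\<Gamma> w" for w
    have mean: "(\<integral>w. indicator (cball 0 \<rho>) w * (k w * Re (F (a + w) - 1)) \<partial>lborel) = 0"
    proof (rule integral_holomorphic_circle_invariant[where D = D])
      show "(\<lambda>z. F z - 1) \<in> holomorphic_functions D"
        using holomorphic_functions_add_const[OF model(4), of "- 1"] by simp
      show "continuous_on UNIV k" unfolding k_def by (intro continuous_intros ct)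
      show "k (cis \<theta> *s w) = k w" for \<theta> w by (simp add: k_def norm_smult t_def dot_smult_right norm_mult)
    qed (use model D in auto)
    have int: "integrable lborel (\<lambda>x. indicator (cball 0 \<rho>) x * H x)" if "continuous_on (cball 0 \<rho>) H" for H :: "complex ^ 'n \<Rightarrow> real"
      using borel_integrable_compact[OF compact_cball that] by simp
    have nz: "s + t w - r / s \<noteq> 0" for w using den[of w] by linarith
    have "(\<integral>w. indicator (cball 0 \<rho>) w * ?L w \<partial>lborel)
       = (\<integral>w. indicator (cball 0 \<rho>) w * ?L w - indicator (cball 0 \<rho>) w * (k w * Re (F (a + w) - 1)) \<partial>lborel)"
    proof -
      have i1: "integrable lborel (\<lambda>w. indicator (cball 0 \<rho>) w * ?L w)"
        by (intro int continuous_intros model(6) ct) (use nz in auto)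
      have i2: "integrable lborel (\<lambda>w. indicator (cball 0 \<rho>) w * (k w * Re (F (a + w) - 1)))"
        unfolding k_def by (intro int continuous_intros cF ct)
      show ?thesis unfolding Bochner_Integration.integral_diff[OF i1 i2] mean diff_0_right ..
    qed
    also have "\<dots> = (\<integral>w. indicator (cball 0 \<rho>) w *
       (((m w + 1) * (t w - r / s) - \<mu> w * (t w - r / s)\<^sup>2 / (s + (t w - r / s)) - 2 * C\<^sup>2 * ((norm w)\<^sup>2)\<^sup>2 * t w)
         * ?\<Gamma> w) \<partial>lborel)"
    proof (intro Bochner_Integration.integral_cong refl)
      fix w
      define y where "y = t w - r / s"
      have y: "s + y \<noteq> 0" using nz[of w] by (simp add: y_def algebra_simps)
      have "s - s\<^sup>2 / (s + y) = y - y\<^sup>2 / (s + y)"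
        using y by (simp add: diff_divide_eq_iff divide_diff_eq_iff power2_eq_square algebra_simps)
      then have "s * \<mu> w - s\<^sup>2 / (s + y) * \<mu> w = \<mu> w * y - \<mu> w * y\<^sup>2 / (s + y)"
        by (metis (no_types, opaque_lifting) left_diff_distrib mult.commute right_diff_distrib times_divide_eq_right)
      moreover have "\<mu> w = m w + 1 + 2 * Re (F (a + w) - 1)" by (simp add: m_def)
      then have "\<mu> w * y = (m w + 1) * y + 2 * y * Re (F (a + w) - 1)"
        by (simp only:) (simp add: algebra_simps)
      ultimately have eq: "s * \<mu> w - s\<^sup>2 / (s + y) * \<mu> w - 2 * y * Re (F (a + w) - 1) = (m w + 1) * y - \<mu> w * y\<^sup>2 / (s + y)"
        by linarith
      have sy: "s + t w - r / s = s + y" by (simp add: y_def)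
      have alg: "(A - c - B) * e - (2 * y * e) * q = ((A - B - 2 * y * q) - c) * e" for A B c e q :: real
        by (simp add: algebra_simps)
      have "?L w - k w * Re (F (a + w) - 1)
          = ((m w + 1) * y - \<mu> w * y\<^sup>2 / (s + y) - 2 * C\<^sup>2 * ((norm w)\<^sup>2)\<^sup>2 * t w) * ?\<Gamma> w"
        unfolding k_def y_def[symmetric] sy alg eq ..
      then show "indicator (cball 0 \<rho>) w * ?L w - indicator (cball 0 \<rho>) w * (k w * Re (F (a + w) - 1))
        = indicator (cball 0 \<rho>) w * (((m w + 1) * (t w - r / s) - \<mu> w * (t w - r / s)\<^sup>2 / (s + (t w - r / s))
           - 2 * C\<^sup>2 * ((norm w)\<^sup>2)\<^sup>2 * t w) * ?\<Gamma> w)"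
        unfolding y_def right_diff_distrib[symmetric] by (rule arg_cong)
    qed
    finally show ?thesis using L by simp
  qed
  let ?S = "second_derivative \<phi> a"
  have lin: "linear (\<lambda>u. ?S u x)" "linear (?S x)" for x
    using second_derivative_linear[OF C2 D(1) a(1)] by auto
  have le: "(\<integral>x. - (?S (U x) (U x) / 2) * ((\<Sum>d\<in>J. (x \<bullet> d)\<^sup>2) - r) * exp (- (norm x)\<^sup>2) \<partial>lborel) \<le> 0"
  proof (rule limit_inequality[OF Uf(1) J cardJ model(1,2,6) cm ct])
    show "\<bar>m w\<bar> \<le> C * (norm w)\<^sup>2" if "norm w \<le> \<rho>" for w using m[OF that] by (simp add: m_def)
    show "\<bar>\<mu> w - 1\<bar> \<le> C * (norm w)\<^sup>2" if "norm w \<le> \<rho>" for w by (rule \<mu>(2)[OF that])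
    show "((\<lambda>s. s * m ((1 / sqrt s) *\<^sub>R x)) \<longlongrightarrow> - (?S x x / 2)) at_top" for x
      unfolding m_def by (rule lim)
    show "(\<lambda>x. - (?S x x / 2)) \<in> borel_measurable borel"
      by (subst bilinear_expansion[OF lin(2,1)]) measurable
    show "t (U x) = (\<Sum>d\<in>J. (x \<bullet> d)\<^sup>2)" for x by (rule tU)
    show "t (c *\<^sub>R x) = c\<^sup>2 * t x" for c x
      by (simp add: t_def dot_scaleR_right power_mult_distrib sum_distrib_left)
    show "\<forall>\<^sub>F s in at_top. (\<integral>w. indicator (cball 0 \<rho>) w *
       (((m w + 1) * (t w - r / s) - \<mu> w * (t w - r / s)\<^sup>2 / (s + (t w - r / s)) - 2 * C\<^sup>2 * ((norm w)\<^sup>2)\<^sup>2 * t w)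
         * exp (- s * (norm w)\<^sup>2)) \<partial>lborel) \<le> s\<^sup>2 * R s / K"
      using eventually_ge_at_top[of s0] by eventually_elim (rule ineq)
    have "0 < \<rho>\<^sup>2" using model(1) by simp
    from exp_decay[OF this, of "exp (2 * M) * A / K" "CARD('n) + 2 + 2"]
    have decay: "((\<lambda>s. exp (2 * M) * A / K * (s ^ (CARD('n) + 2 + 2) * exp (- (\<rho>\<^sup>2 * s)))) \<longlongrightarrow> 0) at_top" .
    have eq: "exp (2 * M) * A / K * (s ^ (CARD('n) + 2 + 2) * exp (- (\<rho>\<^sup>2 * s))) = s ^ (CARD('n) + 2) * (s\<^sup>2 * R s / K)" for s
      unfolding R_def power_add[of s "CARD('n) + 2" 2] exp_diff by (simp add: exp_minus divide_inverse mult_ac)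
    show "((\<lambda>s. s ^ (CARD('n) + 2) * (s\<^sup>2 * R s / K)) \<longlongrightarrow> 0) at_top" using decay unfolding eq .
  qed
  define G where "G = (\<integral>x. exp (- (norm (x :: complex ^ 'n))\<^sup>2) \<partial>lborel)"
  have "0 < G" unfolding G_def by (rule gaussian_moments(1)[OF SOME_Basis SOME_Basis])
  have linU: "linear U" using Uf(1) by (rule orthogonal_transformation_linear)
  have "has_bochner_integral lborel
     (\<lambda>x. ?S (U x) (U x) * ((\<Sum>d\<in>J. (x \<bullet> d)\<^sup>2) - r) * exp (- (norm x)\<^sup>2)) (G / 2 * (\<Sum>d\<in>J. ?S (U d) (U d)))"
    using gaussian_covariance_quadratic[of "\<lambda>x y. ?S (U x) (U y)" J]
      linear_compose[OF linU lin(1), unfolded o_def] linear_compose[OF linU lin(2), unfolded o_def] J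
    by (simp add: cardJ G_def)
  from has_bochner_integral_mult_right[OF this, of "- 1 / 2"]
  have eq: "(\<integral>x. - (?S (U x) (U x) / 2) * ((\<Sum>d\<in>J. (x \<bullet> d)\<^sup>2) - r) * exp (- (norm x)\<^sup>2) \<partial>lborel)
      = - (G / 4) * (\<Sum>d\<in>J. ?S (U d) (U d))"
    by (simp add: has_bochner_integral_iff mult.assoc)
  have "- (G / 4) * (\<Sum>d\<in>J. ?S (U d) (U d)) \<le> 0" using le unfolding eq .
  then have "0 \<le> (\<Sum>d\<in>J. ?S (U d) (U d))" using \<open>0 < G\<close> by (simp add: zero_le_mult_iff)
  then show ?thesis by (simp add: sumJ Uf)
qed

theorem theorem1p5:
  fixes D :: "(complex ^ 'n) set" and \<phi> :: "complex ^ 'n \<Rightarrow> real" and r :: nat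
  assumes "open D" and "connected D" and "D \<noteq> {}" and "bounded D"
    and "Ck_on 2 \<phi> D"
    and "1 \<le> r" and "r \<le> CARD('n)" and "CARD('r::finite) = r"
    and "\<exists>f \<in> A2 D \<phi>. (\<exists>z\<in>D. f z \<noteq> 0) \<and>
      (\<forall>(g :: complex ^ 'n \<Rightarrow> complex ^ ('r::finite option)) \<psi>.
         (\<forall>\<nu>. (\<lambda>z. g z $ \<nu>) \<in> holomorphic_functions D) \<and>
         (\<forall>z\<in>D. g z \<noteq> 0) \<and>
         (\<forall>z\<in>D. \<exists>v. wedge_dg g z v \<noteq> 0) \<and>
         smooth_on \<psi> D \<and> plurisubharmonic_on \<psi> D \<and>
         nakano_positive D \<psi> g \<and>
         I_functional D \<phi> \<psi> g f < \<infinity>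
         \<longrightarrow> (\<exists>h :: complex ^ 'n \<Rightarrow> complex ^ ('r::finite option).
               (\<forall>\<nu>. (\<lambda>z. h z $ \<nu>) \<in> holomorphic_functions D) \<and>
               (\<forall>z\<in>D. f z = dot (g z) (h z)) \<and>
               weighted_norm_sq D (\<lambda>z. \<phi> z + \<psi> z) h \<le> I_functional D \<phi> \<psi> g f))"
  shows "\<forall>z\<in>D. \<forall>M. M \<subseteq># eigenvalues (levi \<phi> z) \<and> size M = r \<longrightarrow> 0 \<le> (\<Sum>c\<in>#M. Re c)"
proof (intro ballI allI impI, elim conjE)
  fix z0 M assume z0: "z0 \<in> D" and M: "M \<subseteq># eigenvalues (levi \<phi> z0)" "size M = r"
  note D = assms(1,2,4) and C2 = assms(5)
  obtain f where f: "f \<in> A2 D \<phi>" "\<exists>z\<in>D. f z \<noteq> 0"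
    and division: "\<And>(g :: complex ^ 'n \<Rightarrow> complex ^ ('r option)) \<psi>.
         (\<forall>\<nu>. (\<lambda>z. g z $ \<nu>) \<in> holomorphic_functions D) \<and>
         (\<forall>z\<in>D. g z \<noteq> 0) \<and>
         (\<forall>z\<in>D. \<exists>v. wedge_dg g z v \<noteq> 0) \<and>
         smooth_on \<psi> D \<and> plurisubharmonic_on \<psi> D \<and>
         nakano_positive D \<psi> g \<and>
         I_functional D \<phi> \<psi> g f < \<infinity>
         \<Longrightarrow> (\<exists>h :: complex ^ 'n \<Rightarrow> complex ^ ('r option).
               (\<forall>\<nu>. (\<lambda>z. h z $ \<nu>) \<in> holomorphic_functions D) \<and>
               (\<forall>z\<in>D. f z = dot (g z) (h z)) \<and>
               weighted_norm_sq D (\<lambda>z. \<phi> z + \<psi> z) h \<le> I_functional D \<phi> \<psi> g f)"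
    using assms(9) by blast
  have fh: "f \<in> holomorphic_functions D" using f(1) by (simp add: A2_def)
  have herm: "levi \<phi> z0 $ i $ j = cnj (levi \<phi> z0 $ j $ i)" for i j
    by (rule levi_hermitian[OF C2 D(1) z0])
  have size: "size M = CARD('r)" using M(2) assms(8) by simp
  obtain v :: "'n \<Rightarrow> complex ^ 'n" and \<sigma> :: "'r \<Rightarrow> 'n"
    where v: "\<And>i j. herm (v i) (v j) = (if i = j then 1 else 0)" and \<sigma>: "inj \<sigma>"
    and sum: "(\<Sum>c\<in>#M. Re c) = (\<Sum>i\<in>UNIV. Re (\<Sum>j\<in>UNIV. \<Sum>l\<in>UNIV. levi \<phi> z0 $ j $ l * v (\<sigma> i) $ j * cnj (v (\<sigma> i) $ l)))"
    using eigenvalue_sum_frame[OF herm M(1) size] by blast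
  \<comment> \<open>Four times the trace of the Levi form over the frame.\<close>
  define T where "T z = (\<Sum>i\<in>UNIV. second_derivative \<phi> z (v (\<sigma> i)) (v (\<sigma> i)) + second_derivative \<phi> z (\<i> *s v (\<sigma> i)) (\<i> *s v (\<sigma> i)))" for z
  have sumT: "(\<Sum>c\<in>#M. Re c) = T z0 / 4"
    unfolding sum T_def Re_levi_form[OF C2 D(1) z0] by (simp add: sum_divide_distrib)
  have "isCont T z0"
  proof -
    have "continuous_on D T"
      unfolding T_def by (intro continuous_intros Ck_on_2D(3)[OF C2])
    then show ?thesis using D(1) z0 by (simp add: continuous_on_eq_continuous_at)
  qed
  show "0 \<le> (\<Sum>c\<in>#M. Re c)"
  proof (rule ccontr)
    assume "\<not> ?thesis"
    then have neg: "T z0 < 0" by (simp add: sumT)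
    obtain e where e: "0 < e" "\<And>z. dist z z0 < e \<Longrightarrow> \<bar>T z - T z0\<bar> < - T z0"
      using \<open>isCont T z0\<close> neg unfolding continuous_at_eps_delta dist_real_def by (metis neg_0_less_iff_less)
    obtain z1 where z1: "z1 \<in> D" "f z1 \<noteq> 0" using f(2) by blast
    obtain a where a: "a \<in> D" "dist z0 a < e" "f a \<noteq> 0"
      by (rule holomorphic_functions_nonzero_dense[OF D(1,2) fh z1 z0 e(1)])
    have "0 \<le> T a"
      unfolding T_def by (rule frame_trace_nonneg[OF D(1,3) C2 f(1) a(1,3) v \<sigma> division])
    moreover have "\<bar>T a - T z0\<bar> < - T z0" using e(2)[of a] a(2) by (simp add: dist_commute)
    ultimately show False by linarith
  qed
qed

end
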